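(* Let $F$ be a non-Archimedean local field of odd residue characteristic, $K=F((t))$, $G=\mathrm{PGL}_2$, and $P\subset G$ the upper triangular Borel subgroup. There is no (smooth) representation of $G(K)$ whose restriction to $P(K)$ is isomorphic to $\Upsilon$.
   Context: $O=F[[t]]$, $v$ the valuation of $K$ with $v(t)=1$. $P(K)=K^*\ltimes K$, $(a,b)\leftrightarrow\begin{pmatrix}a&b\\0&1\end{pmatrix}$; $\widehat a=(a,0)$, $\widetilde b=(1,b)$; $P_0=O^*\ltimes K$. Fix an additive character $\widetilde\psi:F\to\mathbb C^*$ trivial on $\varpi O_F$ and nontrivial on $O_F$ ($\varpi$ a uniformizer of $F$), and put $\psi(f)=\widetilde\psi(\mathrm{Res}_{t=0}(f\,dt))$ for $f\in K$. *Smooth representations.* Let $\mathbb V\mathrm{ect}$ be the category of countable pro-objects in complex vector spaces of at most countable dimension. $G(K)$ is the union of $X^n$ = classes of $A=(a_{ij})\in\mathrm{GL}_2(K)$ with $2\min v(a_{ij})-v(\det A)\ge-n$, and $X^n=\varprojlim_mX^n_m$, $X^n_m=X^n/G(O)(m+1)$, where $G(O)(m+1)=\ker(G(O)\to G(O/t^{m+1}))$; each $X^n_m$ is the set of $F$-points of an $F$-variety with its natural topology. For $\mathbb V=\varprojlim_lV_l$ put $a(G(K),\mathbb V)=\varprojlim_n\varprojlim_l\varinjlim_m\{\text{locally constant functions }X^n_m\to V_l\}$. A smooth representation of $G(K)$ on $\mathbb V$ is a morphism $\mathbb V\to a(G(K),\mathbb V)$ satisfying the usual associativity and unit axioms. It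 induces, and is determined by, an action of the abstract group $G(K)$ on $\mathbb V$. Smooth representations of $P(K)$ are defined in the same way using the exhaustion $P^n=\{(a,b):\min(v(a),-v(a),v(b))\ge-n\}$ and quotients $P^n_m=P^n/\{(a,b)\in P(O):v(a-1),v(b)\ge m\}$. *The representation $\Upsilon$.* For $n\ge0$ put $Z_n=O^*/(1+t^{n+1}O)$ and let $\mathcal M_n$ be the space of locally constant compactly supported complex measures on $Z_n$; pushforward gives surjections $\mathcal M_{n+1}\to\mathcal M_n$. Let $\mathcal M=\varprojlim_n\mathcal M_n$ as a pro-vector space. The representation $\rho_0$ of $P_0$ on $\mathcal M$: $\widehat a$, $a\in O^*$, acts by pushforward under $z\mapsto az$; $\widetilde b$, $b\in K$, acts by multiplication by $z\mapsto\psi(bz/t)$ (well defined on $Z_n$ when $b\in t^{-n}O$, compatible with the transition maps). For $m\in\mathbb Z$ put $\rho_m(p)=\rho_0(\widehat t^{\,-m}p\,\widehat t^{\,m})$. Then $\Upsilon=\prod_{m\in\mathbb Z}\mathcal M$, where $P_0$ acts on the $m$-th factor by $\rho_m$ and $\widehat t$ acts by the shift from the $m$-th factor to the $(m+1)$-st; this is a representation of $P(K)=\langle\widehat t\rangle\ltimes P_0$.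
   Formalization: In the definition of ρ_0, â acts by pushforward under z ↦ a^{-1}z instead of z ↦ az; with z ↦ az and multiplication by ψ(bz/t) the formulas do not satisfy the relation â b̃ = (ab)~ â of P(K), so Υ would not be a representation. *)

theory Defs
  imports
    "HOL-Analysis.Analysis"
    "HOL-Computational_Algebra.Formal_Laurent_Series"
    "HOL-Library.Function_Algebras"
begin

section \<open>Non-Archimedean local fields\<close>

text \<open>The valuation is only meaningful on nonzero elements; the value at \<open>0\<close> is irrelevant.
  \<open>vball vF N\<close> is the fractional ideal \<open>\<varpi>\<^sup>N O\<^sub>F\<close>.\<close>

definition vball :: "('f::field \<Rightarrow> int) \<Rightarrow> int \<Rightarrow> 'f set" where
  "vball vF N = {x. x = 0 \<or> vF x \<ge> N}"

locale nonarch_local_field =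
  fixes vF :: "'f::field \<Rightarrow> int"
  assumes val_mult: "\<And>x y. x \<noteq> 0 \<Longrightarrow> y \<noteq> 0 \<Longrightarrow> vF (x * y) = vF x + vF y"
    and val_add: "\<And>x y. x \<noteq> 0 \<Longrightarrow> y \<noteq> 0 \<Longrightarrow> x + y \<noteq> 0 \<Longrightarrow> vF (x + y) \<ge> min (vF x) (vF y)"
    and val_normalized: "\<exists>\<pi>. \<pi> \<noteq> 0 \<and> vF \<pi> = 1"
    and complete: "\<And>s :: nat \<Rightarrow> 'f.
      (\<forall>N. \<exists>n0. \<forall>m\<ge>n0. \<forall>n\<ge>n0. s m - s n \<in> vball vF N)
      \<Longrightarrow> \<exists>x. \<forall>N. \<exists>n0. \<forall>n\<ge>n0. s n - x \<in> vball vF N"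
    and finite_residue_field:
      "finite (vball vF 0 // {(x, y). x \<in> vball vF 0 \<and> y \<in> vball vF 0 \<and> x - y \<in> vball vF 1})"

definition residue_char :: "('f::field \<Rightarrow> int) \<Rightarrow> nat" where
  "residue_char vF = (LEAST p. p > 0 \<and> of_nat p \<in> vball vF 1)"

definition val_topology :: "('f::field \<Rightarrow> int) \<Rightarrow> 'f topology" where
  "val_topology vF = topology_generated_by (range (\<lambda>(x, N). {y. y - x \<in> vball vF N}))"

text \<open>Additive characters of \<open>F\<close> of the required conductor, and the induced character \<open>\<psi>\<close> of
  \<open>K = F((t))\<close>.\<close>

definition additive_char :: "('f::field \<Rightarrow> int) \<Rightarrow> ('f \<Rightarrow> complex) \<Rightarrow> bool" where
  "additive_char vF \<theta> \<longleftrightarrow>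
     (\<forall>x y. \<theta> (x + y) = \<theta> x * \<theta> y) \<and> (\<forall>x. \<theta> x \<noteq> 0) \<and>
     (\<forall>x\<in>vball vF 1. \<theta> x = 1) \<and> (\<exists>x\<in>vball vF 0. \<theta> x \<noteq> 1)"

definition psiK :: "('f::field \<Rightarrow> complex) \<Rightarrow> 'f fls \<Rightarrow> complex" where
  "psiK \<theta> f = \<theta> (fls_residue f)"


section \<open>Countable pro-objects in complex vector spaces of countable dimension\<close>

text \<open>A countable pro-object is given by an inverse system indexed by the natural numbers. All its
  terms are subspaces \<open>sp V l\<close> of one ambient complex vector space with scalar multiplication
  \<open>sc V\<close> (any countable family embeds into its direct sum), and \<open>tr V j i\<close>, for \<open>i \<le> j\<close>, is the
  transition map from the \<open>j\<close>-th to the \<open>i\<close>-th term. Transition maps need not be surjective.\<close>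

record 'v prospace =
  sc :: "complex \<Rightarrow> 'v \<Rightarrow> 'v"
  sp :: "nat \<Rightarrow> 'v set"
  tr :: "nat \<Rightarrow> nat \<Rightarrow> 'v \<Rightarrow> 'v"

definition lin_on ::
  "(complex \<Rightarrow> 'v \<Rightarrow> 'v) \<Rightarrow> (complex \<Rightarrow> 'w \<Rightarrow> 'w) \<Rightarrow>
   'v::ab_group_add set \<Rightarrow> 'w::ab_group_add set \<Rightarrow> ('v \<Rightarrow> 'w) \<Rightarrow> bool" where
  "lin_on s1 s2 S T f \<longleftrightarrow> f ` S \<subseteq> T \<and> (\<forall>x\<in>S. \<forall>y\<in>S. f (x + y) = f x + f y) \<and>
     (\<forall>c. \<forall>x\<in>S. f (s1 c x) = s2 c (f x))"

definition pro_vect :: "'v::ab_group_add prospace \<Rightarrow> bool" where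
  "pro_vect V \<longleftrightarrow> vector_space (sc V) \<and>
     (\<forall>l. module.subspace (sc V) (sp V l) \<and>
          (\<exists>B. countable B \<and> module.span (sc V) B = sp V l)) \<and>
     (\<forall>i j. i \<le> j \<longrightarrow> lin_on (sc V) (sc V) (sp V j) (sp V i) (tr V j i)) \<and>
     (\<forall>i. \<forall>x\<in>sp V i. tr V i i x = x) \<and>
     (\<forall>i j k. i \<le> j \<longrightarrow> j \<le> k \<longrightarrow> (\<forall>x\<in>sp V k. tr V j i (tr V k j x) = tr V k i x))"

text \<open>\<open>Hom(lim V\<^sub>l, lim W\<^sub>k) = lim\<^sub>k colim\<^sub>l Hom(V\<^sub>l, W\<^sub>k)\<close>. A representative of a morphism assigns to
  every \<open>k\<close> a source level \<open>l\<close> and a linear map \<open>V\<^sub>l \<rightarrow> W\<^sub>k\<close>; two representatives are identified by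
  \<open>pro_eq\<close>.\<close>

type_synonym ('v, 'w) pro_rep = "nat \<Rightarrow> nat \<times> ('v \<Rightarrow> 'w)"

definition pro_mor ::
  "'v::ab_group_add prospace \<Rightarrow> 'w::ab_group_add prospace \<Rightarrow> ('v, 'w) pro_rep \<Rightarrow> bool" where
  "pro_mor V W \<Phi> \<longleftrightarrow>
     (\<forall>k. lin_on (sc V) (sc W) (sp V (fst (\<Phi> k))) (sp W k) (snd (\<Phi> k))) \<and>
     (\<forall>k j. k \<le> j \<longrightarrow> (\<exists>L. L \<ge> fst (\<Phi> k) \<and> L \<ge> fst (\<Phi> j) \<and>
        (\<forall>x\<in>sp V L. tr W j k (snd (\<Phi> j) (tr V L (fst (\<Phi> j)) x)) =
                     snd (\<Phi> k) (tr V L (fst (\<Phi> k)) x))))"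

definition pro_eq :: "'v prospace \<Rightarrow> ('v, 'w) pro_rep \<Rightarrow> ('v, 'w) pro_rep \<Rightarrow> bool" where
  "pro_eq V \<Phi> \<Psi> \<longleftrightarrow>
     (\<forall>k. \<exists>L. L \<ge> fst (\<Phi> k) \<and> L \<ge> fst (\<Psi> k) \<and>
        (\<forall>x\<in>sp V L. snd (\<Phi> k) (tr V L (fst (\<Phi> k)) x) = snd (\<Psi> k) (tr V L (fst (\<Psi> k)) x)))"

definition pro_id :: "('v, 'v) pro_rep" where
  "pro_id = (\<lambda>k. (k, \<lambda>x. x))"

definition pro_comp :: "('v, 'w) pro_rep \<Rightarrow> ('u, 'v) pro_rep \<Rightarrow> ('u, 'w) pro_rep" where
  "pro_comp \<Psi> \<Phi> = (\<lambda>k. (fst (\<Phi> (fst (\<Psi> k))), \<lambda>x. snd (\<Psi> k) (snd (\<Phi> (fst (\<Psi> k))) x)))"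

definition pro_iso ::
  "'v::ab_group_add prospace \<Rightarrow> 'w::ab_group_add prospace \<Rightarrow> ('v, 'w) pro_rep \<Rightarrow> bool" where
  "pro_iso V W \<Phi> \<longleftrightarrow> pro_mor V W \<Phi> \<and>
     (\<exists>\<Psi>. pro_mor W V \<Psi> \<and> pro_eq V (pro_comp \<Psi> \<Phi>) pro_id \<and> pro_eq W (pro_comp \<Phi> \<Psi>) pro_id)"


section \<open>The group \<open>G(K)\<close> and its exhaustion\<close>

definition tO :: "int \<Rightarrow> 'f::field fls set" where
  "tO r = {f. f = 0 \<or> fls_subdegree f \<ge> r}"

definition O_units :: "'f::field fls set" where
  "O_units = {f. f \<noteq> 0 \<and> fls_subdegree f = 0}"

type_synonym 'f mat2 = "'f fls ^ 2 ^ 2"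

definition GL2K :: "'f::field mat2 set" where
  "GL2K = {A. invertible A}"

text \<open>\<open>PGL\<^sub>2(K)\<close> is \<open>GL\<^sub>2(K)\<close> modulo the nonzero scalars. Subsets of it are given by their preimages
  in \<open>GL\<^sub>2(K)\<close>, functions on it by functions of matrices that do not change under nonzero scalars.
  The following is the preimage of \<open>X\<^sup>n\<close>; vanishing entries have valuation \<open>\<infinity>\<close>.\<close>

definition XG :: "nat \<Rightarrow> 'f::field mat2 set" where
  "XG n = {A \<in> GL2K. \<forall>i j. A $ i $ j \<noteq> 0 \<longrightarrow>
            2 * fls_subdegree (A $ i $ j) - fls_subdegree (det A) \<ge> - int n}"

text \<open>\<open>GO_cong r\<close> is the kernel of reduction modulo \<open>t\<^sup>r\<close> on \<open>GL\<^sub>2(O)\<close>; for \<open>r > 0\<close> its image in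
  \<open>PGL\<^sub>2(O)\<close> is the kernel of \<open>PGL\<^sub>2(O) \<rightarrow> PGL\<^sub>2(O/t\<^sup>r)\<close>, because every unit of \<open>O/t\<^sup>r\<close> lifts to
  \<open>O\<close>.\<close>

definition GO_cong :: "nat \<Rightarrow> 'f::field mat2 set" where
  "GO_cong r = {h. (\<forall>i j. h $ i $ j \<in> tO 0) \<and> det h \<in> O_units \<and>
                   (\<forall>i j. (h - mat 1) $ i $ j \<in> tO (int r))}"

text \<open>The topology of \<open>GL\<^sub>2(K)\<close>: coefficientwise convergence of the matrix entries, with the
  valuation of the determinant locally constant (the determinant of a family of points of the
  ind-scheme \<open>GL\<^sub>2((t))\<close> is a family of units of Laurent series). Only its restriction to the sets
  \<open>XG n\<close> is used; there, fixing the valuation of the determinant bounds the poles of the entries. The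
  projection \<open>X\<^sup>n \<rightarrow> X\<^sup>n\<^sub>m\<close> has continuous local sections, so the natural topology on the
  \<open>F\<close>-points of \<open>X\<^sup>n\<^sub>m\<close> is the quotient topology.\<close>

definition GL2K_topology :: "('f::field \<Rightarrow> int) \<Rightarrow> 'f mat2 topology" where
  "GL2K_topology vF = pullback_topology GL2K
     (\<lambda>A. (\<lambda>(i, j, k). fls_nth (A $ i $ j) k, fls_subdegree (det A)))
     (prod_topology (product_topology (\<lambda>_::2 \<times> 2 \<times> int. val_topology vF) UNIV)
                    (discrete_topology UNIV))"

text \<open>\<open>\<phi>\<close> is a locally constant function on \<open>X\<^sup>n\<^sub>m = X\<^sup>n/G(O)(m+1)\<close>.\<close>

definition loc_const_X :: "('f::field \<Rightarrow> int) \<Rightarrow> nat \<Rightarrow> nat \<Rightarrow> ('f mat2 \<Rightarrow> 'v) \<Rightarrow> bool" where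
  "loc_const_X vF n m \<phi> \<longleftrightarrow>
     (\<forall>A\<in>XG n. \<forall>c. c \<noteq> 0 \<longrightarrow> \<phi> (mat c ** A) = \<phi> A) \<and>
     (\<forall>A\<in>XG n. \<forall>h\<in>GO_cong (Suc m). \<phi> (A ** h) = \<phi> A) \<and>
     continuous_map (subtopology (GL2K_topology vF) (XG n)) (discrete_topology UNIV) \<phi>"


section \<open>Smooth representations of \<open>G(K)\<close>\<close>

text \<open>The \<open>(n, l)\<close>-component \<open>colim\<^sub>m {locally constant functions X\<^sup>n\<^sub>m \<rightarrow> V\<^sub>l}\<close> of \<open>a(G(K), V)\<close>. The maps
  \<open>X\<^sup>n\<^sub>m\<^sub>+\<^sub>1 \<rightarrow> X\<^sup>n\<^sub>m\<close> are surjective, so the colimit is a union of spaces of functions on \<open>X\<^sup>n\<close>. Its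
  elements are only considered on \<open>XG n\<close>.\<close>

definition a_space ::
  "('f::field \<Rightarrow> int) \<Rightarrow> 'v prospace \<Rightarrow> nat \<Rightarrow> nat \<Rightarrow> ('f mat2 \<Rightarrow> 'v) set" where
  "a_space vF V n l = {\<phi>. (\<forall>A\<in>XG n. \<phi> A \<in> sp V l) \<and> (\<exists>m. loc_const_X vF n m \<phi>)}"

text \<open>A representative of a morphism \<open>V \<rightarrow> a(G(K), V)\<close> has a source level and a map for each
  component \<open>(n, l)\<close>. The image of \<open>x\<close> is the function \<open>g \<mapsto> g x\<close>.\<close>

type_synonym ('f, 'v) coaction = "nat \<Rightarrow> nat \<Rightarrow> nat \<times> ('v \<Rightarrow> 'f mat2 \<Rightarrow> 'v)"

definition coaction_mor ::
  "('f::field \<Rightarrow> int) \<Rightarrow> 'v::ab_group_add prospace \<Rightarrow> ('f, 'v) coaction \<Rightarrow> bool" where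
  "coaction_mor vF V \<alpha> \<longleftrightarrow>
     (\<forall>n l. (\<forall>x\<in>sp V (fst (\<alpha> n l)). snd (\<alpha> n l) x \<in> a_space vF V n l) \<and>
            (\<forall>g\<in>XG n. lin_on (sc V) (sc V) (sp V (fst (\<alpha> n l))) (sp V l)
                        (\<lambda>x. snd (\<alpha> n l) x g))) \<and>
     (\<forall>n n' l l'. n \<le> n' \<longrightarrow> l \<le> l' \<longrightarrow>
        (\<exists>L. L \<ge> fst (\<alpha> n l) \<and> L \<ge> fst (\<alpha> n' l') \<and>
          (\<forall>x\<in>sp V L. \<forall>g\<in>XG n.
             tr V l' l (snd (\<alpha> n' l') (tr V L (fst (\<alpha> n' l')) x) g) =
             snd (\<alpha> n l) (tr V L (fst (\<alpha> n l)) x) g)))"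

text \<open>Equality of the two morphisms \<open>V \<rightarrow> a(G(K) \<times> G(K), V)\<close>: the source level \<open>L\<close> is uniform in
  \<open>g\<close> and \<open>h\<close>. Note that \<open>X\<^sup>n X\<^sup>n\<^sup>' \<subseteq> X\<^sup>n\<^sup>+\<^sup>n\<^sup>'\<close>.\<close>

definition coaction_assoc :: "('f::field, 'v) coaction \<Rightarrow> 'v prospace \<Rightarrow> bool" where
  "coaction_assoc \<alpha> V \<longleftrightarrow>
     (\<forall>n n' l. let l1 = fst (\<alpha> n l); l2 = fst (\<alpha> n' l1); l3 = fst (\<alpha> (n + n') l) in
        \<exists>L. L \<ge> l2 \<and> L \<ge> l3 \<and>
          (\<forall>x\<in>sp V L. \<forall>g\<in>XG n. \<forall>h\<in>XG n'.
             snd (\<alpha> n l) (snd (\<alpha> n' l1) (tr V L l2 x) h) g =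
             snd (\<alpha> (n + n') l) (tr V L l3 x) (g ** h)))"

definition coaction_unit :: "('f::field, 'v) coaction \<Rightarrow> 'v prospace \<Rightarrow> bool" where
  "coaction_unit \<alpha> V \<longleftrightarrow>
     (\<forall>n l. \<exists>L. L \<ge> fst (\<alpha> n l) \<and> L \<ge> l \<and>
        (\<forall>x\<in>sp V L. snd (\<alpha> n l) (tr V L (fst (\<alpha> n l)) x) (mat 1) = tr V L l x))"

definition smooth_rep ::
  "('f::field \<Rightarrow> int) \<Rightarrow> 'v::ab_group_add prospace \<Rightarrow> ('f, 'v) coaction \<Rightarrow> bool" where
  "smooth_rep vF V \<alpha> \<longleftrightarrow>
     pro_vect V \<and> coaction_mor vF V \<alpha> \<and> coaction_assoc \<alpha> V \<and> coaction_unit \<alpha> V"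

text \<open>The induced action of the abstract group \<open>G(K)\<close> by endomorphisms of the pro-object \<open>V\<close>. Any
  other \<open>n\<close> with \<open>g \<in> XG n\<close> represents the same morphism.\<close>

definition G_act :: "('f::field, 'v) coaction \<Rightarrow> 'f mat2 \<Rightarrow> ('v, 'v) pro_rep" where
  "G_act \<alpha> g = (\<lambda>l. let n = (LEAST n. g \<in> XG n) in (fst (\<alpha> n l), \<lambda>x. snd (\<alpha> n l) x g))"


section \<open>The representation \<open>\<Upsilon>\<close> of \<open>P(K)\<close>\<close>

text \<open>An element of \<open>P(K)\<close> is a pair \<open>(a, b)\<close> with \<open>a \<noteq> 0\<close>; it lies in \<open>P\<^sub>0\<close> if \<open>a\<close> is in \<open>O_units\<close>.\<close>

definition P_mult :: "'f::field fls \<times> 'f fls \<Rightarrow> 'f fls \<times> 'f fls \<Rightarrow> 'f fls \<times> 'f fls" where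
  "P_mult p q = (fst p * fst q, fst p * snd q + snd p)"

definition P_mat :: "'f::field fls \<times> 'f fls \<Rightarrow> 'f mat2" where
  "P_mat p = vector [vector [fst p, snd p], vector [0, 1]]"

definition t_hat :: "int \<Rightarrow> 'f::field fls \<times> 'f fls" where
  "t_hat m = (fls_X_intpow m, 0)"

text \<open>\<open>Z\<^sub>n = O\<^sup>*/(1 + t\<^sup>n\<^sup>+\<^sup>1 O)\<close> is the open subset \<open>z\<^sub>0 \<noteq> 0\<close> of \<open>F\<^sup>n\<^sup>+\<^sup>1\<close>, with coordinates the first
  \<open>n + 1\<close> coefficients. Its open sets are given by their preimages in \<open>O\<^sup>*\<close>; functions that are
  continuous for the (non-Hausdorff) topology below factor through \<open>Z\<^sub>n\<close>, so \<open>LC vF n\<close> is the space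
  of locally constant functions on \<open>Z\<^sub>n\<close>, extended by \<open>0\<close> outside \<open>O\<^sup>*\<close>.\<close>

definition Z_topology :: "('f::field \<Rightarrow> int) \<Rightarrow> nat \<Rightarrow> 'f fls topology" where
  "Z_topology vF n = pullback_topology O_units (\<lambda>z. restrict (fls_nth z) {0..int n})
     (product_topology (\<lambda>_. val_topology vF) {0..int n})"

definition LC :: "('f::field \<Rightarrow> int) \<Rightarrow> nat \<Rightarrow> ('f fls \<Rightarrow> complex) set" where
  "LC vF n = {f. (\<forall>z. z \<notin> O_units \<longrightarrow> f z = 0) \<and>
                 continuous_map (Z_topology vF n) (discrete_topology UNIV) f}"

text \<open>As usual on totally disconnected spaces, a compactly supported complex measure \<open>\<mu>\<close> is given by
  the functional \<open>f \<mapsto> \<integral> f d\<mu>\<close> on locally constant functions. It is locally constant (locally a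
  constant multiple of Haar measure on the group \<open>Z\<^sub>n\<close>) iff, having compact support, it is invariant
  under a neighbourhood of \<open>1\<close>. Functionals are extended by \<open>0\<close> outside \<open>LC vF n\<close>.\<close>

type_synonym 'f functional = "('f fls \<Rightarrow> complex) \<Rightarrow> complex"

definition restrict_meas :: "('f::field \<Rightarrow> int) \<Rightarrow> nat \<Rightarrow> 'f functional \<Rightarrow> 'f functional" where
  "restrict_meas vF n \<mu> = (\<lambda>f. if f \<in> LC vF n then \<mu> f else 0)"

definition measures_Z :: "('f::field \<Rightarrow> int) \<Rightarrow> nat \<Rightarrow> 'f functional set" where
  "measures_Z vF n = {\<mu>.
     (\<forall>f. f \<notin> LC vF n \<longrightarrow> \<mu> f = 0) \<and>
     (\<forall>f\<in>LC vF n. \<forall>g\<in>LC vF n. \<mu> (\<lambda>z. f z + g z) = \<mu> f + \<mu> g) \<and>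
     (\<forall>c. \<forall>f\<in>LC vF n. \<mu> (\<lambda>z. c * f z) = c * \<mu> f) \<and>
     (\<exists>C. compactin (Z_topology vF n) C \<and>
        (\<forall>f\<in>LC vF n. (\<forall>z\<in>C. f z = 0) \<longrightarrow> \<mu> f = 0)) \<and>
     (\<exists>U. openin (Z_topology vF n) U \<and> 1 \<in> U \<and>
        (\<forall>u\<in>U. \<forall>f\<in>LC vF n. \<mu> (\<lambda>z. f (u * z)) = \<mu> f))}"

text \<open>Pullback of functions along \<open>Z\<^sub>j \<rightarrow> Z\<^sub>i\<close> is the inclusion of \<open>LC vF i\<close> in \<open>LC vF j\<close>, so
  pushforward of measures is restriction of functionals.\<close>

definition M_pro :: "('f::field \<Rightarrow> int) \<Rightarrow> 'f functional prospace" where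
  "M_pro vF = \<lparr> sc = (\<lambda>c \<mu> f. c * \<mu> f), sp = measures_Z vF, tr = (\<lambda>j i. restrict_meas vF i) \<rparr>"

text \<open>Pushforward is along \<open>z \<mapsto> a\<^sup>-\<^sup>1 z\<close>: in \<open>P(K)\<close> conjugation by \<open>(a, 0)\<close> takes \<open>(1, b)\<close> to
  \<open>(1, a b)\<close>, and this is the choice for which \<open>rho0\<close> is multiplicative.\<close>

definition hat_act :: "'f::field fls \<Rightarrow> 'f functional \<Rightarrow> 'f functional" where
  "hat_act a \<mu> = (\<lambda>f. \<mu> (\<lambda>z. f (inverse a * z)))"

definition tilde_act :: "('f::field \<Rightarrow> complex) \<Rightarrow> 'f fls \<Rightarrow> 'f functional \<Rightarrow> 'f functional" where
  "tilde_act \<theta> b \<mu> = (\<lambda>f. \<mu> (\<lambda>z. psiK \<theta> (b * z / fls_X) * f z))"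

lemma hat_act_tilde_act:
  assumes "a \<noteq> 0"
  shows "hat_act a (tilde_act \<theta> b \<mu>) = tilde_act \<theta> (a * b) (hat_act a \<mu>)"
proof -
  have "a * b * (inverse a * z) = (a * inverse a) * (b * z)" for z
    by (simp only: mult_ac)
  then have "a * b * (inverse a * z) = b * z" for z
    using assms by simp
  then show ?thesis
    unfolding hat_act_def tilde_act_def by (simp only:)
qed

text \<open>\<open>(a, b) = (1, b)(a, 0)\<close>; the function \<open>\<psi>(b z/t)\<close> is defined on \<open>Z\<^sub>L\<close> if \<open>L \<ge> -v(b)\<close>.\<close>

definition rho0 ::
  "('f::field \<Rightarrow> int) \<Rightarrow> ('f \<Rightarrow> complex) \<Rightarrow> 'f fls \<times> 'f fls \<Rightarrow>
   ('f functional, 'f functional) pro_rep" where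
  "rho0 vF \<theta> p = (\<lambda>n. (nat (max (int n) (- fls_subdegree (snd p))),
     \<lambda>\<mu>. restrict_meas vF n (tilde_act \<theta> (snd p) (hat_act (fst p) \<mu>))))"

definition rho ::
  "('f::field \<Rightarrow> int) \<Rightarrow> ('f \<Rightarrow> complex) \<Rightarrow> int \<Rightarrow> 'f fls \<times> 'f fls \<Rightarrow>
   ('f functional, 'f functional) pro_rep" where
  "rho vF \<theta> m p = rho0 vF \<theta> (P_mult (P_mult (t_hat (- m)) p) (t_hat m))"

text \<open>The product over all integers of copies of \<open>M_pro\<close>, in the category of pro-objects; its
  \<open>N\<close>-th term is the product of the \<open>N\<close>-th terms of the factors with index \<open>-N \<le> m \<le> N\<close> (these
  are cofinal among all finite products of terms).\<close>

definition Upsilon :: "('f::field \<Rightarrow> int) \<Rightarrow> (int \<Rightarrow> 'f functional) prospace" where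
  "Upsilon vF = \<lparr>
     sc = (\<lambda>c x m. sc (M_pro vF) c (x m)),
     sp = (\<lambda>N. {x. \<forall>m. if \<bar>m\<bar> \<le> int N then x m \<in> sp (M_pro vF) N else x m = 0}),
     tr = (\<lambda>j i x m. if \<bar>m\<bar> \<le> int i then tr (M_pro vF) j i (x m) else 0) \<rparr>"

text \<open>With \<open>k = v(a)\<close>, the element \<open>p = (a, b)\<close> is the product of \<open>p\<^sub>0 = (a t\<^sup>-\<^sup>k, b)\<close> in \<open>P\<^sub>0\<close> and the
  \<open>k\<close>-th power of \<open>(t, 0)\<close>, which acts by the shift by \<open>k\<close>. The source level \<open>L\<close> is large
  enough for \<open>\<bar>m - k\<bar> \<le> L\<close> and for \<open>rho vF \<theta> m p\<^sub>0\<close> at level \<open>N\<close> to start at a level \<open>\<le> L\<close>,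
  for all \<open>\<bar>m\<bar> \<le> N\<close>.\<close>

definition Upsilon_act ::
  "('f::field \<Rightarrow> int) \<Rightarrow> ('f \<Rightarrow> complex) \<Rightarrow> 'f fls \<times> 'f fls \<Rightarrow>
   (int \<Rightarrow> 'f functional, int \<Rightarrow> 'f functional) pro_rep" where
  "Upsilon_act vF \<theta> p = (\<lambda>N.
     let k = fls_subdegree (fst p);
         p0 = P_mult p (t_hat (- k));
         L = N + nat \<bar>k\<bar> + nat \<bar>fls_subdegree (snd p)\<bar>
     in (L, \<lambda>x m. if \<bar>m\<bar> \<le> int N
                  then snd (rho vF \<theta> m p0 N)
                         (tr (M_pro vF) L (fst (rho vF \<theta> m p0 N)) (x (m - k)))
                  else 0))"

text \<open>An isomorphism of pro-objects from \<open>V\<close> to \<open>\<Upsilon>\<close> commuting with the actions of \<open>P(K)\<close>.\<close>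

definition restricts_to_Upsilon ::
  "('f::field \<Rightarrow> int) \<Rightarrow> ('f \<Rightarrow> complex) \<Rightarrow> 'v::ab_group_add prospace \<Rightarrow> ('f, 'v) coaction \<Rightarrow> bool"
  where
  "restricts_to_Upsilon vF \<theta> V \<alpha> \<longleftrightarrow>
     (\<exists>\<Phi>. pro_iso V (Upsilon vF) \<Phi> \<and>
       (\<forall>a b. a \<noteq> 0 \<longrightarrow>
          pro_eq V (pro_comp \<Phi> (G_act \<alpha> (P_mat (a, b))))
                   (pro_comp (Upsilon_act vF \<theta> (a, b)) \<Phi>)))"

end

theory Submission
  imports Defs
begin

text \<open>
  Suppose that \<open>V\<close> is a smooth representation with \<open>V \<cong> \<Upsilon>\<close> over \<open>P(K)\<close>. Taking inverse limits turns
  morphisms of pro-objects into honest linear maps, so \<open>GL\<^sub>2(K)\<close> acts on \<open>lim \<Upsilon>\<close>, whose elements are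
  families \<open>(y\<^sub>m)\<close>, \<open>m \<in> \<int>\<close>, of compatible systems of measures on the \<open>Z\<^sub>n\<close>. This is a Kirillov model: \<open>P(K)\<close>
  acts by known formulas, and \<open>n(b) = (1, b)\<close> multiplies \<open>y\<^sub>m\<close> by \<open>\<theta>((b z)\<^sub>m)\<close>, where \<open>(b z)\<^sub>m\<close> is the
  coefficient of \<open>t\<^sup>m\<close>. Everything unknown is in the operator \<open>W\<close> of the Weyl element, which satisfies
  \<open>W W = 1\<close>, \<open>W (a, 0) = (a\<^sup>-\<^sup>1, 0) W\<close> and the braid relation
  \<open>W n(b) W = n(1/b) W (-b\<^sup>2, -b)\<close>. The theorem is that there is no such \<open>W\<close> that comes from a morphism of
  pro-objects (lemma \<open>no_weyl_operator\<close>).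

  Look at the bottom level \<open>\<M>\<^sub>0\<close> of the component \<open>m = 0\<close>. Since \<open>W\<close> is a morphism of pro-objects,
  the bottom level of \<open>W y\<close> depends only on finitely many components \<open>y\<^sub>i\<close>, \<open>\<bar>i\<bar> \<le> L0\<close>, up to level \<open>L0\<close>.
  Some component does contribute to it, as \<open>W\<close> is onto; let \<open>s\<close> be the largest one. Now let \<open>\<nu>\<close> be a
  measure placed in the component \<open>j\<close>, put \<open>y = W \<nu>\<close> and take \<open>v(b) = s - k\<close> with \<open>k\<close> large. By the
  braid relation the bottom level of \<open>W n(b) y\<close> is that of \<open>W (-b\<^sup>2, -b) \<nu>\<close>. Here the measure has been
  moved to the component \<open>j + 2 v(b)\<close>, which does not contribute. Hence the contributions of the
  \<open>n(b) y\<^sub>i\<close>, \<open>i \<le> s\<close>, add up to \<open>0\<close> for every such \<open>b\<close>.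

  On component \<open>i\<close> the factor \<open>\<theta>((b z)\<^sub>i)\<close> involves the coefficients of \<open>b\<close> up to degree \<open>i\<close> only, so
  the coefficient of \<open>t\<^sup>s\<close> in \<open>b\<close> is seen by component \<open>s\<close> alone. A finite Fourier sum over \<open>b\<close>
  therefore kills the components \<open>i < s\<close>, and it cuts \<open>y\<^sub>s\<close> down, at level \<open>k\<close>, to a small congruence
  subgroup \<open>H\<close> of \<open>O\<^sup>*\<close> (lemmas \<open>freq_sum_lower\<close> and \<open>freq_sum_top\<close>). There \<open>y\<^sub>s\<close> is a multiple of Haar
  measure, and the Haar measure of \<open>H\<close> in component \<open>s\<close> does contribute, because translates of it span
  all measures (lemma \<open>measure_decomposition\<close>). So \<open>y\<^sub>s\<close> has mass \<open>0\<close> on \<open>H\<close>, by translation on every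
  coset of \<open>H\<close>, and thus \<open>y\<^sub>s = 0\<close> at level \<open>k\<close> (lemma \<open>component_vanishes\<close>). As \<open>\<nu>\<close> and \<open>j\<close> were
  arbitrary, component \<open>s\<close> vanishes at a fixed level on the whole image of \<open>W\<close>. This is absurd, since
  \<open>W\<close> is onto and Haar measure is not \<open>0\<close>.
\<close>

unbundle fps_syntax

section \<open>Fractional ideals of \<open>F\<close> and power series modulo them\<close>

context nonarch_local_field
begin

abbreviation idealF :: "int \<Rightarrow> 'f set" ("\<pp>")
  where "\<pp> \<equiv> vball vF"

lemma vF_one [simp]: "vF 1 = 0"
  using val_mult[of 1 1] by simp

lemma vF_minus [simp]: "vF (- x) = vF x"
proof (cases "x = 0")
  case False
  have "vF ((-1) * (-1)) = vF (-1) + vF (-1)"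
    by (rule val_mult) auto
  then have "vF (-1) = 0" by simp
  then show ?thesis
    using val_mult[of "-1" x] False by simp
qed simp

lemma vF_inverse: "x \<noteq> 0 \<Longrightarrow> vF (inverse x) = - vF x"
  using val_mult[of x "inverse x"] by simp

lemma idealF_0 [simp]: "0 \<in> \<pp> N"
  by (simp add: vball_def)

lemma idealF_minus: "x \<in> \<pp> N \<Longrightarrow> - x \<in> \<pp> N"
  by (auto simp: vball_def)

lemma idealF_add: "x \<in> \<pp> N \<Longrightarrow> y \<in> \<pp> N \<Longrightarrow> x + y \<in> \<pp> N"
  using val_add[of x y] by (cases "x = 0"; cases "y = 0"; cases "x + y = 0") (auto simp: vball_def)

lemma idealF_diff: "x \<in> \<pp> N \<Longrightarrow> y \<in> \<pp> N \<Longrightarrow> x - y \<in> \<pp> N"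
  using idealF_add[of x N "- y"] idealF_minus by auto

lemma idealF_mult: "x \<in> \<pp> M \<Longrightarrow> y \<in> \<pp> N \<Longrightarrow> x * y \<in> \<pp> (M + N)"
  using val_mult[of x y] by (cases "x = 0"; cases "y = 0") (auto simp: vball_def)

lemma idealF_mono: "x \<in> \<pp> M \<Longrightarrow> N \<le> M \<Longrightarrow> x \<in> \<pp> N"
  by (auto simp: vball_def)

lemma idealF_sum: "(\<And>i. i \<in> I \<Longrightarrow> f i \<in> \<pp> N) \<Longrightarrow> sum f I \<in> \<pp> N"
  by (induction I rule: infinite_finite_induct) (auto intro: idealF_add)

lemma one_in_idealF: "1 \<in> \<pp> 0"
  by (simp add: vball_def)

definition uniformizer :: 'f where
  "uniformizer = (SOME x. x \<noteq> 0 \<and> vF x = 1)"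

lemma uni_nonzero [simp]: "uniformizer \<noteq> 0" and vF_uni [simp]: "vF uniformizer = 1"
  using someI_ex[OF val_normalized] by (auto simp: uniformizer_def)

lemma vF_uni_power [simp]: "vF (uniformizer powi N) = N"
proof -
  have *: "vF (uniformizer ^ n) = int n" for n
    by (induction n) (auto simp: val_mult)
  show ?thesis
    by (cases N rule: int_cases2) (auto simp: power_int_minus vF_inverse *)
qed

lemma uni_power_in_idealF [simp]: "uniformizer powi N \<in> \<pp> M \<longleftrightarrow> M \<le> N"
  by (simp add: vball_def)

lemma uni_power_mult_in_idealF: "uniformizer powi M * x \<in> \<pp> N \<longleftrightarrow> x \<in> \<pp> (N - M)"
  by (cases "x = 0") (auto simp: vball_def val_mult)

lemma uni_power_cancel: "uniformizer powi M * (uniformizer powi N * x) = uniformizer powi (M + N) * x"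
  by (simp add: power_int_add)

text \<open>By induction on \<open>N\<close>: lift the residues of \<open>\<varpi>\<^sup>-\<^sup>N (x - d)\<close>, where \<open>d\<close> represents \<open>x\<close> modulo \<open>\<varpi>\<^sup>N\<close>.\<close>

lemma finite_residues:
  "\<exists>D. finite D \<and> D \<subseteq> \<pp> 0 \<and> (\<forall>x\<in>\<pp> 0. \<exists>d\<in>D. x - d \<in> \<pp> (int N))"
proof (induction N)
  case 0
  then show ?case
    by (intro exI[of _ "{0}"]) auto
next
  case (Suc N)
  then obtain D where D: "finite D" "D \<subseteq> \<pp> 0" "\<And>x. x \<in> \<pp> 0 \<Longrightarrow> \<exists>d\<in>D. x - d \<in> \<pp> (int N)"
    by auto
  define Q where "Q = \<pp> 0 // {(x, y). x \<in> \<pp> 0 \<and> y \<in> \<pp> 0 \<and> x - y \<in> \<pp> 1}"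
  define E where "E = (\<lambda>X. SOME x. x \<in> X) ` Q"
  have "finite Q" unfolding Q_def by (rule finite_residue_field)
  have E: "\<exists>e\<in>E. e \<in> \<pp> 0 \<and> x - e \<in> \<pp> 1" if x: "x \<in> \<pp> 0" for x
  proof -
    let ?X = "{(x, y). x \<in> \<pp> 0 \<and> y \<in> \<pp> 0 \<and> x - y \<in> \<pp> 1} `` {x}"
    have "x \<in> ?X" using x by auto
    then have "(SOME y. y \<in> ?X) \<in> ?X" by (rule someI)
    moreover have "?X \<in> Q" unfolding Q_def using x by (auto simp: quotient_def)
    ultimately show ?thesis unfolding E_def by fast
  qed
  show ?case
  proof (intro exI conjI ballI)
    show "finite ((\<lambda>(d, e). d + uniformizer powi (int N) * e) ` (D \<times> (E \<inter> \<pp> 0)))"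
      using D(1) \<open>finite Q\<close> by (simp add: E_def)
    show "(\<lambda>(d, e). d + uniformizer powi (int N) * e) ` (D \<times> (E \<inter> \<pp> 0)) \<subseteq> \<pp> 0"
    proof clarsimp
      fix d e assume "d \<in> D" "e \<in> \<pp> 0"
      moreover have "uniformizer powi (int N) * e \<in> \<pp> 0"
        unfolding uni_power_mult_in_idealF using \<open>e \<in> \<pp> 0\<close> by (rule idealF_mono) simp
      ultimately show "d + uniformizer ^ N * e \<in> \<pp> 0"
        using D(2) by (auto intro!: idealF_add)
    qed
    fix x assume "x \<in> \<pp> 0"
    then obtain d where d: "d \<in> D" "x - d \<in> \<pp> (int N)" using D(3) by blast
    then have "uniformizer powi (- int N) * (x - d) \<in> \<pp> 0"
      unfolding uni_power_mult_in_idealF by simp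
    then obtain e where e: "e \<in> E" "e \<in> \<pp> 0" "uniformizer powi (- int N) * (x - d) - e \<in> \<pp> 1"
      using E by blast
    have "x - (d + uniformizer powi int N * e) = uniformizer powi (int N) * (uniformizer powi (- int N) * (x - d) - e)"
      unfolding right_diff_distrib uni_power_cancel by (simp add: algebra_simps uni_power_cancel)
    also have "\<dots> \<in> \<pp> (int (Suc N))"
      unfolding uni_power_mult_in_idealF using e(3) by simp
    finally have "x - (d + uniformizer powi int N * e) \<in> \<pp> (int (Suc N))" .
    then show "\<exists>d\<in>(\<lambda>(d, e). d + uniformizer powi (int N) * e) ` (D \<times> (E \<inter> \<pp> 0)). x - d \<in> \<pp> (int (Suc N))"
      using d(1) e by force
  qed
qed

text \<open>For \<open>N \<ge> 0\<close> these are ideals of the ring \<open>disc n 0\<close>; for negative \<open>N\<close> they bound the size of a series.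
  Only the first \<open>n + 1\<close> coefficients are restricted, so translates of \<open>disc n N\<close> are preimages of balls
  under the projection of \<open>O\<close> to \<open>O/t\<^sup>n\<^sup>+\<^sup>1\<close>.\<close>

definition disc :: "nat \<Rightarrow> int \<Rightarrow> 'f fls set" where
  "disc n N = {z. (\<forall>i<0. z $$ i = 0) \<and> (\<forall>i\<in>{0..int n}. z $$ i \<in> \<pp> N)}"

lemma disc_0 [simp]: "0 \<in> disc n N"
  by (simp add: disc_def)

lemma disc_add: "x \<in> disc n N \<Longrightarrow> y \<in> disc n N \<Longrightarrow> x + y \<in> disc n N"
  by (simp add: disc_def idealF_add)

lemma disc_minus: "x \<in> disc n N \<Longrightarrow> - x \<in> disc n N"
  by (simp add: disc_def idealF_minus)

lemma disc_diff: "x \<in> disc n N \<Longrightarrow> y \<in> disc n N \<Longrightarrow> x - y \<in> disc n N"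
  by (simp add: disc_def idealF_diff)

lemma disc_minus_sym: "x - y \<in> disc n N \<Longrightarrow> y - x \<in> disc n N"
  using disc_minus by fastforce

lemma disc_mono: "x \<in> disc n N \<Longrightarrow> n' \<le> n \<Longrightarrow> N' \<le> N \<Longrightarrow> x \<in> disc n' N'"
  by (auto simp: disc_def intro: idealF_mono)

lemma nth_mult_nonneg:
  fixes x y :: "'b::field fls"
  assumes "\<forall>i<0. x $$ i = 0" "\<forall>i<0. y $$ i = 0"
  shows "(x * y) $$ m = (\<Sum>i=0..m. x $$ i * y $$ (m - i))"
proof (cases "x = 0 \<or> y = 0")
  case False
  then have x: "fls_subdegree x \<ge> 0" and y: "fls_subdegree y \<ge> 0"
    using assms by (auto intro: fls_subdegree_ge0I)
  have "(x * y) $$ m = (\<Sum>i=fls_subdegree x..m - fls_subdegree y. x $$ i * y $$ (m - i))"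
    by (rule fls_times_nth)
  also have "\<dots> = (\<Sum>i=0..m. x $$ i * y $$ (m - i))"
    using x y by (intro sum.mono_neutral_left) auto
  finally show ?thesis .
qed auto

lemma disc_mult: "x \<in> disc n M \<Longrightarrow> y \<in> disc n N \<Longrightarrow> x * y \<in> disc n (M + N)"
  unfolding disc_def mem_Collect_eq
  by (auto simp: nth_mult_nonneg intro!: idealF_sum idealF_mult)

lemma disc_exists_bound:
  assumes "\<forall>i<0. z $$ i = 0"
  shows "\<exists>R\<ge>0. z \<in> disc n (- R)"
proof -
  define R where "R = (\<Sum>i\<in>{0..int n}. \<bar>vF (z $$ i)\<bar>)"
  have "- R \<le> vF (z $$ i)" if "i \<in> {0..int n}" for i
    using member_le_sum[of i "{0..int n}" "\<lambda>i. \<bar>vF (z $$ i)\<bar>"] that unfolding R_def by fastforce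
  moreover have "R \<ge> 0" by (simp add: R_def sum_nonneg)
  ultimately show ?thesis
    using assms by (intro exI[of _ R]) (auto simp: disc_def vball_def)
qed

lemma O_units_iff: "z \<in> O_units \<longleftrightarrow> (\<forall>i<0. z $$ i = 0) \<and> z $$ 0 \<noteq> 0"
proof
  show "z \<in> O_units \<Longrightarrow> (\<forall>i<0. z $$ i = 0) \<and> z $$ 0 \<noteq> 0"
    unfolding O_units_def using nth_fls_subdegree_nonzero[of z] by auto
  assume "(\<forall>i<0. z $$ i = 0) \<and> z $$ 0 \<noteq> 0"
  then show "z \<in> O_units"
    unfolding O_units_def using fls_subdegree_eqI[of z 0] by auto
qed

lemma O_units_mult: "x \<in> O_units \<Longrightarrow> y \<in> O_units \<Longrightarrow> x * y \<in> O_units"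
  by (simp add: O_units_def)

lemma O_units_inverse: "x \<in> O_units \<Longrightarrow> inverse x \<in> O_units"
  by (simp add: O_units_def fls_inverse_subdegree)

lemma O_units_nonzero: "x \<in> O_units \<Longrightarrow> x \<noteq> 0"
  by (simp add: O_units_def)

lemma O_units_mult_iff: "u \<in> O_units \<Longrightarrow> u * z \<in> O_units \<longleftrightarrow> z \<in> O_units"
  by (cases "z = 0") (auto simp: O_units_def)

lemma one_O_units [simp]: "1 \<in> O_units"
  by (simp add: O_units_def)

text \<open>The preimage in \<open>O\<^sup>*\<close> of a compact open subgroup of \<open>Z\<^sub>n\<close> for \<open>r \<ge> 1\<close>. These subgroups form a basis of
  neighbourhoods of \<open>1\<close>.\<close>

definition cong1 :: "nat \<Rightarrow> nat \<Rightarrow> 'f fls set" where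
  "cong1 n r = {z. z - 1 \<in> disc n (int r)}"

lemma cong1_subset_O_units: "r \<ge> 1 \<Longrightarrow> cong1 n r \<subseteq> O_units"
proof
  fix z assume r: "r \<ge> 1" and z: "z \<in> cong1 n r"
  then have neg: "\<forall>i<0. z $$ i = 0" and "z $$ 0 - 1 \<in> \<pp> (int r)"
    by (auto simp: cong1_def disc_def dest: bspec[of _ _ 0])
  moreover have "0 - 1 \<notin> \<pp> (int r)" using r by (auto simp: vball_def)
  ultimately show "z \<in> O_units" by (auto simp: O_units_iff)
qed

lemma one_cong1 [simp]: "1 \<in> cong1 n r"
  by (simp add: cong1_def)

lemma cong1_mono: "z \<in> cong1 n r \<Longrightarrow> n' \<le> n \<Longrightarrow> r' \<le> r \<Longrightarrow> z \<in> cong1 n' r'"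
  by (auto simp: cong1_def elim!: disc_mono)

lemma one_disc: "1 \<in> disc n 0"
  by (auto simp: disc_def one_in_idealF)

lemma cong1_disc: "z \<in> cong1 n r \<Longrightarrow> z \<in> disc n 0"
  using disc_add[of "z - 1" n 0 1] one_disc disc_mono[of "z - 1" n "int r" n 0]
  by (auto simp: cong1_def)

lemma cong1_mult: "x \<in> cong1 n r \<Longrightarrow> y \<in> cong1 n r \<Longrightarrow> x * y \<in> cong1 n r"
proof -
  assume x: "x \<in> cong1 n r" and y: "y \<in> cong1 n r"
  have "x * (y - 1) \<in> disc n (int r)"
    using disc_mult[OF cong1_disc[OF x]] y by (auto simp: cong1_def)
  then have "x * (y - 1) + (x - 1) \<in> disc n (int r)"
    using x by (intro disc_add) (auto simp: cong1_def)
  moreover have "x * (y - 1) + (x - 1) = x * y - 1" by (simp add: algebra_simps)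
  ultimately show ?thesis by (simp add: cong1_def)
qed

text \<open>The coefficient of \<open>t\<^sup>i\<close> in \<open>z z\<^sup>-\<^sup>1 = 1\<close> determines that of \<open>z\<^sup>-\<^sup>1\<close> from the earlier ones, and the only
  division in it is by the unit \<open>z\<^sub>0\<close>.\<close>

lemma disc_inverse:
  assumes z: "z \<in> disc n 0" and z0: "z $$ 0 \<noteq> 0" "vF (z $$ 0) = 0"
  shows "inverse z \<in> disc n 0"
proof -
  let ?w = "inverse z"
  have zu: "z \<in> O_units" using z z0 by (auto simp: O_units_iff disc_def)
  then have wu: "?w \<in> O_units" by (rule O_units_inverse)
  have neg: "\<forall>i<0. z $$ i = 0" "\<forall>i<0. ?w $$ i = 0" using zu wu by (auto simp: O_units_iff)
  have "?w $$ (int i) \<in> \<pp> 0" if "i \<le> n" for i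
    using that
  proof (induction i rule: less_induct)
    case (less i)
    have "z * ?w = 1" using zu by (simp add: O_units_nonzero)
    then have "(\<Sum>j=0..int i. z $$ j * ?w $$ (int i - j)) = 1 $$ (int i)"
      using nth_mult_nonneg[OF neg] by metis
    moreover have "{0..int i} = insert 0 {1..int i}" by auto
    ultimately have eq: "z $$ 0 * ?w $$ int i = 1 $$ (int i) - (\<Sum>j=1..int i. z $$ j * ?w $$ (int i - j))"
      by (simp add: algebra_simps)
    have "(\<Sum>j=1..int i. z $$ j * ?w $$ (int i - j)) \<in> \<pp> (0 + 0)"
    proof (intro idealF_sum idealF_mult)
      fix j assume j: "j \<in> {1..int i}"
      then show "z $$ j \<in> \<pp> 0" using z less.prems by (auto simp: disc_def)
      show "?w $$ (int i - j) \<in> \<pp> 0"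
        using less.IH[of "nat (int i - j)"] j less.prems by auto
    qed
    moreover have "1 $$ (int i) \<in> \<pp> 0" by (simp add: one_in_idealF)
    ultimately have "z $$ 0 * ?w $$ int i \<in> \<pp> 0"
      unfolding eq by (intro idealF_diff) simp_all
    then show ?case using z0 val_mult[of "z $$ 0" "?w $$ int i"] by (cases "?w $$ int i = 0") (auto simp: vball_def)
  qed
  then have "?w $$ j \<in> \<pp> 0" if "j \<in> {0..int n}" for j
    using that by (cases j) auto
  then show ?thesis using neg by (auto simp: disc_def)
qed

lemma cong1_vF0:
  assumes "r \<ge> 1" "z \<in> cong1 n r" shows "vF (z $$ 0) = 0"
proof -
  have "z $$ 0 - 1 \<in> \<pp> (int r)"
    using assms(2) by (auto simp: cong1_def disc_def dest: bspec[of _ _ 0])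
  then have d: "z $$ 0 - 1 \<in> \<pp> 1" by (rule idealF_mono) (use assms in simp)
  have z0: "z $$ 0 \<noteq> 0" using cong1_subset_O_units[OF assms(1)] assms(2) O_units_iff by blast
  have "z $$ 0 \<in> \<pp> 0" using cong1_disc[OF assms(2)] by (auto simp: disc_def)
  moreover have "\<not> vF (z $$ 0) \<ge> 1"
  proof
    assume "vF (z $$ 0) \<ge> 1"
    then have "z $$ 0 - (z $$ 0 - 1) \<in> \<pp> 1" by (intro idealF_diff d) (auto simp: vball_def)
    then show False by (simp add: vball_def)
  qed
  ultimately show ?thesis using z0 by (auto simp: vball_def)
qed

lemma cong1_inverse_disc:
  assumes "r \<ge> 1" "z \<in> cong1 n r" shows "inverse z \<in> disc n 0"
proof (rule disc_inverse)
  show "z $$ 0 \<noteq> 0"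
    using cong1_subset_O_units[OF assms(1)] assms(2) O_units_iff by blast
qed (use assms cong1_disc cong1_vF0 in auto)

lemma cong1_inverse:
  assumes "r \<ge> 1" "z \<in> cong1 n r" shows "inverse z \<in> cong1 n r"
proof -
  have z: "z \<noteq> 0" using cong1_subset_O_units[OF assms(1)] assms(2) O_units_nonzero by blast
  have "inverse z * (z - 1) \<in> disc n (0 + int r)"
    using assms by (intro disc_mult cong1_inverse_disc) (auto simp: cong1_def)
  then have "- (inverse z * (z - 1)) \<in> disc n (int r)" by (simp add: disc_minus)
  moreover have "- (inverse z * (z - 1)) = inverse z - 1" using z by (simp add: algebra_simps)
  ultimately show ?thesis by (simp add: cong1_def)
qed

section \<open>The spaces \<open>Z\<^sub>n\<close>: open sets and locally constant functions\<close>

lemma openin_val_ball: "openin (val_topology vF) {y. y - x \<in> \<pp> N}"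
  unfolding val_topology_def
  by (rule topology_generated_by_Basis, rule range_eqI[of _ _ "(x, N)"]) simp

lemma openin_val_topology_iff:
  "openin (val_topology vF) S \<longleftrightarrow> (\<forall>x\<in>S. \<exists>N. \<forall>y. y - x \<in> \<pp> N \<longrightarrow> y \<in> S)"
proof
  assume "openin (val_topology vF) S"
  then have "generate_topology_on (range (\<lambda>(x, N). {y. y - x \<in> \<pp> N})) S"
    unfolding val_topology_def openin_topology_generated_by_iff .
  then show "\<forall>x\<in>S. \<exists>N. \<forall>y. y - x \<in> \<pp> N \<longrightarrow> y \<in> S"
  proof induction
    case (Int A B)
    show ?case
    proof
      fix x assume "x \<in> A \<inter> B"
      then obtain M N where "\<forall>y. y - x \<in> \<pp> M \<longrightarrow> y \<in> A" "\<forall>y. y - x \<in> \<pp> N \<longrightarrow> y \<in> B"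
        using Int.IH by blast
      then show "\<exists>N. \<forall>y. y - x \<in> \<pp> N \<longrightarrow> y \<in> A \<inter> B"
        by (intro exI[of _ "max M N"]) (auto dest: idealF_mono[of _ "max M N" M] idealF_mono[of _ "max M N" N])
    qed
  next
    case (UN K)
    then show ?case by (meson UnionE UnionI)
  next
    case (Basis s)
    then obtain x N where s: "s = {y. y - x \<in> \<pp> N}" by auto
    show ?case
    proof
      fix u assume "u \<in> s"
      then have "y \<in> s" if "y - u \<in> \<pp> N" for y
        using idealF_add[of "y - u" N "u - x"] that by (simp add: s)
      then show "\<exists>N. \<forall>y. y - u \<in> \<pp> N \<longrightarrow> y \<in> s" by blast
    qed
  qed auto
next
  assume *: "\<forall>x\<in>S. \<exists>N. \<forall>y. y - x \<in> \<pp> N \<longrightarrow> y \<in> S"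
  have "\<exists>T. openin (val_topology vF) T \<and> x \<in> T \<and> T \<subseteq> S" if x: "x \<in> S" for x
  proof -
    obtain N where "\<forall>y. y - x \<in> \<pp> N \<longrightarrow> y \<in> S" using * x by blast
    moreover have "openin (val_topology vF) {y. y - x \<in> \<pp> N}" by (rule openin_val_ball)
    ultimately show ?thesis by (intro exI[of _ "{y. y - x \<in> \<pp> N}"]) auto
  qed
  then show "openin (val_topology vF) S"
    using openin_subopen[of "val_topology vF" S] by metis
qed

text \<open>The pullback of a finite product topology is thus described by one ultrametric, measured by the
  sets \<open>disc n N\<close>. All later arguments use only this description.\<close>

lemma openin_Z_topology_iff:
  "openin (Z_topology vF n) S \<longleftrightarrow>
     S \<subseteq> O_units \<and> (\<forall>z\<in>S. \<exists>N. \<forall>z'\<in>O_units. z' - z \<in> disc n N \<longrightarrow> z' \<in> S)"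
proof
  assume "openin (Z_topology vF n) S"
  then obtain U where U: "openin (product_topology (\<lambda>_. val_topology vF) {0..int n}) U"
    and S: "S = (\<lambda>z. restrict (fls_nth z) {0..int n}) -` U \<inter> O_units"
    unfolding Z_topology_def openin_pullback_topology by blast
  have "\<exists>N. \<forall>z'\<in>O_units. z' - z \<in> disc n N \<longrightarrow> z' \<in> S" if z: "z \<in> S" for z
  proof -
    have "restrict (fls_nth z) {0..int n} \<in> U" using z S by auto
    then obtain V where V: "\<forall>i\<in>{0..int n}. openin (val_topology vF) (V i)"
        "restrict (fls_nth z) {0..int n} \<in> PiE {0..int n} V" "PiE {0..int n} V \<subseteq> U"
      using U unfolding openin_product_topology_alt by blast
    have "\<forall>i\<in>{0..int n}. \<exists>N. \<forall>y. y - z $$ i \<in> \<pp> N \<longrightarrow> y \<in> V i"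
    proof
      fix i assume i: "i \<in> {0..int n}"
      then have "z $$ i \<in> V i" using V(2) by (auto simp: PiE_iff)
      then show "\<exists>N. \<forall>y. y - z $$ i \<in> \<pp> N \<longrightarrow> y \<in> V i"
        using V(1) i unfolding openin_val_topology_iff by blast
    qed
    then obtain M where M: "\<And>i y. i \<in> {0..int n} \<Longrightarrow> y - z $$ i \<in> \<pp> (M i) \<Longrightarrow> y \<in> V i"
      by metis
    have "z' \<in> S" if "z' \<in> O_units" "z' - z \<in> disc n (Max (M ` {0..int n}))" for z'
    proof -
      have "z' $$ i \<in> V i" if i: "i \<in> {0..int n}" for i
      proof (rule M[OF i])
        have "z' $$ i - z $$ i \<in> \<pp> (Max (M ` {0..int n}))"
          using \<open>z' - z \<in> disc n _\<close> i by (auto simp: disc_def)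
        then show "z' $$ i - z $$ i \<in> \<pp> (M i)"
          by (rule idealF_mono) (use i in simp)
      qed
      then have "restrict (fls_nth z') {0..int n} \<in> PiE {0..int n} V" by (simp add: PiE_iff)
      then have "restrict (fls_nth z') {0..int n} \<in> U" using V(3) by blast
      then show ?thesis using that(1) by (simp add: S)
    qed
    then show ?thesis by blast
  qed
  then show "S \<subseteq> O_units \<and> (\<forall>z\<in>S. \<exists>N. \<forall>z'\<in>O_units. z' - z \<in> disc n N \<longrightarrow> z' \<in> S)"
    using S by blast
next
  assume *: "S \<subseteq> O_units \<and> (\<forall>z\<in>S. \<exists>N. \<forall>z'\<in>O_units. z' - z \<in> disc n N \<longrightarrow> z' \<in> S)"
  have "\<exists>T. openin (Z_topology vF n) T \<and> z \<in> T \<and> T \<subseteq> S" if z: "z \<in> S" for z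
  proof -
    obtain N where N: "\<forall>z'\<in>O_units. z' - z \<in> disc n N \<longrightarrow> z' \<in> S" using * z by blast
    let ?U = "PiE {0..int n} (\<lambda>i. {y. y - z $$ i \<in> \<pp> N})"
    have "openin (product_topology (\<lambda>_. val_topology vF) {0..int n}) ?U"
      using openin_val_ball by (auto simp: openin_PiE)
    then have "openin (Z_topology vF n) ((\<lambda>z. restrict (fls_nth z) {0..int n}) -` ?U \<inter> O_units)"
      unfolding Z_topology_def openin_pullback_topology by blast
    moreover have "(\<lambda>z. restrict (fls_nth z) {0..int n}) -` ?U \<inter> O_units \<subseteq> S"
    proof
      fix z' assume z': "z' \<in> (\<lambda>z. restrict (fls_nth z) {0..int n}) -` ?U \<inter> O_units"
      moreover have "z \<in> O_units" using z * by blast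
      ultimately have "z' - z \<in> disc n N"
        by (auto simp: disc_def O_units_iff PiE_iff)
      then show "z' \<in> S" using N z' by blast
    qed
    moreover have "z \<in> (\<lambda>z. restrict (fls_nth z) {0..int n}) -` ?U \<inter> O_units"
      using z * by (auto simp: PiE_iff)
    ultimately show ?thesis by blast
  qed
  then show "openin (Z_topology vF n) S"
    using openin_subopen[of "Z_topology vF n" S] by metis
qed

lemma topspace_Z_topology [simp]: "topspace (Z_topology vF n) = O_units"
proof
  show "topspace (Z_topology vF n) \<subseteq> O_units"
    using openin_topspace[of "Z_topology vF n"] unfolding openin_Z_topology_iff by blast
  show "O_units \<subseteq> topspace (Z_topology vF n)"
    by (rule openin_subset) (auto simp: openin_Z_topology_iff)
qed

lemma LC_iff:
  "f \<in> LC vF n \<longleftrightarrow> (\<forall>z. z \<notin> O_units \<longrightarrow> f z = 0) \<and>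
     (\<forall>z\<in>O_units. \<exists>N. \<forall>z'\<in>O_units. z' - z \<in> disc n N \<longrightarrow> f z' = f z)"
proof -
  have "continuous_map (Z_topology vF n) (discrete_topology UNIV) f \<longleftrightarrow>
     (\<forall>z\<in>O_units. \<exists>N. \<forall>z'\<in>O_units. z' - z \<in> disc n N \<longrightarrow> f z' = f z)" (is "?L \<longleftrightarrow> ?R")
  proof
    assume ?L
    then have op: "openin (Z_topology vF n) {x \<in> O_units. f x \<in> {f z}}" for z
      unfolding continuous_map by (metis openin_discrete_topology subset_UNIV topspace_Z_topology)
    show ?R
    proof
      fix z :: "'f fls" assume "z \<in> O_units"
      then show "\<exists>N. \<forall>z'\<in>O_units. z' - z \<in> disc n N \<longrightarrow> f z' = f z"
        using op[of z] unfolding openin_Z_topology_iff by simp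
    qed
  next
    assume R: ?R
    have "openin (Z_topology vF n) {x \<in> O_units. f x \<in> U}" for U
      unfolding openin_Z_topology_iff
    proof (intro conjI ballI)
      fix z assume z: "z \<in> {x \<in> O_units. f x \<in> U}"
      then have "z \<in> O_units" by simp
      from bspec[OF R this] obtain N where N: "\<forall>z'\<in>O_units. z' - z \<in> disc n N \<longrightarrow> f z' = f z" ..
      have "f z' \<in> U" if "z' \<in> O_units" "z' - z \<in> disc n N" for z'
        using N[rule_format, OF that] z by (metis (mono_tags) mem_Collect_eq)
      then show "\<exists>N. \<forall>z'\<in>O_units. z' - z \<in> disc n N \<longrightarrow> z' \<in> {x \<in> O_units. f x \<in> U}"
        by auto
    qed auto
    then show ?L by (simp add: continuous_map_def)
  qed
  then show ?thesis unfolding LC_def by blast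
qed

lemma LC_mono: "f \<in> LC vF n \<Longrightarrow> n \<le> n' \<Longrightarrow> f \<in> LC vF n'"
  unfolding LC_iff by (meson disc_mono order_refl)

lemma LC_outside: "f \<in> LC vF n \<Longrightarrow> z \<notin> O_units \<Longrightarrow> f z = 0"
  by (simp add: LC_iff)

lemma LC_pointwise2:
  assumes "f \<in> LC vF n" "g \<in> LC vF n" "h 0 0 = 0"
  shows "(\<lambda>z. h (f z) (g z)) \<in> LC vF n"
  unfolding LC_iff
proof (intro conjI allI impI ballI)
  fix z :: "'f fls" assume "z \<notin> O_units"
  then show "h (f z) (g z) = 0" using assms by (simp add: LC_iff)
next
  fix z :: "'f fls" assume z: "z \<in> O_units"
  obtain M where M: "\<forall>z'\<in>O_units. z' - z \<in> disc n M \<longrightarrow> f z' = f z"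
    using assms(1) z unfolding LC_iff by blast
  obtain N where N: "\<forall>z'\<in>O_units. z' - z \<in> disc n N \<longrightarrow> g z' = g z"
    using assms(2) z unfolding LC_iff by blast
  show "\<exists>N. \<forall>z'\<in>O_units. z' - z \<in> disc n N \<longrightarrow> h (f z') (g z') = h (f z) (g z)"
    using M N by (intro exI[of _ "max M N"]) (metis disc_mono max.cobounded1 max.cobounded2 order_refl)
qed

lemma LC_zero [simp]: "(\<lambda>z. 0) \<in> LC vF n"
  by (simp add: LC_iff)

lemma LC_add: "f \<in> LC vF n \<Longrightarrow> g \<in> LC vF n \<Longrightarrow> (\<lambda>z. f z + g z) \<in> LC vF n"
  by (rule LC_pointwise2) auto

lemma LC_mult: "f \<in> LC vF n \<Longrightarrow> g \<in> LC vF n \<Longrightarrow> (\<lambda>z. f z * g z) \<in> LC vF n"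
  by (rule LC_pointwise2) auto

lemma LC_cmult: "f \<in> LC vF n \<Longrightarrow> (\<lambda>z. c * f z) \<in> LC vF n"
  using LC_pointwise2[of f n f "\<lambda>x _. c * x"] by simp

lemma LC_sum: "(\<And>i. i \<in> I \<Longrightarrow> f i \<in> LC vF n) \<Longrightarrow> (\<lambda>z. \<Sum>i\<in>I. f i z) \<in> LC vF n"
  by (induction I rule: infinite_finite_induct) (auto intro: LC_add)

lemma LC_indicator:
  assumes "S \<subseteq> O_units"
    and "\<And>z z'. z \<in> O_units \<Longrightarrow> z' \<in> O_units \<Longrightarrow> z' - z \<in> disc n N \<Longrightarrow> z \<in> S \<Longrightarrow> z' \<in> S"
  shows "indicator S \<in> LC vF n"
proof -
  have iff: "z' \<in> S \<longleftrightarrow> z \<in> S" if "z \<in> O_units" "z' \<in> O_units" "z' - z \<in> disc n N" for z z'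
    using assms(2)[OF that] assms(2)[OF that(2,1) disc_minus_sym[OF that(3)]] by (rule iffI[rotated])
  have "\<forall>z'\<in>O_units. z' - z \<in> disc n N \<longrightarrow> (indicator S z' :: complex) = indicator S z"
    if "z \<in> O_units" for z
  proof (intro ballI impI)
    fix z' assume "z' \<in> O_units" "z' - z \<in> disc n N"
    then show "(indicator S z' :: complex) = indicator S z"
      unfolding indicator_def using iff[OF that, of z'] by simp
  qed
  moreover have "\<forall>z. z \<notin> O_units \<longrightarrow> indicator S z = (0 :: complex)"
    using assms(1) by (auto simp: indicator_def)
  ultimately show ?thesis unfolding LC_iff by metis
qed

lemma LC_translate:
  assumes "f \<in> LC vF n" "u \<in> O_units"
  shows "(\<lambda>z. f (u * z)) \<in> LC vF n"
  unfolding LC_iff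
proof (intro conjI allI impI ballI)
  fix z :: "'f fls" assume "z \<notin> O_units"
  then show "f (u * z) = 0" using assms by (simp add: LC_iff O_units_mult_iff)
next
  fix z :: "'f fls" assume z: "z \<in> O_units"
  obtain N where N: "\<forall>z'\<in>O_units. z' - u * z \<in> disc n N \<longrightarrow> f z' = f (u * z)"
    using assms z unfolding LC_iff by (meson O_units_mult)
  obtain R where R: "u \<in> disc n (- R)"
    using disc_exists_bound[of u n] assms(2) by (auto simp: O_units_iff)
  have "f (u * z') = f (u * z)" if "z' \<in> O_units" "z' - z \<in> disc n (N + R)" for z'
  proof -
    have "u * (z' - z) \<in> disc n (- R + (N + R))"
      by (rule disc_mult[OF R that(2)])
    then show ?thesis using N that(1) assms(2) by (simp add: O_units_mult right_diff_distrib)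
  qed
  then show "\<exists>N. \<forall>z'\<in>O_units. z' - z \<in> disc n N \<longrightarrow> f (u * z') = f (u * z)" by blast
qed

lemma LC_cong1_indicator:
  assumes "r \<ge> 1" shows "indicator (cong1 n r) \<in> LC vF n"
proof (rule LC_indicator)
  show "cong1 n r \<subseteq> O_units" by (rule cong1_subset_O_units[OF assms])
  fix z z' :: "'f fls" assume "z' - z \<in> disc n (int r)" "z \<in> cong1 n r"
  then show "z' \<in> cong1 n r" using disc_add[of "z' - z" n "int r" "z - 1"] by (simp add: cong1_def)
qed

section \<open>Compact sets in \<open>Z\<^sub>n\<close>\<close>

definition trunc_series :: "nat \<Rightarrow> (int \<Rightarrow> 'f) \<Rightarrow> 'f fls" where
  "trunc_series n g = fps_to_fls (Abs_fps (\<lambda>i. if i \<le> n then g (int i) else 0))"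

lemma trunc_series_nth: "trunc_series n g $$ i = (if i \<in> {0..int n} then g i else 0)"
  by (auto simp: trunc_series_def)

lemma disc_cover:
  "\<exists>D. finite D \<and> D \<subseteq> disc n M \<and> (\<forall>x\<in>disc n M. \<exists>d\<in>D. x - d \<in> disc n (M + int N))"
proof -
  obtain E where E: "finite E" "E \<subseteq> \<pp> 0" "\<And>x. x \<in> \<pp> 0 \<Longrightarrow> \<exists>d\<in>E. x - d \<in> \<pp> (int N)"
    using finite_residues[of N] by blast
  let ?E = "(\<lambda>e. uniformizer powi M * e) ` E"
  let ?D = "trunc_series n ` PiE {0..int n} (\<lambda>_. ?E)"
  show ?thesis
  proof (intro exI conjI ballI)
    show "finite ?D" using E(1) by (intro finite_imageI finite_PiE) auto
    have "?E \<subseteq> \<pp> M" using E(2) by (auto simp: uni_power_mult_in_idealF)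
    then show "?D \<subseteq> disc n M" by (fastforce simp: disc_def trunc_series_nth PiE_iff)
    fix x assume x: "x \<in> disc n M"
    have "\<forall>i\<in>{0..int n}. \<exists>e\<in>E. x $$ i - uniformizer powi M * e \<in> \<pp> (M + int N)"
    proof
      fix i assume "i \<in> {0..int n}"
      then have "uniformizer powi (- M) * x $$ i \<in> \<pp> 0" using x by (auto simp: disc_def uni_power_mult_in_idealF)
      then obtain e where e: "e \<in> E" "uniformizer powi (- M) * x $$ i - e \<in> \<pp> (int N)" using E(3) by blast
      have "uniformizer powi M * (uniformizer powi (- M) * x $$ i - e) \<in> \<pp> (M + int N)"
        unfolding uni_power_mult_in_idealF using e(2) by simp
      then show "\<exists>e\<in>E. x $$ i - uniformizer powi M * e \<in> \<pp> (M + int N)"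
        using e(1) unfolding right_diff_distrib uni_power_cancel by auto
    qed
    then obtain e where e: "\<And>i. i \<in> {0..int n} \<Longrightarrow> e i \<in> E"
        "\<And>i. i \<in> {0..int n} \<Longrightarrow> x $$ i - uniformizer powi M * e i \<in> \<pp> (M + int N)"
      by metis
    let ?g = "restrict (\<lambda>i. uniformizer powi M * e i) {0..int n}"
    have "?g \<in> PiE {0..int n} (\<lambda>_. ?E)" using e(1) by auto
    moreover have "x - trunc_series n ?g \<in> disc n (M + int N)"
      using x e(2) by (auto simp: disc_def trunc_series_nth)
    ultimately show "\<exists>d\<in>?D. x - d \<in> disc n (M + int N)" by blast
  qed
qed

text \<open>The usual subdivision argument. If a cover has no finite subcover, then neither does it on one of the
  finitely many balls of the next smaller radius, and so on. The centres of these balls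
  converge coefficientwise because \<open>F\<close> is complete, and a member of the cover that contains the limit
  contains one of the balls.\<close>

lemma compactin_cong1:
  assumes r: "r \<ge> 1"
  shows "compactin (Z_topology vF n) (cong1 n r)"
  unfolding compactin_def
proof (intro conjI allI impI)
  show "cong1 n r \<subseteq> topspace (Z_topology vF n)" using cong1_subset_O_units[OF r] by simp
  fix \<U> assume \<U>: "Ball \<U> (openin (Z_topology vF n)) \<and> cong1 n r \<subseteq> \<Union>\<U>"
  define P where "P x i = {z \<in> O_units. z - x \<in> disc n (int r + int i)}" for x i
  define good where "good S \<longleftrightarrow> (\<exists>\<F>. finite \<F> \<and> \<F> \<subseteq> \<U> \<and> S \<subseteq> \<Union>\<F>)" for S
  have "good (cong1 n r)"
  proof (rule ccontr)
    assume bad: "\<not> good (cong1 n r)"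
    have step: "\<exists>y. \<not> good (P y (Suc i)) \<and> y - x \<in> disc n (int r + int i)"
      if x: "\<not> good (P x i)" for x i
    proof (rule ccontr)
      assume neg: "\<not> ?thesis"
      obtain D where D: "finite D" "D \<subseteq> disc n (int r + int i)"
          "\<forall>y\<in>disc n (int r + int i). \<exists>d\<in>D. y - d \<in> disc n (int r + int i + int 1)"
        using disc_cover[of n "int r + int i" 1] by auto
      have "good (P (x + d) (Suc i))" if "d \<in> D" for d
      proof -
        have "(x + d) - x \<in> disc n (int r + int i)" using that D(2) by auto
        with neg show ?thesis by metis
      qed
      then have "\<forall>d\<in>D. \<exists>\<F>. finite \<F> \<and> \<F> \<subseteq> \<U> \<and> P (x + d) (Suc i) \<subseteq> \<Union>\<F>"
        unfolding good_def by (intro ballI)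
      from bchoice[OF this] obtain \<F> where
        \<F>: "\<forall>d\<in>D. finite (\<F> d) \<and> \<F> d \<subseteq> \<U> \<and> P (x + d) (Suc i) \<subseteq> \<Union>(\<F> d)"
        by (elim exE)
      have "P x i \<subseteq> \<Union>(\<Union>(\<F> ` D))"
      proof
        fix z assume z: "z \<in> P x i"
        then obtain d where d: "d \<in> D" "z - x - d \<in> disc n (int r + int i + int 1)"
          using D(3) by (auto simp: P_def)
        have e: "z - (x + d) = z - x - d" "int r + int (Suc i) = int r + int i + int 1" by simp_all
        have "z - (x + d) \<in> disc n (int r + int (Suc i))" unfolding e by (rule d(2))
        then have "z \<in> P (x + d) (Suc i)" using z unfolding P_def by blast
        moreover have "P (x + d) (Suc i) \<subseteq> \<Union>(\<F> d)" using \<F> d(1) by simp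
        ultimately have "z \<in> \<Union>(\<F> d)" by (rule rev_subsetD)
        then show "z \<in> \<Union>(\<Union>(\<F> ` D))" using d(1) by (meson UN_I UnionE UnionI)
      qed
      moreover have "finite (\<Union>(\<F> ` D))" "\<Union>(\<F> ` D) \<subseteq> \<U>"
        using \<F> D(1) by (simp_all add: UN_least)
      ultimately have "good (P x i)" unfolding good_def by (intro exI[of _ "\<Union>(\<F> ` D)"] conjI)
      with x show False by (rule notE)
    qed
    have "cong1 n r = P 1 0" using cong1_subset_O_units[OF r] by (auto simp: cong1_def P_def)
    then have base: "\<not> good (P 1 0)" using bad by simp
    define X where "X = rec_nat 1 (\<lambda>i x. SOME y. \<not> good (P y (Suc i)) \<and> y - x \<in> disc n (int r + int i))"
    have X0: "X 0 = 1" and XS: "X (Suc i) = (SOME y. \<not> good (P y (Suc i)) \<and> y - X i \<in> disc n (int r + int i))" for i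
      by (simp_all add: X_def)
    have X: "\<not> good (P (X i) i)" for i
    proof (induction i)
      case (Suc i)
      show ?case using someI_ex[OF step[OF Suc]] unfolding XS[symmetric] by blast
    qed (use base X0 in simp)
    have X_step: "X (Suc i) - X i \<in> disc n (int r + int i)" for i
      using someI_ex[OF step[OF X[of i]]] unfolding XS[symmetric] by blast
    have X_cauchy: "X (i + m) - X i \<in> disc n (int r + int i)" for i m
    proof (induction m)
      case (Suc m)
      have "X (Suc (i + m)) - X (i + m) \<in> disc n (int r + int i)"
        using X_step by (rule disc_mono) auto
      from disc_add[OF this Suc] show ?case by simp
    qed simp
    have X_cauchy': "X l - X i \<in> disc n (int r + int m)" if "l \<ge> m" "i \<ge> m" for l i m
      using disc_diff[OF X_cauchy[of m "l - m"] X_cauchy[of m "i - m"]] that by simp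
    have "\<exists>y. \<forall>N. \<exists>n0. \<forall>l\<ge>n0. X l $$ k - y \<in> \<pp> N" if k: "k \<in> {0..int n}" for k
    proof (rule complete, rule allI)
      fix N
      have "X l $$ k - X i $$ k \<in> \<pp> N" if "l \<ge> nat N" "i \<ge> nat N" for l i
      proof -
        have "X l $$ k - X i $$ k \<in> \<pp> (int r + int (nat N))"
          using X_cauchy'[OF that] k by (auto simp: disc_def)
        then show ?thesis by (rule idealF_mono) auto
      qed
      then show "\<exists>n0. \<forall>l\<ge>n0. \<forall>i\<ge>n0. X l $$ k - X i $$ k \<in> \<pp> N" by blast
    qed
    then obtain y where y: "\<And>k N. k \<in> {0..int n} \<Longrightarrow> \<exists>n0. \<forall>l\<ge>n0. X l $$ k - y k \<in> \<pp> N" by metis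
    define z where "z = trunc_series n y"
    have Xneg: "X i $$ k = 0" if "k < 0" for i k
      using X_cauchy[of 0 i] X0 that by (auto simp: disc_def)
    have zX: "z - X i \<in> disc n (int r + int i)" for i
    proof -
      have "y k - X i $$ k \<in> \<pp> (int r + int i)" if k: "k \<in> {0..int n}" for k
      proof -
        obtain n0 where "\<forall>l\<ge>n0. X l $$ k - y k \<in> \<pp> (int r + int i)" using y[OF k] by blast
        then have "X (i + n0) $$ k - y k \<in> \<pp> (int r + int i)" by simp
        moreover have "X (i + n0) $$ k - X i $$ k \<in> \<pp> (int r + int i)"
          using X_cauchy[of i n0] k by (auto simp: disc_def)
        ultimately have "(X (i + n0) $$ k - X i $$ k) - (X (i + n0) $$ k - y k) \<in> \<pp> (int r + int i)"
          by (rule idealF_diff[rotated])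
        then show ?thesis by simp
      qed
      then show ?thesis by (auto simp: disc_def z_def trunc_series_nth Xneg)
    qed
    have "z \<in> cong1 n r" using zX[of 0] X0 by (simp add: cong1_def)
    then obtain U where U: "U \<in> \<U>" "z \<in> U" using \<U> by blast
    then obtain N where N: "\<And>z'. z' \<in> O_units \<Longrightarrow> z' - z \<in> disc n N \<Longrightarrow> z' \<in> U"
      using \<U> unfolding openin_Z_topology_iff by meson
    have "P (X (nat N)) (nat N) \<subseteq> U"
    proof
      fix z' assume z': "z' \<in> P (X (nat N)) (nat N)"
      then have "z' - X (nat N) \<in> disc n (int r + int (nat N))" unfolding P_def by blast
      from disc_diff[OF this zX] have "z' - z \<in> disc n (int r + int (nat N))" by (simp only: diff_diff_eq2 diff_add_cancel)
      then have "z' - z \<in> disc n N" by (intro disc_mono[of "z' - z" n "int r + int (nat N)" n N]) auto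
      then show "z' \<in> U" using N z' by (simp add: P_def)
    qed
    then have "good (P (X (nat N)) (nat N))" using U(1) unfolding good_def by (intro exI[of _ "{U}"]) simp
    then show False using X by simp
  qed
  then show "\<exists>\<F>. finite \<F> \<and> \<F> \<subseteq> \<U> \<and> cong1 n r \<subseteq> \<Union>\<F>" unfolding good_def .
qed

lemma compact_uniform:
  assumes C: "compactin (Z_topology vF n) C" and f: "f \<in> LC vF n"
  shows "\<exists>N. \<forall>z\<in>C. \<forall>z'\<in>O_units. z' - z \<in> disc n N \<longrightarrow> f z' = f z"
proof -
  have CO: "C \<subseteq> O_units" using compactin_subset_topspace[OF C] by simp
  have "\<forall>z\<in>O_units. \<exists>N. \<forall>z'\<in>O_units. z' - z \<in> disc n N \<longrightarrow> f z' = f z"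
    using f unfolding LC_iff by blast
  then obtain M where M: "\<And>z z'. z \<in> O_units \<Longrightarrow> z' \<in> O_units \<Longrightarrow> z' - z \<in> disc n (M z) \<Longrightarrow> f z' = f z"
    by metis
  let ?P = "\<lambda>x. {z \<in> O_units. z - x \<in> disc n (M x)}"
  have op: "openin (Z_topology vF n) (?P x)" for x
    unfolding openin_Z_topology_iff
  proof (intro conjI ballI)
    fix z assume z: "z \<in> ?P x"
    show "\<exists>N. \<forall>z'\<in>O_units. z' - z \<in> disc n N \<longrightarrow> z' \<in> ?P x"
    proof (intro exI ballI impI)
      fix z' assume "z' \<in> O_units" "z' - z \<in> disc n (M x)"
      then show "z' \<in> ?P x" using disc_add[of "z' - z" n "M x" "z - x"] z by auto
    qed
  qed auto
  have "\<forall>U\<in>?P ` C. openin (Z_topology vF n) U" "C \<subseteq> \<Union>(?P ` C)" using op CO by auto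
  then obtain \<F> where "finite \<F>" "\<F> \<subseteq> ?P ` C" "C \<subseteq> \<Union>\<F>"
    using C unfolding compactin_def by meson
  then obtain X where X: "X \<subseteq> C" "finite X" "C \<subseteq> \<Union>(?P ` X)"
    using finite_subset_image[of \<F> ?P C] by blast
  define N where "N = Max (insert 0 (M ` X))"
  have N: "M x \<le> N" if "x \<in> X" for x using that X(2) by (auto simp: N_def)
  have "f z' = f z" if z: "z \<in> C" "z' \<in> O_units" "z' - z \<in> disc n N" for z z'
  proof -
    obtain x where x: "x \<in> X" "z \<in> O_units" "z - x \<in> disc n (M x)" using X(3) z(1) by blast
    have "z' - z \<in> disc n (M x)" using z(3) by (rule disc_mono) (use N x in auto)
    then have "(z' - z) + (z - x) \<in> disc n (M x)" using x(3) by (rule disc_add)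
    then have "f z' = f x" using M[of x z'] x X(1) CO z(2) by auto
    moreover have "f z = f x" using M[of x z] x X(1) CO by auto
    ultimately show ?thesis by simp
  qed
  then show ?thesis by blast
qed

lemma compact_bounded:
  assumes C: "compactin (Z_topology vF n) C"
  shows "\<exists>R\<ge>0. C \<subseteq> disc n (- R)"
proof -
  have CO: "C \<subseteq> O_units" using compactin_subset_topspace[OF C] by simp
  let ?P = "\<lambda>R. O_units \<inter> disc n (- int R)"
  have op: "openin (Z_topology vF n) (?P x)" for x
    unfolding openin_Z_topology_iff
  proof (intro conjI ballI)
    fix z assume z: "z \<in> ?P x"
    show "\<exists>N. \<forall>z'\<in>O_units. z' - z \<in> disc n N \<longrightarrow> z' \<in> ?P x"
    proof (intro exI ballI impI)
      fix z' assume "z' \<in> O_units" "z' - z \<in> disc n (- int x)"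
      then show "z' \<in> ?P x" using disc_add[of "z' - z" n "- int x" z] z by auto
    qed
  qed auto
  have "C \<subseteq> \<Union>(range ?P)"
  proof
    fix z assume z: "z \<in> C"
    then have "\<forall>i<0. z $$ i = 0" using CO O_units_iff by blast
    from disc_exists_bound[OF this, of n] obtain R where "R \<ge> 0" "z \<in> disc n (- R)" by blast
    then have "z \<in> ?P (nat R)" using z CO by auto
    then show "z \<in> \<Union>(range ?P)" by blast
  qed
  moreover have "\<forall>U\<in>range ?P. openin (Z_topology vF n) U" using op by auto
  ultimately obtain \<F> where "finite \<F>" "\<F> \<subseteq> range ?P" "C \<subseteq> \<Union>\<F>"
    using C unfolding compactin_def by meson
  then obtain X where X: "finite X" "C \<subseteq> \<Union>(?P ` X)"
    using finite_subset_image[of \<F> ?P UNIV] by blast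
  have "C \<subseteq> disc n (- int (Max (insert 0 X)))"
  proof
    fix z assume "z \<in> C"
    then obtain x where "x \<in> X" "z \<in> disc n (- int x)" using X(2) by blast
    then show "z \<in> disc n (- int (Max (insert 0 X)))"
      by (auto elim!: disc_mono simp: X(1))
  qed
  then show ?thesis by (intro exI[of _ "int (Max (insert 0 X))"]) auto
qed

text \<open>The cosets of \<open>cong1 n r\<close> are open, and two of them are equal or disjoint; so it suffices to select
  one representative of each coset in a finite subcover.\<close>

lemma compact_coset_cover:
  assumes C: "compactin (Z_topology vF n) C" and r: "r \<ge> 1"
  shows "\<exists>X\<subseteq>O_units. finite X \<and> (\<forall>z\<in>C. \<exists>!x. x \<in> X \<and> inverse x * z \<in> cong1 n r)"
proof -
  have CO: "C \<subseteq> O_units" using compactin_subset_topspace[OF C] by simp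
  let ?P = "\<lambda>x. {z \<in> O_units. inverse x * z \<in> cong1 n r}"
  have op: "openin (Z_topology vF n) (?P x)" if x: "x \<in> O_units" for x
  proof -
    have ind: "(\<lambda>z. indicator (cong1 n r) (inverse x * z) :: complex) \<in> LC vF n"
      by (intro LC_translate LC_cong1_indicator r O_units_inverse x)
    have eq: "(indicator (cong1 n r) (inverse x * z) = (1::complex)) = (inverse x * z \<in> cong1 n r)" for z
      by (simp add: indicator_def)
    show ?thesis unfolding openin_Z_topology_iff
      using ind unfolding LC_iff by (smt (verit) eq mem_Collect_eq subsetI)
  qed
  have inv1: "inverse x * x \<in> cong1 n r" if "x \<in> C" for x
  proof -
    have "x \<noteq> 0" using that CO O_units_nonzero by blast
    then show ?thesis by simp
  qed
  then have "C \<subseteq> \<Union>(?P ` C)" using CO by auto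
  moreover have "\<forall>U\<in>?P ` C. openin (Z_topology vF n) U" using op CO by auto
  ultimately obtain \<F> where "finite \<F>" "\<F> \<subseteq> ?P ` C" "C \<subseteq> \<Union>\<F>"
    using C unfolding compactin_def by meson
  then obtain Y where Y: "Y \<subseteq> C" "finite Y" "C \<subseteq> \<Union>(?P ` Y)"
    using finite_subset_image[of \<F> ?P C] by blast
  define rep where "rep x = (SOME y. y \<in> ?P x)" for x
  have rep: "rep x \<in> ?P x" if "x \<in> Y" for x
  proof -
    have "x \<in> ?P x" using that Y(1) CO inv1 by auto
    then show ?thesis unfolding rep_def by (rule someI)
  qed
  have same: "?P x = ?P y" if xy: "x \<in> O_units" "y \<in> O_units" "inverse x * y \<in> cong1 n r" for x y
  proof -
    have nz: "x \<noteq> 0" "y \<noteq> 0" using xy O_units_nonzero by auto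
    have yx: "inverse y * x \<in> cong1 n r" using cong1_inverse[OF r xy(3)] nz by (simp add: mult.commute)
    have e: "inverse x * z = (inverse x * y) * (inverse y * z)" "inverse y * z = (inverse y * x) * (inverse x * z)" for z
      using nz by (simp_all add: mult.assoc)
    show ?thesis using cong1_mult xy(3) yx e by (metis (no_types, lifting))
  qed
  have YO: "Y \<subseteq> O_units" using Y(1) CO by blast
  show ?thesis
  proof (intro exI[of _ "rep ` Y"] conjI ballI)
    show "rep ` Y \<subseteq> O_units" using rep by auto
    show "finite (rep ` Y)" using Y by simp
    fix z assume z: "z \<in> C"
    then obtain x where x: "x \<in> Y" "z \<in> ?P x" using Y(3) by blast
    have "?P x = ?P (rep x)" using rep[OF x(1)] x(1) YO by (intro same) auto
    then have "z \<in> ?P (rep x)" using x(2) by simp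
    moreover have "y = rep x" if y: "y \<in> rep ` Y" "inverse y * z \<in> cong1 n r" for y
    proof -
      obtain x' where x': "x' \<in> Y" "y = rep x'" using y by blast
      have "?P x' = ?P y" using rep[OF x'(1)] x' YO by (intro same) auto
      moreover have "?P y = ?P z" using rep[OF x'(1)] x'(2) y(2) z CO by (intro same) auto
      moreover have "?P x = ?P z" using x YO z CO by (intro same) auto
      ultimately have "?P x' = ?P x" by simp
      then show ?thesis using x' by (simp add: rep_def)
    qed
    ultimately show "\<exists>!y. y \<in> rep ` Y \<and> inverse y * z \<in> cong1 n r"
      using x(1) by (intro ex1I[of _ "rep x"]) auto
  qed
qed

section \<open>Sums over representatives of a finite quotient ring\<close>

definition rep_set :: "nat \<Rightarrow> int \<Rightarrow> 'f fls set \<Rightarrow> bool" where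
  "rep_set n N X \<longleftrightarrow> finite X \<and> X \<subseteq> disc n 0 \<and> (\<forall>x\<in>disc n 0. \<exists>!d. d \<in> X \<and> x - d \<in> disc n N)"

definition periodic :: "nat \<Rightarrow> int \<Rightarrow> ('f fls \<Rightarrow> complex) \<Rightarrow> bool" where
  "periodic n N g \<longleftrightarrow> (\<forall>x\<in>disc n 0. \<forall>y\<in>disc n 0. x - y \<in> disc n N \<longrightarrow> g x = g y)"

text \<open>Representatives with nonzero constant coefficient are available because adding an element of valuation
  \<open>N\<close> to the constant coefficient does not change the class. They will serve as numerators of elements
  of \<open>K\<close> of a prescribed valuation.\<close>

lemma rep_set_exists:
  assumes N: "N \<ge> 0"
  shows "\<exists>X. rep_set n N X \<and> (\<forall>d\<in>X. d $$ 0 \<noteq> 0)"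
proof -
  obtain D where D: "finite D" "D \<subseteq> disc n 0" "\<And>x. x \<in> disc n 0 \<Longrightarrow> \<exists>d\<in>D. x - d \<in> disc n N"
    using disc_cover[of n 0 "nat N"] N by auto
  define cls where "cls x = {y \<in> disc n 0. y - x \<in> disc n N \<and> y $$ 0 \<noteq> 0}" for x
  define rep where "rep x = (SOME y. y \<in> cls x)" for x
  have rep: "rep x \<in> cls x" if x: "x \<in> disc n 0" for x
  proof -
    let ?s = "fls_const (uniformizer powi N)"
    have "?s \<in> disc n N" by (auto simp: disc_def)
    then have "x + ?s \<in> disc n 0" "x + ?s - x \<in> disc n N"
      using disc_add[OF x, of ?s] disc_mono[of ?s n N n 0] N by auto
    then have "(if x $$ 0 = 0 then x + ?s else x) \<in> cls x" using x by (auto simp: cls_def)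
    then show ?thesis unfolding rep_def by (rule someI)
  qed
  have eq: "rep x = rep y" if "x - y \<in> disc n N" for x y
  proof -
    have "(z - x \<in> disc n N) = (z - y \<in> disc n N)" for z
      using disc_add[of "z - x" n N "x - y"] disc_diff[of "z - y" n N "x - y"] that by auto
    then show ?thesis by (simp add: rep_def cls_def)
  qed
  have "\<exists>!d. d \<in> rep ` D \<and> x - d \<in> disc n N" if x: "x \<in> disc n 0" for x
  proof -
    obtain d where d: "d \<in> D" "x - d \<in> disc n N" using D(3) x by blast
    have d': "rep d - d \<in> disc n N" using rep[of d] d(1) D(2) by (auto simp: cls_def)
    have "y = rep d" if y: "y \<in> rep ` D" "x - y \<in> disc n N" for y
    proof -
      obtain e where e: "e \<in> D" "y = rep e" using y by blast
      have "rep e - e \<in> disc n N" using rep[of e] e(1) D(2) by (auto simp: cls_def)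
      from disc_add[OF disc_minus_sym[OF d(2)] disc_add[OF y(2) this[folded e(2)]]]
      have "d - e \<in> disc n N" by simp
      then show ?thesis using eq e by metis
    qed
    moreover have "x - rep d \<in> disc n N" using disc_diff[OF d(2) d'] by simp
    ultimately show ?thesis using d(1) by (intro ex1I[of _ "rep d"]) auto
  qed
  moreover have "rep ` D \<subseteq> disc n 0" "\<forall>d\<in>rep ` D. d $$ 0 \<noteq> 0"
    using rep D(2) by (auto simp: cls_def)
  ultimately show ?thesis unfolding rep_set_def using D(1) by (intro exI[of _ "rep ` D"]) auto
qed

lemma rep_set_nonempty: "rep_set n N X \<Longrightarrow> card X \<noteq> 0"
  unfolding rep_set_def using disc_0 by (metis card_eq_0_iff emptyE)

text \<open>On the finite quotient \<open>disc n 0/disc n N\<close> the map \<open>\<tau>\<close>, followed by the choice of a representative, is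
  injective and hence a permutation.\<close>

lemma rep_set_sum_reindex:
  assumes X: "rep_set n N X" and g: "periodic n N g"
    and t: "\<And>x. x \<in> disc n 0 \<Longrightarrow> \<tau> x \<in> disc n 0"
    and inj: "\<And>x y. x \<in> disc n 0 \<Longrightarrow> y \<in> disc n 0 \<Longrightarrow> \<tau> x - \<tau> y \<in> disc n N \<Longrightarrow> x - y \<in> disc n N"
  shows "(\<Sum>d\<in>X. g (\<tau> d)) = (\<Sum>d\<in>X. g d)"
proof -
  have fin: "finite X" and XO: "X \<subseteq> disc n 0"
    and ex1: "\<And>x. x \<in> disc n 0 \<Longrightarrow> \<exists>!d. d \<in> X \<and> x - d \<in> disc n N"
    using X by (auto simp: rep_set_def)
  define c where "c x = (THE d. d \<in> X \<and> x - d \<in> disc n N)" for x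
  have c: "c x \<in> X" "x - c x \<in> disc n N" if "x \<in> disc n 0" for x
    using theI'[OF ex1[OF that]] by (auto simp: c_def)
  have "inj_on (\<lambda>d. c (\<tau> d)) X"
  proof (rule inj_onI)
    fix x y assume x: "x \<in> X" and y: "y \<in> X" and e: "c (\<tau> x) = c (\<tau> y)"
    have xO: "x \<in> disc n 0" and yO: "y \<in> disc n 0" using x y XO by auto
    have "\<tau> x - c (\<tau> x) - (\<tau> y - c (\<tau> y)) \<in> disc n N"
      by (rule disc_diff[OF c(2)[OF t[OF xO]] c(2)[OF t[OF yO]]])
    then have "x - y \<in> disc n N" using inj[OF xO yO] e by simp
    moreover have "x - x \<in> disc n N" by simp
    ultimately show "x = y" using ex1[OF xO] x y by blast
  qed
  moreover have "(\<lambda>d. c (\<tau> d)) ` X \<subseteq> X" using c(1) t XO by blast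
  ultimately have "bij_betw (\<lambda>d. c (\<tau> d)) X X"
    using fin by (simp add: bij_betw_def endo_inj_surj)
  then have "(\<Sum>d\<in>X. g d) = (\<Sum>d\<in>X. g (c (\<tau> d)))"
    by (rule sum.reindex_bij_betw[symmetric])
  also have "\<dots> = (\<Sum>d\<in>X. g (\<tau> d))"
  proof (rule sum.cong)
    fix d assume "d \<in> X"
    then have "\<tau> d \<in> disc n 0" using t XO by auto
    then show "g (c (\<tau> d)) = g (\<tau> d)"
      using c[of "\<tau> d"] XO g unfolding periodic_def by (metis subsetD)
  qed simp
  finally show ?thesis by simp
qed

lemma rep_set_sum_translate:
  assumes X: "rep_set n N X" and g: "periodic n N g" and y: "y \<in> disc n 0"
  shows "(\<Sum>d\<in>X. g (y + d)) = (\<Sum>d\<in>X. g d)"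
  by (rule rep_set_sum_reindex[OF X g]) (auto intro: disc_add y)

lemma rep_set_sum_char:
  assumes X: "rep_set n N X" and ch: "periodic n N ch"
    and add: "\<And>x y. ch (x + y) = ch x * ch y" and y: "y \<in> disc n 0" "ch y \<noteq> 1"
  shows "(\<Sum>d\<in>X. ch d) = 0"
proof -
  have "(\<Sum>d\<in>X. ch d) = (\<Sum>d\<in>X. ch (y + d))"
    using rep_set_sum_translate[OF X ch y(1)] by simp
  also have "\<dots> = ch y * (\<Sum>d\<in>X. ch d)" by (simp add: add sum_distrib_left)
  finally show ?thesis using y(2) by (simp add: algebra_simps)
qed

text \<open>Compute the double sum of \<open>g (d' + d)\<close> over both sets of representatives in two orders; by translation
  invariance each inner sum is constant.\<close>

lemma rep_set_avg_eq:
  assumes X: "rep_set n N X" "periodic n N g" and X': "rep_set n' N' X'" "periodic n' N' g"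
    and le: "n \<le> n'"
  shows "(\<Sum>d\<in>X. g d) / card X = (\<Sum>d\<in>X'. g d) / card X'"
proof -
  have XO: "X \<subseteq> disc n 0" and XO': "X' \<subseteq> disc n' 0" using X X' by (auto simp: rep_set_def)
  have sub: "disc n' 0 \<subseteq> disc n 0" using le by (auto elim: disc_mono)
  have 1: "(\<Sum>d\<in>X. g (d' + d)) = (\<Sum>d\<in>X. g d)" if "d' \<in> X'" for d'
    using rep_set_sum_translate[OF X, of d'] that XO' sub by auto
  have 2: "(\<Sum>d'\<in>X'. g (d' + d)) = (\<Sum>d'\<in>X'. g d')" if d: "d \<in> X" for d
  proof -
    define e where "e = trunc_series n (fls_nth d)"
    have dO: "d \<in> disc n 0" using d XO by blast
    have eO: "e \<in> disc n' 0" using dO by (auto simp: e_def disc_def trunc_series_nth)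
    have de: "d - e \<in> disc n N" using dO by (auto simp: e_def disc_def trunc_series_nth)
    have "g (d' + d) = g (e + d')" if "d' \<in> X'" for d'
    proof -
      have "d' \<in> disc n 0" "e \<in> disc n 0" using that XO' sub eO by auto
      moreover have "d' + d - (e + d') \<in> disc n N" using de by simp
      ultimately show ?thesis using X(2) dO disc_add unfolding periodic_def by blast
    qed
    then have "(\<Sum>d'\<in>X'. g (d' + d)) = (\<Sum>d'\<in>X'. g (e + d'))" by simp
    also have "\<dots> = (\<Sum>d'\<in>X'. g d')" by (rule rep_set_sum_translate[OF X' eO])
    finally show ?thesis .
  qed
  have "of_nat (card X') * (\<Sum>d\<in>X. g d) = (\<Sum>d'\<in>X'. \<Sum>d\<in>X. g (d' + d))" using 1 by simp
  also have "\<dots> = (\<Sum>d\<in>X. \<Sum>d'\<in>X'. g (d' + d))" by (rule sum.swap)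
  also have "\<dots> = of_nat (card X) * (\<Sum>d\<in>X'. g d)" using 2 by simp
  finally show ?thesis
    using rep_set_nonempty[OF X(1)] rep_set_nonempty[OF X'(1)] by (simp add: field_simps)
qed

section \<open>Haar measure of a congruence subgroup\<close>

definition scal :: "nat \<Rightarrow> 'f fls \<Rightarrow> 'f fls" where
  "scal r x = fls_const (uniformizer powi int r) * x"

lemma scal_nth: "scal r x $$ i = uniformizer powi int r * x $$ i"
  by (simp add: scal_def)

lemma scal_disc: "scal r x \<in> disc n (int r + N) \<longleftrightarrow> x \<in> disc n N"
  unfolding disc_def mem_Collect_eq scal_nth uni_power_mult_in_idealF by simp

lemma cong1_scal: "1 + scal r x \<in> cong1 n r \<longleftrightarrow> x \<in> disc n 0"
  using scal_disc[of r x n 0] by (simp add: cong1_def)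

lemma cong1_scalE:
  assumes "z \<in> cong1 n r"
  obtains x where "x \<in> disc n 0" "z = 1 + scal r x"
proof -
  define x where "x = fls_const (uniformizer powi (- int r)) * (z - 1)"
  have z: "z = 1 + scal r x"
    by (rule fls_eqI) (simp only: scal_nth x_def fls_mult_const_nth fls_plus_nth uni_power_cancel, simp)
  then show ?thesis using assms that cong1_scal by blast
qed

definition LCinf :: "('f fls \<Rightarrow> complex) set" where
  "LCinf = (\<Union>n. LC vF n)"

text \<open>The average of \<open>f\<close> over \<open>cong1 n r\<close>, written additively by means of \<open>x \<mapsto> 1 + \<varpi>\<^sup>r x\<close>. Multiplicative and
  additive Haar measure agree on this group up to a constant.\<close>

definition is_avg :: "nat \<Rightarrow> ('f fls \<Rightarrow> complex) \<Rightarrow> complex \<Rightarrow> bool" where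
  "is_avg r f c \<longleftrightarrow> (\<exists>n N X. rep_set n N X \<and> periodic n N (\<lambda>x. f (1 + scal r x)) \<and>
     c = (\<Sum>d\<in>X. f (1 + scal r d)) / card X)"

lemma is_avg_unique: "is_avg r f c \<Longrightarrow> is_avg r f c' \<Longrightarrow> c = c'"
  unfolding is_avg_def using rep_set_avg_eq by (metis (no_types, lifting) linorder_le_cases)

text \<open>One functional for all levels at once: by \<open>rep_set_avg_eq\<close> the value does not depend on the \<open>n\<close> for
  which \<open>f\<close> is regarded as a function on \<open>Z\<^sub>n\<close>. So it is a compatible system of measures, that is, an
  element of \<open>\<M>\<close>.\<close>

definition haar :: "nat \<Rightarrow> ('f fls \<Rightarrow> complex) \<Rightarrow> complex" where
  "haar r f = (if f \<in> LCinf then (THE c. is_avg r f c) else 0)"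

lemma haar_eq:
  assumes "f \<in> LCinf" "rep_set n N X" "periodic n N (\<lambda>x. f (1 + scal r x))"
  shows "haar r f = (\<Sum>d\<in>X. f (1 + scal r d)) / card X"
proof -
  have "is_avg r f ((\<Sum>d\<in>X. f (1 + scal r d)) / card X)" unfolding is_avg_def using assms by blast
  then have "(THE c. is_avg r f c) = (\<Sum>d\<in>X. f (1 + scal r d)) / card X"
    using is_avg_unique by blast
  then show ?thesis using assms(1) by (simp add: haar_def)
qed

lemma LC_periodic:
  assumes r: "r \<ge> 1" and f: "f \<in> LC vF n"
  shows "\<exists>N0. \<forall>N\<ge>N0. periodic n N (\<lambda>x. f (1 + scal r x))"
proof -
  obtain M where M: "\<forall>z\<in>cong1 n r. \<forall>z'\<in>O_units. z' - z \<in> disc n M \<longrightarrow> f z' = f z"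
    using compact_uniform[OF compactin_cong1[OF r] f] by blast
  have "f (1 + scal r x) = f (1 + scal r y)"
    if x: "x \<in> disc n 0" and y: "y \<in> disc n 0" and N: "N \<ge> M - int r" and xy: "x - y \<in> disc n N" for x y N
  proof -
    have "1 + scal r x \<in> cong1 n r" "1 + scal r y \<in> cong1 n r" using x y by (simp_all add: cong1_scal)
    moreover have "scal r (x - y) \<in> disc n (int r + N)" using xy by (simp add: scal_disc)
    then have "scal r (x - y) \<in> disc n M" by (rule disc_mono) (use N in auto)
    then have "1 + scal r x - (1 + scal r y) \<in> disc n M" by (simp add: scal_def right_diff_distrib)
    ultimately show ?thesis using M cong1_subset_O_units[OF r] by blast
  qed
  then have "\<forall>N\<ge>M - int r. periodic n N (\<lambda>x. f (1 + scal r x))"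
    unfolding periodic_def by blast
  then show ?thesis ..
qed

lemma LC_LCinf: "f \<in> LC vF n \<Longrightarrow> f \<in> LCinf"
  by (auto simp: LCinf_def)

text \<open>Finitely many functions are periodic to a common precision, so identities between their averages can
  be checked on one set of representatives.\<close>

lemma haar_common:
  assumes r: "r \<ge> 1" and F: "finite F" "F \<subseteq> LC vF n"
  obtains N X where "rep_set n N X" "N \<ge> 0" "\<And>f. f \<in> F \<Longrightarrow> periodic n N (\<lambda>x. f (1 + scal r x))"
    "\<And>f. f \<in> F \<Longrightarrow> haar r f = (\<Sum>d\<in>X. f (1 + scal r d)) / card X"
proof -
  have "\<forall>f\<in>F. \<exists>N0. \<forall>N\<ge>N0. periodic n N (\<lambda>x. f (1 + scal r x))"
    using LC_periodic[OF r] F(2) by blast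
  then obtain N0 where N0: "\<And>f N. f \<in> F \<Longrightarrow> N \<ge> N0 f \<Longrightarrow> periodic n N (\<lambda>x. f (1 + scal r x))"
    by metis
  define N where "N = Max (insert 0 (N0 ` F))"
  have N: "N \<ge> 0" "\<And>f. f \<in> F \<Longrightarrow> N \<ge> N0 f" using F(1) by (auto simp: N_def)
  obtain X where X: "rep_set n N X" using rep_set_exists[OF N(1)] by blast
  show ?thesis
  proof (rule that[OF X N(1)])
    fix f assume f: "f \<in> F"
    show p: "periodic n N (\<lambda>x. f (1 + scal r x))" using N0 N f by blast
    show "haar r f = (\<Sum>d\<in>X. f (1 + scal r d)) / card X"
      using haar_eq[OF _ X p] f F(2) LC_LCinf by blast
  qed
qed

lemma haar_add:
  assumes r: "r \<ge> 1" and f: "f \<in> LC vF n" and g: "g \<in> LC vF n"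
  shows "haar r (\<lambda>z. f z + g z) = haar r f + haar r g"
proof -
  obtain N X where *: "rep_set n N X" "N \<ge> 0"
    "\<And>h. h \<in> {f, g, \<lambda>z. f z + g z} \<Longrightarrow> periodic n N (\<lambda>x. h (1 + scal r x))"
    "\<And>h. h \<in> {f, g, \<lambda>z. f z + g z} \<Longrightarrow> haar r h = (\<Sum>d\<in>X. h (1 + scal r d)) / card X"
    using haar_common[OF r, of "{f, g, \<lambda>z. f z + g z}" n] f g LC_add by auto
  show ?thesis using *(4) by (simp add: sum.distrib add_divide_distrib)
qed

lemma haar_cmult:
  assumes r: "r \<ge> 1" and f: "f \<in> LC vF n"
  shows "haar r (\<lambda>z. c * f z) = c * haar r f"
proof -
  obtain N X where *: "rep_set n N X" "N \<ge> 0"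
    "\<And>h. h \<in> {f, \<lambda>z. c * f z} \<Longrightarrow> periodic n N (\<lambda>x. h (1 + scal r x))"
    "\<And>h. h \<in> {f, \<lambda>z. c * f z} \<Longrightarrow> haar r h = (\<Sum>d\<in>X. h (1 + scal r d)) / card X"
    using haar_common[OF r, of "{f, \<lambda>z. c * f z}" n] f LC_cmult by auto
  show ?thesis using *(4) by (simp add: sum_distrib_left)
qed

lemma haar_outside_LC: "f \<notin> LCinf \<Longrightarrow> haar r f = 0"
  by (simp add: haar_def)

lemma haar_sum:
  assumes r: "r \<ge> 1" and f: "f \<in> LC vF n"
  shows "\<exists>N X. rep_set n N X \<and> haar r f = (\<Sum>d\<in>X. f (1 + scal r d)) / card X"
  by (rule haar_common[OF r, of "{f}" n]) (use f in auto)

lemma haar_zero: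
  assumes r: "r \<ge> 1" and f: "f \<in> LC vF n" and z: "\<forall>z\<in>cong1 n r. f z = 0"
  shows "haar r f = 0"
proof -
  obtain N X where *: "rep_set n N X" "haar r f = (\<Sum>d\<in>X. f (1 + scal r d)) / card X"
    using haar_sum[OF r f] by blast
  have "f (1 + scal r d) = 0" if "d \<in> X" for d
    using that *(1) z cong1_scal by (auto simp: rep_set_def)
  then show ?thesis by (simp add: *(2))
qed

text \<open>With \<open>u = 1 + \<varpi>\<^sup>r y\<close>, multiplication by \<open>u\<close> becomes the affine map \<open>x \<mapsto> y + u x\<close>, which permutes residue
  classes since \<open>u\<close> is invertible.\<close>

lemma haar_invariant:
  assumes r: "r \<ge> 1" and f: "f \<in> LC vF n" and u: "u \<in> cong1 n r"
  shows "haar r (\<lambda>z. f (u * z)) = haar r f"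
proof -
  have uO: "u \<in> O_units" using u cong1_subset_O_units[OF r] by blast
  have fu: "(\<lambda>z. f (u * z)) \<in> LC vF n" using LC_translate[OF f uO] .
  obtain N X where *: "rep_set n N X" "N \<ge> 0"
    "\<And>h. h \<in> {f, \<lambda>z. f (u * z)} \<Longrightarrow> periodic n N (\<lambda>x. h (1 + scal r x))"
    "\<And>h. h \<in> {f, \<lambda>z. f (u * z)} \<Longrightarrow> haar r h = (\<Sum>d\<in>X. h (1 + scal r d)) / card X"
    using haar_common[OF r, of "{f, \<lambda>z. f (u * z)}" n] f fu by auto
  obtain y where y: "y \<in> disc n 0" "u = 1 + scal r y" using cong1_scalE[OF u] .
  have eq: "u * (1 + scal r d) = 1 + scal r (y + u * d)" for d
    by (subst y(2)) (simp add: scal_def y(2) algebra_simps)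
  have u0: "u \<in> disc n 0" by (rule cong1_disc[OF u])
  have "(\<Sum>d\<in>X. f (1 + scal r (y + u * d))) = (\<Sum>d\<in>X. f (1 + scal r d))"
  proof (rule rep_set_sum_reindex[OF *(1), of "\<lambda>x. f (1 + scal r x)"])
    show "periodic n N (\<lambda>x. f (1 + scal r x))" using *(3) by simp
    show "y + u * x \<in> disc n 0" if "x \<in> disc n 0" for x
      using disc_add[OF y(1)] disc_mult[OF u0 that] by simp
    fix x x' assume "y + u * x - (y + u * x') \<in> disc n N"
    then have "inverse u * (u * (x - x')) \<in> disc n (0 + N)"
      using cong1_inverse_disc[OF r u] by (intro disc_mult) (auto simp: algebra_simps)
    moreover have "inverse u * (u * (x - x')) = x - x'"
      using O_units_nonzero[OF uO] by (simp flip: mult.assoc)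
    ultimately show "x - x' \<in> disc n N" by simp
  qed
  then show ?thesis using *(4) by (simp add: eq)
qed

lemma haar_measures_Z:
  assumes r: "r \<ge> 1" shows "restrict_meas vF n (haar r) \<in> measures_Z vF n"
  unfolding measures_Z_def mem_Collect_eq
proof (intro conjI allI impI ballI)
  fix f g :: "'f fls \<Rightarrow> complex" and c
  show "f \<notin> LC vF n \<Longrightarrow> restrict_meas vF n (haar r) f = 0" by (simp add: restrict_meas_def)
  show "restrict_meas vF n (haar r) (\<lambda>z. f z + g z) = restrict_meas vF n (haar r) f + restrict_meas vF n (haar r) g"
    if "f \<in> LC vF n" "g \<in> LC vF n"
    using that haar_add[OF r that] by (simp add: restrict_meas_def LC_add)
  show "restrict_meas vF n (haar r) (\<lambda>z. c * f z) = c * restrict_meas vF n (haar r) f"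
    if "f \<in> LC vF n"
    using that haar_cmult[OF r that] by (simp add: restrict_meas_def LC_cmult)
next
  show "\<exists>C. compactin (Z_topology vF n) C \<and>
      (\<forall>f\<in>LC vF n. (\<forall>z\<in>C. f z = 0) \<longrightarrow> restrict_meas vF n (haar r) f = 0)"
    using haar_zero[OF r] by (intro exI[of _ "cong1 n r"]) (auto simp: restrict_meas_def compactin_cong1[OF r])
  have "openin (Z_topology vF n) (cong1 n r)"
    unfolding openin_Z_topology_iff
  proof (intro conjI ballI cong1_subset_O_units[OF r])
    fix z assume z: "z \<in> cong1 n r"
    have "z' \<in> cong1 n r" if "z' - z \<in> disc n (int r)" for z'
      using disc_add[OF that, of "z - 1"] z by (simp add: cong1_def)
    then show "\<exists>N. \<forall>z'\<in>O_units. z' - z \<in> disc n N \<longrightarrow> z' \<in> cong1 n r" by blast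
  qed
  then show "\<exists>U. openin (Z_topology vF n) U \<and> 1 \<in> U \<and>
      (\<forall>u\<in>U. \<forall>f\<in>LC vF n. restrict_meas vF n (haar r) (\<lambda>z. f (u * z)) = restrict_meas vF n (haar r) f)"
    using haar_invariant[OF r] LC_translate cong1_subset_O_units[OF r, THEN subsetD]
    by (intro exI[of _ "cong1 n r"]) (simp add: restrict_meas_def)
qed

lemma haar_indicator_O_units:
  assumes r: "r \<ge> 1"
  shows "haar r (indicator O_units) = 1"
proof -
  have "indicator O_units \<in> LC vF 0" by (rule LC_indicator[of _ 0 0]) auto
  then obtain N X where *: "rep_set 0 N X"
     "haar r (indicator O_units) = (\<Sum>d\<in>X. indicator O_units (1 + scal r d) :: complex) / of_nat (card X)"
    using haar_sum[OF r] by blast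
  have "1 + scal r d \<in> O_units" if "d \<in> X" for d
    using that *(1) cong1_scal[of r d 0] cong1_subset_O_units[OF r, THEN subsetD] by (auto simp: rep_set_def)
  then have "(\<Sum>d\<in>X. indicator O_units (1 + scal r d)) = (\<Sum>d\<in>X. (1::complex))"
    by (intro sum.cong) auto
  then show ?thesis using *(2) rep_set_nonempty[OF *(1)] by simp
qed

section \<open>Locally constant measures as combinations of Haar measures\<close>

definition lin_LC :: "nat \<Rightarrow> 'f functional \<Rightarrow> bool" where
  "lin_LC n \<mu> \<longleftrightarrow> (\<forall>f\<in>LC vF n. \<forall>g\<in>LC vF n. \<mu> (\<lambda>z. f z + g z) = \<mu> f + \<mu> g) \<and>
     (\<forall>c. \<forall>f\<in>LC vF n. \<mu> (\<lambda>z. c * f z) = c * \<mu> f)"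

lemma measures_Z_lin: "\<mu> \<in> measures_Z vF n \<Longrightarrow> lin_LC n \<mu>"
  by (simp add: measures_Z_def lin_LC_def)

lemma lin_LC_add: "lin_LC n \<mu> \<Longrightarrow> f \<in> LC vF n \<Longrightarrow> g \<in> LC vF n \<Longrightarrow> \<mu> (\<lambda>z. f z + g z) = \<mu> f + \<mu> g"
  by (simp add: lin_LC_def)

lemma lin_LC_cmult: "lin_LC n \<mu> \<Longrightarrow> f \<in> LC vF n \<Longrightarrow> \<mu> (\<lambda>z. c * f z) = c * \<mu> f"
  by (simp add: lin_LC_def)

lemma lin_LC_zero_fun: "lin_LC n \<mu> \<Longrightarrow> \<mu> (\<lambda>z. 0) = 0"
  using lin_LC_cmult[of n \<mu> "\<lambda>z. 0" 0] by simp

lemma lin_LC_sum: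
  assumes "lin_LC n \<mu>" "\<And>i. i \<in> I \<Longrightarrow> f i \<in> LC vF n"
  shows "\<mu> (\<lambda>z. \<Sum>i\<in>I. f i z) = (\<Sum>i\<in>I. \<mu> (f i))"
  using assms(2)
proof (induction I rule: infinite_finite_induct)
  case (insert i I)
  then show ?case
    using lin_LC_add[OF assms(1), of "f i" "\<lambda>z. \<Sum>i\<in>I. f i z"] LC_sum[of I f n] by simp
qed (simp_all add: lin_LC_zero_fun[OF assms(1)])

lemma lin_LC_translate:
  assumes "lin_LC n \<mu>" "x \<in> O_units"
  shows "lin_LC n (\<lambda>h. \<mu> (\<lambda>z. h (x * z)))"
  unfolding lin_LC_def
  using lin_LC_add[OF assms(1) LC_translate[OF _ assms(2)] LC_translate[OF _ assms(2)]]
    lin_LC_cmult[OF assms(1) LC_translate[OF _ assms(2)]] by simp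

lemma measures_Z_support:
  assumes "\<mu> \<in> measures_Z vF n"
  obtains C where "compactin (Z_topology vF n) C" "C \<subseteq> O_units"
    "\<And>f g. f \<in> LC vF n \<Longrightarrow> g \<in> LC vF n \<Longrightarrow> (\<And>z. z \<in> C \<Longrightarrow> f z = g z) \<Longrightarrow> \<mu> f = \<mu> g"
proof -
  obtain C where C: "compactin (Z_topology vF n) C" "\<forall>f\<in>LC vF n. (\<forall>z\<in>C. f z = 0) \<longrightarrow> \<mu> f = 0"
    using assms unfolding measures_Z_def by blast
  show ?thesis
  proof (rule that[OF C(1)])
    show "C \<subseteq> O_units" using compactin_subset_topspace[OF C(1)] by simp
    fix f g assume fg: "f \<in> LC vF n" "g \<in> LC vF n" "\<And>z. z \<in> C \<Longrightarrow> f z = g z"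
    have g': "(\<lambda>z. (-1) * g z) \<in> LC vF n" by (rule LC_cmult[OF fg(2)])
    have "\<mu> (\<lambda>z. f z + (-1) * g z) = \<mu> f + (-1) * \<mu> g"
      using lin_LC_add[OF measures_Z_lin[OF assms] fg(1) g']
        lin_LC_cmult[OF measures_Z_lin[OF assms] fg(2), of "-1"] by simp
    moreover have "\<mu> (\<lambda>z. f z + (-1) * g z) = 0"
      using C(2) LC_add[OF fg(1) g'] fg(3) by simp
    ultimately show "\<mu> f = \<mu> g" by simp
  qed
qed

definition cong1_invariant :: "nat \<Rightarrow> nat \<Rightarrow> 'f functional \<Rightarrow> bool" where
  "cong1_invariant n r \<mu> \<longleftrightarrow> (\<forall>u\<in>cong1 n r. \<forall>f\<in>LC vF n. \<mu> (\<lambda>z. f (u * z)) = \<mu> f)"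

lemma measures_Z_cong1_invariant:
  assumes "\<mu> \<in> measures_Z vF n"
  shows "\<exists>r0\<ge>1. \<forall>r\<ge>r0. cong1_invariant n r \<mu>"
proof -
  obtain U where U: "openin (Z_topology vF n) U" "1 \<in> U" "\<forall>u\<in>U. \<forall>f\<in>LC vF n. \<mu> (\<lambda>z. f (u * z)) = \<mu> f"
    using assms unfolding measures_Z_def by blast
  obtain N where N: "\<And>z. z \<in> O_units \<Longrightarrow> z - 1 \<in> disc n N \<Longrightarrow> z \<in> U"
    using U(1,2) unfolding openin_Z_topology_iff by blast
  have "cong1 n r \<subseteq> U" if r: "r \<ge> max 1 (nat N)" for r
  proof
    fix z assume z: "z \<in> cong1 n r"
    have "N \<le> int r" using r by linarith
    then have "z - 1 \<in> disc n N" using z disc_mono[of "z - 1" n "int r" n N] by (simp add: cong1_def)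
    moreover have "z \<in> O_units" using z cong1_subset_O_units[of r] r by auto
    ultimately show "z \<in> U" using N by blast
  qed
  then have "\<forall>r\<ge>max 1 (nat N). cong1_invariant n r \<mu>" using U(3) unfolding cong1_invariant_def by blast
  then show ?thesis by (intro exI[of _ "max 1 (nat N)"]) auto
qed

text \<open>Uniqueness of Haar measure: \<open>f\<close> is constant on the cosets of a smaller subgroup \<open>cong1 n r'\<close> in
  \<open>cong1 n r\<close>, and an invariant \<open>\<mu>\<close> gives all of these cosets the same mass.\<close>

lemma measure_on_coset:
  assumes \<mu>: "lin_LC n \<mu>" and r: "r \<ge> 1" and inv: "cong1_invariant n r \<mu>" and f: "f \<in> LC vF n"
  shows "\<mu> (\<lambda>z. indicator (cong1 n r) z * f z) = \<mu> (indicator (cong1 n r)) * haar r f"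
proof -
  let ?I = "indicator (cong1 n r) :: 'f fls \<Rightarrow> complex"
  have I: "?I \<in> LC vF n" by (rule LC_cong1_indicator[OF r])
  obtain N X where *: "rep_set n N X" "N \<ge> 0"
    "\<And>h. h \<in> {f, ?I} \<Longrightarrow> periodic n N (\<lambda>x. h (1 + scal r x))"
    "\<And>h. h \<in> {f, ?I} \<Longrightarrow> haar r h = (\<Sum>d\<in>X. h (1 + scal r d)) / card X"
    using haar_common[OF r, of "{f, ?I}" n] f I by auto
  have XO: "X \<subseteq> disc n 0" and fin: "finite X" using *(1) by (auto simp: rep_set_def)
  let ?r' = "r + nat N"
  have r': "?r' \<ge> 1" "int ?r' = int r + N" using r *(2) by auto
  let ?J = "indicator (cong1 n ?r') :: 'f fls \<Rightarrow> complex"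
  have J: "?J \<in> LC vF n" by (rule LC_cong1_indicator[OF r'(1)])
  define p where "p d = 1 + scal r d" for d
  have p: "p d \<in> cong1 n r" if "d \<in> X" for d using that XO by (auto simp: p_def cong1_scal)
  have ip: "inverse (p d) \<in> cong1 n r" if "d \<in> X" for d using cong1_inverse[OF r p[OF that]] .
  have ipO: "inverse (p d) \<in> O_units" if "d \<in> X" for d using ip[OF that] cong1_subset_O_units[OF r] by blast
  have pn: "p d \<noteq> 0" if "d \<in> X" for d using p[OF that] cong1_subset_O_units[OF r] O_units_nonzero by blast
  have coset: "inverse (p d) * (1 + scal r x) \<in> cong1 n ?r' \<longleftrightarrow> x - d \<in> disc n N"
    if d: "d \<in> X" and x: "x \<in> disc n 0" for d x
  proof -
    have e: "1 + scal r x - p d = scal r (x - d)" by (simp add: p_def scal_def algebra_simps)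
    have "inverse (p d) * (1 + scal r x) - 1 = inverse (p d) * (1 + scal r x - p d)"
      using pn[OF d] by (simp add: algebra_simps)
    then have e1: "inverse (p d) * (1 + scal r x) - 1 = inverse (p d) * scal r (x - d)" unfolding e .
    then have e2: "scal r (x - d) = p d * (inverse (p d) * (1 + scal r x) - 1)"
      using pn[OF d] by (simp add: mult.assoc[symmetric])
    show ?thesis
    proof
      assume "inverse (p d) * (1 + scal r x) \<in> cong1 n ?r'"
      then have "p d * (inverse (p d) * (1 + scal r x) - 1) \<in> disc n (0 + (int r + N))"
        using cong1_disc[OF p[OF d]] r'(2) by (intro disc_mult) (auto simp: cong1_def)
      then have "scal r (x - d) \<in> disc n (int r + N)" unfolding e2 by simp
      then show "x - d \<in> disc n N" unfolding scal_disc .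
    next
      assume "x - d \<in> disc n N"
      then have "inverse (p d) * scal r (x - d) \<in> disc n (0 + (int r + N))"
        using cong1_disc[OF ip[OF d]] by (intro disc_mult) (auto simp: scal_disc)
      then show "inverse (p d) * (1 + scal r x) \<in> cong1 n ?r'" using e1 r'(2) by (simp add: cong1_def)
    qed
  qed
  have inside: "z \<in> cong1 n r" if d: "d \<in> X" and z: "inverse (p d) * z \<in> cong1 n ?r'" for d z
  proof -
    have "p d * (inverse (p d) * z) \<in> cong1 n r"
      by (rule cong1_mult[OF p[OF d]], rule cong1_mono[OF z]) simp_all
    then show ?thesis using pn[OF d] by (simp flip: mult.assoc)
  qed
  \<comment> \<open>Applied to \<open>f\<close> this computes the left-hand side, applied to the indicator it computes the mass of \<open>cong1 n r\<close>.\<close>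
  have decomp: "?I z * h z = (\<Sum>d\<in>X. h (p d) * ?J (inverse (p d) * z))"
    if h: "h \<in> {f, ?I}" for h z
  proof (cases "z \<in> cong1 n r")
    case False
    then have "?J (inverse (p d) * z) = 0" if "d \<in> X" for d
      using inside[OF that] by (auto simp: indicator_def)
    then show ?thesis using False by simp
  next
    case True
    then obtain x where x: "x \<in> disc n 0" "z = 1 + scal r x" by (rule cong1_scalE)
    obtain d0 where d0: "d0 \<in> X" "x - d0 \<in> disc n N" "\<And>d. d \<in> X \<Longrightarrow> x - d \<in> disc n N \<Longrightarrow> d = d0"
      using *(1) x(1) unfolding rep_set_def by metis
    have "(\<Sum>d\<in>X. h (p d) * ?J (inverse (p d) * z)) = (\<Sum>d\<in>X. if d = d0 then h (p d0) else 0)"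
    proof (rule sum.cong)
      fix d assume d: "d \<in> X"
      have "inverse (p d) * z \<in> cong1 n ?r' \<longleftrightarrow> d = d0"
        unfolding x(2) coset[OF d x(1)] using d0 d by blast
      then show "h (p d) * ?J (inverse (p d) * z) = (if d = d0 then h (p d0) else 0)"
        by (auto simp: indicator_def)
    qed simp
    also have "\<dots> = h (p d0)" using d0(1) fin by simp
    also have "\<dots> = h z"
      using *(3)[OF h] d0 x XO unfolding periodic_def p_def by (metis subsetD)
    finally show ?thesis using True by simp
  qed
  have val: "\<mu> (\<lambda>z. ?I z * h z) = (\<Sum>d\<in>X. h (p d)) * \<mu> ?J" if h: "h \<in> {f, ?I}" for h
  proof -
    have "\<mu> (\<lambda>z. ?I z * h z) = \<mu> (\<lambda>z. \<Sum>d\<in>X. h (p d) * ?J (inverse (p d) * z))"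
      using decomp[OF h] by simp
    also have "\<dots> = (\<Sum>d\<in>X. \<mu> (\<lambda>z. h (p d) * ?J (inverse (p d) * z)))"
      by (rule lin_LC_sum[OF \<mu>]) (intro LC_cmult LC_translate J ipO)
    also have "\<dots> = (\<Sum>d\<in>X. h (p d) * \<mu> ?J)"
    proof (rule sum.cong)
      fix d assume d: "d \<in> X"
      have "\<mu> (\<lambda>z. h (p d) * ?J (inverse (p d) * z)) = h (p d) * \<mu> (\<lambda>z. ?J (inverse (p d) * z))"
        by (rule lin_LC_cmult[OF \<mu> LC_translate[OF J ipO[OF d]]])
      also have "\<mu> (\<lambda>z. ?J (inverse (p d) * z)) = \<mu> ?J"
        using inv ip[OF d] J unfolding cong1_invariant_def by blast
      finally show "\<mu> (\<lambda>z. h (p d) * ?J (inverse (p d) * z)) = h (p d) * \<mu> ?J" .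
    qed simp
    finally show ?thesis by (simp add: sum_distrib_right)
  qed
  have "(\<lambda>z. ?I z * ?I z) = ?I" by (auto simp: indicator_def)
  moreover have "(\<Sum>d\<in>X. ?I (p d)) = of_nat (card X)" using p by simp
  ultimately have "\<mu> ?I = of_nat (card X) * \<mu> ?J" using val[of ?I] by simp
  moreover have "haar r f = (\<Sum>d\<in>X. f (p d)) / card X" using *(4) by (simp add: p_def)
  ultimately show ?thesis
    using val[of f] rep_set_nonempty[OF *(1)] by simp
qed

lemma measure_decomposition:
  assumes \<mu>: "\<mu> \<in> measures_Z vF n" and r: "r \<ge> 1" and inv: "cong1_invariant n r \<mu>"
  shows "\<exists>X\<subseteq>O_units. finite X \<and> (\<forall>f\<in>LC vF n.
     \<mu> f = (\<Sum>x\<in>X. \<mu> (\<lambda>z. indicator (cong1 n r) (inverse x * z)) * haar r (\<lambda>z. f (x * z))))"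
proof -
  let ?I = "indicator (cong1 n r) :: 'f fls \<Rightarrow> complex"
  have I: "?I \<in> LC vF n" by (rule LC_cong1_indicator[OF r])
  obtain C where C: "compactin (Z_topology vF n) C" "C \<subseteq> O_units"
    "\<And>f g. f \<in> LC vF n \<Longrightarrow> g \<in> LC vF n \<Longrightarrow> (\<And>z. z \<in> C \<Longrightarrow> f z = g z) \<Longrightarrow> \<mu> f = \<mu> g"
    using measures_Z_support[OF \<mu>] by metis
  obtain X where X: "X \<subseteq> O_units" "finite X" "\<forall>z\<in>C. \<exists>!x. x \<in> X \<and> inverse x * z \<in> cong1 n r"
    using compact_coset_cover[OF C(1) r] by (elim exE conjE)
  have "\<mu> f = (\<Sum>x\<in>X. \<mu> (\<lambda>z. ?I (inverse x * z)) * haar r (\<lambda>z. f (x * z)))" if f: "f \<in> LC vF n" for f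
  proof -
    have LC: "(\<lambda>z. ?I (inverse x * z) * f z) \<in> LC vF n" if "x \<in> X" for x
      using that X(1) by (intro LC_mult f LC_translate I O_units_inverse) auto
    have "\<mu> f = \<mu> (\<lambda>z. \<Sum>x\<in>X. ?I (inverse x * z) * f z)"
    proof (rule C(3)[OF f])
      show "(\<lambda>z. \<Sum>x\<in>X. ?I (inverse x * z) * f z) \<in> LC vF n" by (intro LC_sum LC)
      fix z assume "z \<in> C"
      then have "\<exists>!x. x \<in> X \<and> inverse x * z \<in> cong1 n r" by (rule bspec[OF X(3)])
      then obtain x0 where x0: "x0 \<in> X \<and> inverse x0 * z \<in> cong1 n r"
          and uniq: "\<forall>x. x \<in> X \<and> inverse x * z \<in> cong1 n r \<longrightarrow> x = x0"
        by (rule ex1E)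
      have "(\<Sum>x\<in>X. ?I (inverse x * z) * f z) = (\<Sum>x\<in>X. if x = x0 then f z else 0)"
      proof (rule sum.cong)
        fix x assume "x \<in> X"
        then have "inverse x * z \<in> cong1 n r \<longleftrightarrow> x = x0" using x0 uniq by metis
        then show "?I (inverse x * z) * f z = (if x = x0 then f z else 0)"
          unfolding indicator_def by (cases "x = x0") simp_all
      qed simp
      then show "f z = (\<Sum>x\<in>X. ?I (inverse x * z) * f z)" using x0 X(2) by simp
    qed
    also have "\<dots> = (\<Sum>x\<in>X. \<mu> (\<lambda>z. ?I (inverse x * z) * f z))"
      by (rule lin_LC_sum[OF measures_Z_lin[OF \<mu>] LC])
    also have "\<dots> = (\<Sum>x\<in>X. \<mu> (\<lambda>z. ?I (inverse x * z)) * haar r (\<lambda>z. f (x * z)))"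
    proof (rule sum.cong)
      fix x assume "x \<in> X"
      then have x: "x \<in> O_units" "x \<noteq> 0" using X(1) O_units_nonzero by auto
      have ix: "inverse x \<in> O_units" by (rule O_units_inverse[OF x(1)])
      define \<nu> where "\<nu> h = \<mu> (\<lambda>z. h (inverse x * z))" for h
      have "cong1_invariant n r \<nu>"
        unfolding cong1_invariant_def
      proof (intro ballI)
        fix u h assume u: "u \<in> cong1 n r" and h: "h \<in> LC vF n"
        have "\<mu> (\<lambda>z. h (inverse x * (u * z))) = \<mu> (\<lambda>z. h (inverse x * z))"
          using inv LC_translate[OF h ix] u unfolding cong1_invariant_def by fast
        then show "\<nu> (\<lambda>z. h (u * z)) = \<nu> h"
          unfolding \<nu>_def by (simp add: mult.left_commute)
      qed
      then have "\<nu> (\<lambda>z. ?I z * f (x * z)) = \<nu> ?I * haar r (\<lambda>z. f (x * z))"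
        unfolding \<nu>_def
        by (intro measure_on_coset lin_LC_translate measures_Z_lin \<mu> ix r LC_translate f x(1))
      then show "\<mu> (\<lambda>z. ?I (inverse x * z) * f z) =
          \<mu> (\<lambda>z. ?I (inverse x * z)) * haar r (\<lambda>z. f (x * z))"
        using x(2) by (simp add: \<nu>_def flip: mult.assoc)
    qed simp
    finally show ?thesis .
  qed
  then show ?thesis using X by blast
qed

end

section \<open>Inverse limits of pro-objects\<close>

text \<open>The elements of the inverse limit.\<close>

definition threads :: "'v prospace \<Rightarrow> (nat \<Rightarrow> 'v) set" where
  "threads V = {x. (\<forall>l. x l \<in> sp V l) \<and> (\<forall>i j. i \<le> j \<longrightarrow> tr V j i (x j) = x i)}"

definition lim_map :: "('v, 'w) pro_rep \<Rightarrow> (nat \<Rightarrow> 'v) \<Rightarrow> nat \<Rightarrow> 'w" where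
  "lim_map F x = (\<lambda>k. snd (F k) (x (fst (F k))))"

lemma threads_sp: "x \<in> threads V \<Longrightarrow> x l \<in> sp V l"
  by (simp add: threads_def)

lemma threads_tr: "x \<in> threads V \<Longrightarrow> i \<le> j \<Longrightarrow> tr V j i (x j) = x i"
  by (simp add: threads_def)

lemma lim_map_threads:
  assumes \<Phi>: "pro_mor V W \<Phi>" and x: "x \<in> threads V"
  shows "lim_map \<Phi> x \<in> threads W"
  unfolding threads_def mem_Collect_eq
proof (intro conjI allI impI)
  fix k
  show "lim_map \<Phi> x k \<in> sp W k"
    using \<Phi> threads_sp[OF x] unfolding pro_mor_def lin_on_def lim_map_def by (meson image_subset_iff)
next
  fix i j :: nat assume "i \<le> j"
  then obtain L where L: "L \<ge> fst (\<Phi> i)" "L \<ge> fst (\<Phi> j)"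
    "\<forall>x\<in>sp V L. tr W j i (snd (\<Phi> j) (tr V L (fst (\<Phi> j)) x)) = snd (\<Phi> i) (tr V L (fst (\<Phi> i)) x)"
    using \<Phi> unfolding pro_mor_def by metis
  from bspec[OF L(3) threads_sp[OF x]] show "tr W j i (lim_map \<Phi> x j) = lim_map \<Phi> x i"
    using L(1,2) by (simp add: lim_map_def threads_tr[OF x])
qed

lemma lim_map_comp: "lim_map (pro_comp \<Psi> \<Phi>) x = lim_map \<Psi> (lim_map \<Phi> x)"
  by (simp add: lim_map_def pro_comp_def)

lemma lim_map_id: "lim_map pro_id x = x"
  by (simp add: lim_map_def pro_id_def)

text \<open>An inverse limit can forget part of a pro-object, but equal morphisms always induce equal maps, and a
  contradiction between induced maps is enough.\<close>

lemma lim_map_eq: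
  assumes e: "pro_eq V \<Phi> \<Psi>" and x: "x \<in> threads V"
  shows "lim_map \<Phi> x = lim_map \<Psi> x"
proof
  fix k
  obtain L where L: "L \<ge> fst (\<Phi> k)" "L \<ge> fst (\<Psi> k)"
    "\<forall>x\<in>sp V L. snd (\<Phi> k) (tr V L (fst (\<Phi> k)) x) = snd (\<Psi> k) (tr V L (fst (\<Psi> k)) x)"
    using e unfolding pro_eq_def by metis
  from bspec[OF L(3) threads_sp[OF x]] show "lim_map \<Phi> x k = lim_map \<Psi> x k"
    using L(1,2) by (simp add: lim_map_def threads_tr[OF x])
qed

lemma lim_map_add:
  assumes "pro_mor V W \<Phi>" "x \<in> threads V" "y \<in> threads V"
  shows "lim_map \<Phi> (\<lambda>l. x l + y l) = (\<lambda>l. lim_map \<Phi> x l + lim_map \<Phi> y l)"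
  using assms by (auto simp: lim_map_def pro_mor_def lin_on_def threads_def)

lemma lim_map_scale:
  assumes "pro_mor V W \<Phi>" "x \<in> threads V"
  shows "lim_map \<Phi> (\<lambda>l. sc V c (x l)) = (\<lambda>l. sc W c (lim_map \<Phi> x l))"
  using assms by (auto simp: lim_map_def pro_mor_def lin_on_def threads_def)

lemma XG_mono: "n \<le> n' \<Longrightarrow> g \<in> XG n \<Longrightarrow> g \<in> XG n'"
  unfolding XG_def by force

text \<open>Take for \<open>n\<close> the sum over all entries, which bounds each of the four conditions.\<close>

lemma XG_exists:
  assumes "g \<in> GL2K" shows "\<exists>n. g \<in> XG n"
proof -
  define h where "h i j = \<bar>2 * fls_subdegree (g $ i $ j) - fls_subdegree (det g)\<bar>" for i j
  define n where "n = nat (\<Sum>i\<in>UNIV. \<Sum>j\<in>UNIV. h i j)"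
  have "h i j \<le> (\<Sum>j\<in>UNIV. h i j)" for i j
    by (rule member_le_sum) (auto simp: h_def)
  moreover have "(\<Sum>j\<in>UNIV. h i j) \<le> (\<Sum>i\<in>UNIV. \<Sum>j\<in>UNIV. h i j)" for i
    by (rule member_le_sum) (auto simp: h_def intro: sum_nonneg)
  ultimately have "h i j \<le> int n" for i j
    unfolding n_def by (smt (verit) h_def int_nat_eq)
  then have "- int n \<le> 2 * fls_subdegree (g $ i $ j) - fls_subdegree (det g)" for i j
    unfolding h_def by (smt (verit))
  then show ?thesis using assms by (intro exI[of _ n]) (auto simp: XG_def)
qed

section \<open>The limit of a smooth representation\<close>

locale smooth_representation =
  fixes vF :: "'f::field \<Rightarrow> int" and V :: "'v::ab_group_add prospace" and \<alpha> :: "('f, 'v) coaction"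
  assumes smooth: "smooth_rep vF V \<alpha>"
begin

lemma mor: "coaction_mor vF V \<alpha>" and assoc: "coaction_assoc \<alpha> V" and unit: "coaction_unit \<alpha> V"
  and V: "pro_vect V"
  using smooth by (auto simp: smooth_rep_def)

definition act :: "'f mat2 \<Rightarrow> (nat \<Rightarrow> 'v) \<Rightarrow> nat \<Rightarrow> 'v" where
  "act g = lim_map (G_act \<alpha> g)"

lemma coaction_sp:
  assumes "g \<in> XG n" "x \<in> sp V (fst (\<alpha> n l))"
  shows "snd (\<alpha> n l) x g \<in> sp V l"
  using mor assms unfolding coaction_mor_def a_space_def by blast

lemma coaction_compat:
  assumes "n \<le> n'" "l \<le> l'" "g \<in> XG n" "x \<in> threads V"
  shows "tr V l' l (snd (\<alpha> n' l') (x (fst (\<alpha> n' l'))) g) = snd (\<alpha> n l) (x (fst (\<alpha> n l))) g"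
proof -
  obtain L where L: "L \<ge> fst (\<alpha> n l)" "L \<ge> fst (\<alpha> n' l')"
    "\<forall>x\<in>sp V L. \<forall>g\<in>XG n. tr V l' l (snd (\<alpha> n' l') (tr V L (fst (\<alpha> n' l')) x) g) =
       snd (\<alpha> n l) (tr V L (fst (\<alpha> n l)) x) g"
    using mor assms(1,2) unfolding coaction_mor_def by meson
  from bspec[OF bspec[OF L(3) threads_sp[OF assms(4)]] assms(3)] show ?thesis
    using L(1,2) by (simp add: threads_tr[OF assms(4)])
qed

text \<open>The definition of \<open>G_act\<close> chooses the least \<open>n\<close>; the compatibility of the components allows any other.\<close>

lemma act_eq:
  assumes g: "g \<in> XG n" and x: "x \<in> threads V"
  shows "act g x = (\<lambda>l. snd (\<alpha> n l) (x (fst (\<alpha> n l))) g)"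
proof
  fix l
  define n0 where "n0 = (LEAST n. g \<in> XG n)"
  have n0: "g \<in> XG n0" unfolding n0_def using g by (rule LeastI)
  have le: "n0 \<le> n" unfolding n0_def using g by (rule Least_le)
  have tr: "tr V l l y = y" if "y \<in> sp V l" for y using V that by (simp add: pro_vect_def)
  have "act g x l = snd (\<alpha> n0 l) (x (fst (\<alpha> n0 l))) g"
    by (simp add: act_def lim_map_def G_act_def Let_def n0_def)
  also have "\<dots> = tr V l l (snd (\<alpha> n l) (x (fst (\<alpha> n l))) g)"
    using coaction_compat[OF le order_refl n0 x] by simp
  also have "\<dots> = snd (\<alpha> n l) (x (fst (\<alpha> n l))) g"
    by (rule tr, rule coaction_sp[OF g threads_sp[OF x]])
  finally show "act g x l = snd (\<alpha> n l) (x (fst (\<alpha> n l))) g" .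
qed

lemma act_threads:
  assumes g: "g \<in> GL2K" and x: "x \<in> threads V"
  shows "act g x \<in> threads V"
proof -
  obtain n where n: "g \<in> XG n" using XG_exists[OF g] by blast
  show ?thesis
    unfolding act_eq[OF n x] threads_def
    using coaction_sp[OF n threads_sp[OF x]] coaction_compat[OF order_refl _ n x] by simp
qed

lemma act_add:
  assumes g: "g \<in> GL2K" and x: "x \<in> threads V" and y: "y \<in> threads V"
    and xy: "(\<lambda>l. x l + y l) \<in> threads V"
  shows "act g (\<lambda>l. x l + y l) = (\<lambda>l. act g x l + act g y l)"
proof -
  obtain n where n: "g \<in> XG n" using XG_exists[OF g] by blast
  have "lin_on (sc V) (sc V) (sp V (fst (\<alpha> n l))) (sp V l) (\<lambda>x. snd (\<alpha> n l) x g)" for l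
    using mor n unfolding coaction_mor_def by blast
  then show ?thesis
    unfolding act_eq[OF n x] act_eq[OF n y] act_eq[OF n xy]
    using threads_sp[OF x] threads_sp[OF y] by (simp add: lin_on_def)
qed

lemma act_scale:
  assumes g: "g \<in> GL2K" and x: "x \<in> threads V" and cx: "(\<lambda>l. sc V c (x l)) \<in> threads V"
  shows "act g (\<lambda>l. sc V c (x l)) = (\<lambda>l. sc V c (act g x l))"
proof -
  obtain n where n: "g \<in> XG n" using XG_exists[OF g] by blast
  have "lin_on (sc V) (sc V) (sp V (fst (\<alpha> n l))) (sp V l) (\<lambda>x. snd (\<alpha> n l) x g)" for l
    using mor n unfolding coaction_mor_def by blast
  then show ?thesis
    unfolding act_eq[OF n x] act_eq[OF n cx]
    using threads_sp[OF x] by (simp add: lin_on_def)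
qed

lemma act_mult:
  assumes g: "g \<in> GL2K" and h: "h \<in> GL2K" and x: "x \<in> threads V"
  shows "act (g ** h) x = act g (act h x)"
proof -
  obtain n1 n2 where n1: "g \<in> XG n1" and n2: "h \<in> XG n2" using XG_exists g h by blast
  have gh: "g ** h \<in> GL2K" using g h by (simp add: GL2K_def invertible_mult)
  then obtain n3 where n3: "g ** h \<in> XG n3" using XG_exists by blast
  \<comment> \<open>A common level for both factors; doubling it still leaves room for the product.\<close>
  define n where "n = max n1 (max n2 n3)"
  have n: "g \<in> XG n" "h \<in> XG n" "g ** h \<in> XG (n + n)"
    using n1 n2 n3 by (auto simp: n_def elim!: XG_mono[rotated])
  have hx: "act h x \<in> threads V" by (rule act_threads[OF h x])
  show ?thesis
  proof
    fix l
    define l1 where "l1 = fst (\<alpha> n l)"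
    define l2 where "l2 = fst (\<alpha> n l1)"
    define l3 where "l3 = fst (\<alpha> (n + n) l)"
    obtain L where L: "L \<ge> l2" "L \<ge> l3"
      "\<forall>x\<in>sp V L. \<forall>g\<in>XG n. \<forall>h\<in>XG n. snd (\<alpha> n l) (snd (\<alpha> n l1) (tr V L l2 x) h) g =
             snd (\<alpha> (n + n) l) (tr V L l3 x) (g ** h)"
      using assoc unfolding coaction_assoc_def Let_def l1_def l2_def l3_def by meson
    from bspec[OF bspec[OF bspec[OF L(3) threads_sp[OF x]] n(1)] n(2)]
    have "snd (\<alpha> n l) (snd (\<alpha> n l1) (x l2) h) g = act (g ** h) x l"
      unfolding act_eq[OF n(3) x] using L(1,2) by (simp add: threads_tr[OF x] l3_def)
    moreover have "snd (\<alpha> n l1) (x l2) h = act h x l1"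
      unfolding act_eq[OF n(2) x] l2_def ..
    moreover have "act g (act h x) l = snd (\<alpha> n l) (act h x l1) g"
      unfolding act_eq[OF n(1) hx] l1_def ..
    ultimately show "act (g ** h) x l = act g (act h x) l" by simp
  qed
qed

lemma act_one:
  assumes x: "x \<in> threads V" shows "act (mat 1) x = x"
proof -
  have "mat 1 \<in> (GL2K :: 'f mat2 set)" by (auto simp: GL2K_def invertible_def)
  then obtain n where n: "(mat 1 :: 'f mat2) \<in> XG n" using XG_exists by blast
  show ?thesis
  proof
    fix l
    obtain L where L: "L \<ge> fst (\<alpha> n l)" "L \<ge> l"
      "\<forall>x\<in>sp V L. snd (\<alpha> n l) (tr V L (fst (\<alpha> n l)) x) (mat 1) = tr V L l x"
      using unit unfolding coaction_unit_def by meson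
    from bspec[OF L(3) threads_sp[OF x]] show "act (mat 1) x l = x l"
      unfolding act_eq[OF n x] using L(1,2) by (simp add: threads_tr[OF x])
  qed
qed

lemma act_scalar:
  assumes g: "g \<in> GL2K" and c: "c \<noteq> 0" and x: "x \<in> threads V" and cg: "mat c ** g \<in> GL2K"
  shows "act (mat c ** g) x = act g x"
proof -
  obtain n1 n2 where "g \<in> XG n1" "mat c ** g \<in> XG n2" using XG_exists g cg by blast
  then have n: "g \<in> XG (max n1 n2)" "mat c ** g \<in> XG (max n1 n2)"
    by (auto elim!: XG_mono[rotated])
  have "snd (\<alpha> (max n1 n2) l) (x (fst (\<alpha> (max n1 n2) l))) \<in> a_space vF V (max n1 n2) l" for l
    using mor threads_sp[OF x] unfolding coaction_mor_def by blast
  then show ?thesis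
    unfolding act_eq[OF n(1) x] act_eq[OF n(2) x]
    using n(1) c unfolding a_space_def loc_const_X_def by (intro ext) blast
qed

end

locale Upsilon_extension = smooth_representation vF V \<alpha>
  for vF :: "'f::field \<Rightarrow> int" and V :: "'v::ab_group_add prospace" and \<alpha> :: "('f, 'v) coaction" +
  fixes \<theta> :: "'f \<Rightarrow> complex" and \<Phi> :: "('v, int \<Rightarrow> 'f functional) pro_rep"
    and \<Psi> :: "(int \<Rightarrow> 'f functional, 'v) pro_rep"
  assumes \<Phi>: "pro_mor V (Upsilon vF) \<Phi>" and \<Psi>: "pro_mor (Upsilon vF) V \<Psi>"
    and \<Psi>\<Phi>: "pro_eq V (pro_comp \<Psi> \<Phi>) pro_id" and \<Phi>\<Psi>: "pro_eq (Upsilon vF) (pro_comp \<Phi> \<Psi>) pro_id"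
    and equiv: "\<And>a b. a \<noteq> 0 \<Longrightarrow> pro_eq V (pro_comp \<Phi> (G_act \<alpha> (P_mat (a, b))))
                   (pro_comp (Upsilon_act vF \<theta> (a, b)) \<Phi>)"
begin

abbreviation "U \<equiv> threads (Upsilon vF)"

definition act_U :: "'f mat2 \<Rightarrow> (nat \<Rightarrow> int \<Rightarrow> 'f functional) \<Rightarrow> nat \<Rightarrow> int \<Rightarrow> 'f functional" where
  "act_U g x = lim_map \<Phi> (act g (lim_map \<Psi> x))"

lemma \<Psi>\<Phi>_id: "x \<in> threads V \<Longrightarrow> lim_map \<Psi> (lim_map \<Phi> x) = x"
  using lim_map_eq[OF \<Psi>\<Phi>] by (simp add: lim_map_comp lim_map_id)

lemma \<Phi>\<Psi>_id: "x \<in> U \<Longrightarrow> lim_map \<Phi> (lim_map \<Psi> x) = x"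
  using lim_map_eq[OF \<Phi>\<Psi>] by (simp add: lim_map_comp lim_map_id)

lemmas \<Phi>_in = lim_map_threads[OF \<Phi>] and \<Psi>_in = lim_map_threads[OF \<Psi>]

lemma act_U_in: "g \<in> GL2K \<Longrightarrow> x \<in> U \<Longrightarrow> act_U g x \<in> U"
  unfolding act_U_def by (intro \<Phi>_in act_threads \<Psi>_in)

lemma act_U_add:
  assumes g: "g \<in> GL2K" and x: "x \<in> U" and y: "y \<in> U" and xy: "(\<lambda>l. x l + y l) \<in> U"
  shows "act_U g (\<lambda>l. x l + y l) = (\<lambda>l. act_U g x l + act_U g y l)"
proof -
  have e: "lim_map \<Psi> (\<lambda>l. x l + y l) = (\<lambda>l. lim_map \<Psi> x l + lim_map \<Psi> y l)"
    by (rule lim_map_add[OF \<Psi> x y])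
  have "act g (lim_map \<Psi> (\<lambda>l. x l + y l)) = (\<lambda>l. act g (lim_map \<Psi> x) l + act g (lim_map \<Psi> y) l)"
    using \<Psi>_in[OF xy] unfolding e by (intro act_add g \<Psi>_in x y)
  then show ?thesis
    unfolding act_U_def by (simp only: lim_map_add[OF \<Phi>] act_threads[OF g] \<Psi>_in x y)
qed

lemma act_U_scale:
  assumes g: "g \<in> GL2K" and x: "x \<in> U" and cx: "(\<lambda>l. sc (Upsilon vF) c (x l)) \<in> U"
  shows "act_U g (\<lambda>l. sc (Upsilon vF) c (x l)) = (\<lambda>l. sc (Upsilon vF) c (act_U g x l))"
proof -
  have e: "lim_map \<Psi> (\<lambda>l. sc (Upsilon vF) c (x l)) = (\<lambda>l. sc V c (lim_map \<Psi> x l))"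
    by (rule lim_map_scale[OF \<Psi> x])
  have "act g (lim_map \<Psi> (\<lambda>l. sc (Upsilon vF) c (x l))) = (\<lambda>l. sc V c (act g (lim_map \<Psi> x) l))"
    using \<Psi>_in[OF cx] unfolding e by (intro act_scale g \<Psi>_in x)
  then show ?thesis
    unfolding act_U_def by (simp only: lim_map_scale[OF \<Phi>] act_threads[OF g] \<Psi>_in x)
qed

lemma act_U_mult:
  assumes "g \<in> GL2K" "h \<in> GL2K" "x \<in> U"
  shows "act_U (g ** h) x = act_U g (act_U h x)"
  unfolding act_U_def using assms by (simp add: \<Psi>\<Phi>_id act_mult act_threads \<Psi>_in)

lemma act_U_one: "x \<in> U \<Longrightarrow> act_U (mat 1) x = x"
  unfolding act_U_def by (simp add: act_one \<Psi>_in \<Phi>\<Psi>_id)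

lemma act_U_scalar:
  "g \<in> GL2K \<Longrightarrow> c \<noteq> 0 \<Longrightarrow> mat c ** g \<in> GL2K \<Longrightarrow> x \<in> U \<Longrightarrow> act_U (mat c ** g) x = act_U g x"
  unfolding act_U_def by (simp add: act_scalar \<Psi>_in)

lemma act_U_P:
  assumes "a \<noteq> 0" "x \<in> U"
  shows "act_U (P_mat (a, b)) x = lim_map (Upsilon_act vF \<theta> (a, b)) x"
proof -
  have "lim_map \<Phi> (act (P_mat (a, b)) y) = lim_map (Upsilon_act vF \<theta> (a, b)) (lim_map \<Phi> y)"
    if "y \<in> threads V" for y
    using lim_map_eq[OF equiv[OF assms(1)] that] by (simp add: lim_map_comp act_def)
  from this[OF \<Psi>_in[OF assms(2)]] show ?thesis
    by (simp add: act_U_def \<Phi>\<Psi>_id assms(2))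
qed

text \<open>Only this remains of the pro-structure in the limit: level \<open>N\<close> of the output depends on one level of the input.\<close>

lemma act_U_continuous: "\<exists>L. \<forall>x y. x L = y L \<longrightarrow> act_U g x N = act_U g y N"
  unfolding act_U_def act_def lim_map_def by metis

end

section \<open>The limit of \<open>\<Upsilon>\<close> as families of functionals\<close>

context nonarch_local_field
begin

lemma measures_Z_closed_zero: "(\<lambda>f. 0) \<in> measures_Z vF n"
proof -
  have "compactin (Z_topology vF n) {}" "openin (Z_topology vF n) O_units"
    using openin_topspace[of "Z_topology vF n"] by simp_all
  then show ?thesis unfolding measures_Z_def using one_O_units by auto
qed

lemma measures_Z_closed_add:
  assumes "\<mu> \<in> measures_Z vF n" "\<nu> \<in> measures_Z vF n"
  shows "(\<lambda>f. \<mu> f + \<nu> f) \<in> measures_Z vF n"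
proof -
  obtain C D where C: "compactin (Z_topology vF n) C" "\<forall>f\<in>LC vF n. (\<forall>z\<in>C. f z = 0) \<longrightarrow> \<mu> f = 0"
    and D: "compactin (Z_topology vF n) D" "\<forall>f\<in>LC vF n. (\<forall>z\<in>D. f z = 0) \<longrightarrow> \<nu> f = 0"
    using assms unfolding measures_Z_def by blast
  obtain S T where S: "openin (Z_topology vF n) S" "1 \<in> S" "\<forall>u\<in>S. \<forall>f\<in>LC vF n. \<mu> (\<lambda>z. f (u * z)) = \<mu> f"
    and T: "openin (Z_topology vF n) T" "1 \<in> T" "\<forall>u\<in>T. \<forall>f\<in>LC vF n. \<nu> (\<lambda>z. f (u * z)) = \<nu> f"
    using assms unfolding measures_Z_def by blast
  show ?thesis
    unfolding measures_Z_def mem_Collect_eq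
  proof (intro conjI)
    show "\<forall>f. f \<notin> LC vF n \<longrightarrow> \<mu> f + \<nu> f = 0"
      "\<forall>f\<in>LC vF n. \<forall>g\<in>LC vF n. \<mu> (\<lambda>z. f z + g z) + \<nu> (\<lambda>z. f z + g z) = \<mu> f + \<nu> f + (\<mu> g + \<nu> g)"
      "\<forall>c. \<forall>f\<in>LC vF n. \<mu> (\<lambda>z. c * f z) + \<nu> (\<lambda>z. c * f z) = c * (\<mu> f + \<nu> f)"
      using assms by (simp_all add: measures_Z_def distrib_left)
    show "\<exists>C. compactin (Z_topology vF n) C \<and>
        (\<forall>f\<in>LC vF n. (\<forall>z\<in>C. f z = 0) \<longrightarrow> \<mu> f + \<nu> f = 0)"
      using C(2) D(2) by (intro exI[of _ "C \<union> D"] conjI compactin_Un C(1) D(1)) simp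
    show "\<exists>U. openin (Z_topology vF n) U \<and> 1 \<in> U \<and>
        (\<forall>u\<in>U. \<forall>f\<in>LC vF n. \<mu> (\<lambda>z. f (u * z)) + \<nu> (\<lambda>z. f (u * z)) = \<mu> f + \<nu> f)"
      using S T by (intro exI[of _ "S \<inter> T"]) auto
  qed
qed

lemma measures_Z_closed_scale:
  assumes "\<mu> \<in> measures_Z vF n"
  shows "(\<lambda>f. c * \<mu> f) \<in> measures_Z vF n"
proof -
  obtain C where C: "compactin (Z_topology vF n) C" "\<forall>f\<in>LC vF n. (\<forall>z\<in>C. f z = 0) \<longrightarrow> \<mu> f = 0"
    using assms unfolding measures_Z_def by blast
  obtain S where S: "openin (Z_topology vF n) S" "1 \<in> S" "\<forall>u\<in>S. \<forall>f\<in>LC vF n. \<mu> (\<lambda>z. f (u * z)) = \<mu> f"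
    using assms unfolding measures_Z_def by blast
  show ?thesis
    unfolding measures_Z_def mem_Collect_eq
  proof (intro conjI)
    show "\<forall>f. f \<notin> LC vF n \<longrightarrow> c * \<mu> f = 0"
      "\<forall>f\<in>LC vF n. \<forall>g\<in>LC vF n. c * \<mu> (\<lambda>z. f z + g z) = c * \<mu> f + c * \<mu> g"
      "\<forall>c'. \<forall>f\<in>LC vF n. c * \<mu> (\<lambda>z. c' * f z) = c' * (c * \<mu> f)"
      using assms by (simp_all add: measures_Z_def distrib_left)
    show "\<exists>C. compactin (Z_topology vF n) C \<and> (\<forall>f\<in>LC vF n. (\<forall>z\<in>C. f z = 0) \<longrightarrow> c * \<mu> f = 0)"
      using C by (intro exI[of _ C]) simp
    show "\<exists>U. openin (Z_topology vF n) U \<and> 1 \<in> U \<and>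
        (\<forall>u\<in>U. \<forall>f\<in>LC vF n. c * \<mu> (\<lambda>z. f (u * z)) = c * \<mu> f)"
      using S by (intro exI[of _ S]) simp
  qed
qed

text \<open>A compatible system of measures is one functional on the union of the spaces \<open>LC vF n\<close>. In the \<open>m\<close>-th
  factor of \<open>\<Upsilon>\<close> only the levels \<open>n \<ge> \<bar>m\<bar>\<close> occur.\<close>

definition lim_meas :: "int \<Rightarrow> 'f functional set" where
  "lim_meas m = {\<nu>. (\<forall>f. f \<notin> LCinf \<longrightarrow> \<nu> f = 0) \<and>
     (\<forall>n. \<bar>m\<bar> \<le> int n \<longrightarrow> restrict_meas vF n \<nu> \<in> measures_Z vF n)}"

definition lim_Upsilon :: "(int \<Rightarrow> 'f functional) set" where
  "lim_Upsilon = {y. \<forall>m. y m \<in> lim_meas m}"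

lemma lim_Upsilon_component: "y \<in> lim_Upsilon \<Longrightarrow> y m \<in> lim_meas m"
  by (simp add: lim_Upsilon_def)

lemma lim_meas_zero: "(\<lambda>f. 0) \<in> lim_meas m"
  using measures_Z_closed_zero by (simp add: lim_meas_def restrict_meas_def)

lemma lim_meas_add: "\<mu> \<in> lim_meas m \<Longrightarrow> \<nu> \<in> lim_meas m \<Longrightarrow> (\<lambda>f. \<mu> f + \<nu> f) \<in> lim_meas m"
proof -
  assume *: "\<mu> \<in> lim_meas m" "\<nu> \<in> lim_meas m"
  have "restrict_meas vF n (\<lambda>f. \<mu> f + \<nu> f) = (\<lambda>f. restrict_meas vF n \<mu> f + restrict_meas vF n \<nu> f)" for n
    by (auto simp: restrict_meas_def)
  then show ?thesis using * by (simp add: lim_meas_def measures_Z_closed_add)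
qed

lemma lim_meas_scale: "\<mu> \<in> lim_meas m \<Longrightarrow> (\<lambda>f. c * \<mu> f) \<in> lim_meas m"
proof -
  assume *: "\<mu> \<in> lim_meas m"
  have "restrict_meas vF n (\<lambda>f. c * \<mu> f) = (\<lambda>f. c * restrict_meas vF n \<mu> f)" for n
    by (auto simp: restrict_meas_def)
  then show ?thesis using * by (simp add: lim_meas_def measures_Z_closed_scale)
qed

lemma lim_meas_haar: "r \<ge> 1 \<Longrightarrow> haar r \<in> lim_meas m"
  by (simp add: lim_meas_def haar_outside_LC haar_measures_Z)

lemma lim_meas_lin: "\<nu> \<in> lim_meas m \<Longrightarrow> \<bar>m\<bar> \<le> int n \<Longrightarrow> lin_LC n \<nu>"
proof -
  assume "\<nu> \<in> lim_meas m" "\<bar>m\<bar> \<le> int n"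
  then have "lin_LC n (restrict_meas vF n \<nu>)" by (intro measures_Z_lin) (simp add: lim_meas_def)
  then show ?thesis
    unfolding lin_LC_def restrict_meas_def by (simp add: LC_add LC_cmult)
qed

definition to_threads :: "(int \<Rightarrow> 'f functional) \<Rightarrow> nat \<Rightarrow> int \<Rightarrow> 'f functional" where
  "to_threads y = (\<lambda>N m. if \<bar>m\<bar> \<le> int N then restrict_meas vF N (y m) else 0)"

text \<open>A locally constant function is evaluated at the least level at which both the function and the
  component \<open>m\<close> are present; by compatibility every higher level gives the same value.\<close>

definition from_threads :: "(nat \<Rightarrow> int \<Rightarrow> 'f functional) \<Rightarrow> int \<Rightarrow> 'f functional" where
  "from_threads x = (\<lambda>m f. if f \<in> LCinf then x (LEAST N. \<bar>m\<bar> \<le> int N \<and> f \<in> LC vF N) m f else 0)"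

lemma level_exists:
  assumes "f \<in> LCinf"
  shows "\<bar>m\<bar> \<le> int (LEAST N. \<bar>m\<bar> \<le> int N \<and> f \<in> LC vF N) \<and> f \<in> LC vF (LEAST N. \<bar>m\<bar> \<le> int N \<and> f \<in> LC vF N)"
proof -
  obtain n where n: "f \<in> LC vF n" using assms by (auto simp: LCinf_def)
  have "\<bar>m\<bar> \<le> int (max n (nat \<bar>m\<bar>)) \<and> f \<in> LC vF (max n (nat \<bar>m\<bar>))"
    using LC_mono[OF n, of "max n (nat \<bar>m\<bar>)"] by auto
  then show ?thesis by (rule LeastI)
qed

lemma to_threads_in:
  assumes y: "y \<in> lim_Upsilon" shows "to_threads y \<in> threads (Upsilon vF)"
  unfolding threads_def mem_Collect_eq
proof (intro conjI allI impI)
  fix N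
  have "restrict_meas vF N (y m) \<in> measures_Z vF N" if "\<bar>m\<bar> \<le> int N" for m
    using lim_Upsilon_component[OF y, of m] that by (simp add: lim_meas_def)
  then show "to_threads y N \<in> sp (Upsilon vF) N"
    by (simp add: Upsilon_def M_pro_def to_threads_def)
next
  fix i j :: nat assume ij: "i \<le> j"
  show "tr (Upsilon vF) j i (to_threads y j) = to_threads y i"
  proof (intro ext)
    fix m f
    show "tr (Upsilon vF) j i (to_threads y j) m f = to_threads y i m f"
      using ij by (auto simp: Upsilon_def M_pro_def to_threads_def restrict_meas_def LC_mono)
  qed
qed

lemma from_threads_eq:
  assumes x: "x \<in> threads (Upsilon vF)" and m: "\<bar>m\<bar> \<le> int N" and f: "f \<in> LC vF N"
  shows "from_threads x m f = x N m f"
proof -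
  define n where "n = (LEAST N. \<bar>m\<bar> \<le> int N \<and> f \<in> LC vF N)"
  have fi: "f \<in> LCinf" using f by (rule LC_LCinf)
  have n: "\<bar>m\<bar> \<le> int n" "f \<in> LC vF n" using level_exists[OF fi, of m] by (auto simp: n_def)
  have "n \<le> N" unfolding n_def by (rule Least_le) (use m f in simp)
  then have "x n = tr (Upsilon vF) N n (x N)" using threads_tr[OF x] by simp
  then have "x n m f = x N m f" using n by (simp add: Upsilon_def M_pro_def restrict_meas_def)
  then show ?thesis using fi by (simp add: from_threads_def n_def)
qed

lemma from_threads_in:
  assumes x: "x \<in> threads (Upsilon vF)" shows "from_threads x \<in> lim_Upsilon"
  unfolding lim_Upsilon_def lim_meas_def mem_Collect_eq
proof (intro allI impI conjI)
  show "f \<notin> LCinf \<Longrightarrow> from_threads x m f = 0" for m f by (simp add: from_threads_def)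
  fix m n assume m: "\<bar>m\<bar> \<le> int n"
  have *: "x n m \<in> measures_Z vF n"
    using threads_sp[OF x, of n] m by (auto simp: Upsilon_def M_pro_def split: if_splits)
  have "restrict_meas vF n (from_threads x m) = x n m"
  proof
    fix f
    show "restrict_meas vF n (from_threads x m) f = x n m f"
      using from_threads_eq[OF x m] * by (simp add: restrict_meas_def measures_Z_def)
  qed
  then show "restrict_meas vF n (from_threads x m) \<in> measures_Z vF n" using * by simp
qed

lemma to_from_threads:
  assumes x: "x \<in> threads (Upsilon vF)" shows "to_threads (from_threads x) = x"
proof (intro ext)
  fix N m f
  have 1: "x N m \<in> measures_Z vF N" if "\<bar>m\<bar> \<le> int N"
    using threads_sp[OF x, of N] that by (auto simp: Upsilon_def M_pro_def split: if_splits)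
  have 2: "x N m = 0" if "\<not> \<bar>m\<bar> \<le> int N"
    using threads_sp[OF x, of N] that by (auto simp: Upsilon_def M_pro_def split: if_splits)
  show "to_threads (from_threads x) N m f = x N m f"
    using 1 2 from_threads_eq[OF x, of m N f] by (auto simp: to_threads_def restrict_meas_def measures_Z_def)
qed

lemma from_to_threads:
  assumes y: "y \<in> lim_Upsilon" shows "from_threads (to_threads y) = y"
proof (intro ext)
  fix m f
  show "from_threads (to_threads y) m f = y m f"
  proof (cases "f \<in> LCinf")
    case True
    then show ?thesis using level_exists[OF True, of m] by (simp add: from_threads_def to_threads_def restrict_meas_def)
  next
    case False
    then show ?thesis using lim_Upsilon_component[OF y, of m] by (simp add: from_threads_def lim_meas_def)
  qed
qed

lemma to_threads_add: "to_threads (\<lambda>m f. y m f + y' m f) = (\<lambda>N. to_threads y N + to_threads y' N)"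
  by (intro ext) (simp add: to_threads_def restrict_meas_def)

lemma to_threads_scale: "to_threads (\<lambda>m f. c * y m f) = (\<lambda>N. sc (Upsilon vF) c (to_threads y N))"
  by (intro ext) (simp add: to_threads_def restrict_meas_def Upsilon_def M_pro_def)

lemma from_threads_add: "from_threads (\<lambda>N. x N + x' N) = (\<lambda>m f. from_threads x m f + from_threads x' m f)"
  by (intro ext) (simp add: from_threads_def)

lemma from_threads_scale: "from_threads (\<lambda>N. sc (Upsilon vF) c (x N)) = (\<lambda>m f. c * from_threads x m f)"
  by (intro ext) (simp add: from_threads_def Upsilon_def M_pro_def)

lemma lim_Upsilon_add: "y \<in> lim_Upsilon \<Longrightarrow> y' \<in> lim_Upsilon \<Longrightarrow> (\<lambda>m f. y m f + y' m f) \<in> lim_Upsilon"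
  by (simp add: lim_Upsilon_def lim_meas_add)

lemma lim_Upsilon_scale: "y \<in> lim_Upsilon \<Longrightarrow> (\<lambda>m f. c * y m f) \<in> lim_Upsilon"
  by (simp add: lim_Upsilon_def lim_meas_scale)

end

section \<open>The action of \<open>P(K)\<close> on the limit of \<open>\<Upsilon>\<close>\<close>

locale local_field_with_char = nonarch_local_field vF for vF :: "'f::field \<Rightarrow> int" +
  fixes \<theta> :: "'f \<Rightarrow> complex"
  assumes char: "additive_char vF \<theta>"
begin

lemma char_add: "\<theta> (x + y) = \<theta> x * \<theta> y"
  using char by (simp add: additive_char_def)

lemma char_0 [simp]: "\<theta> 0 = 1"
proof -
  have "\<theta> (0 + 0) = \<theta> 0 * \<theta> 0" by (rule char_add)
  moreover have "\<theta> 0 \<noteq> 0" using char by (simp add: additive_char_def)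
  ultimately show ?thesis by simp
qed

lemma char_trivial: "x \<in> \<pp> 1 \<Longrightarrow> \<theta> x = 1"
  using char by (simp add: additive_char_def)

lemma char_nontrivial: "\<exists>x\<in>\<pp> 0. \<theta> x \<noteq> 1"
  using char by (simp add: additive_char_def)

lemma nth_mult_shift:
  fixes b x :: "'f fls"
  shows "(b * x) $$ m = (fls_shift d b * x) $$ (m - d)"
  using fls_shifted_times_simps(2)[of d b x] by simp

text \<open>The coefficient \<open>(b z)\<^sub>m\<close> involves the coefficients of \<open>z\<close> of degree at most \<open>m - v(b)\<close>, so the factor
  depends on the first \<open>n' + 1\<close> coefficients only.\<close>

lemma LC_char_mult:
  assumes f: "f \<in> LC vF n" and n: "n \<le> n'" and b: "b \<noteq> 0 \<Longrightarrow> m - fls_subdegree b \<le> int n'"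
  shows "(\<lambda>z. \<theta> ((b * z) $$ m) * f z) \<in> LC vF n'"
  unfolding LC_iff
proof (intro conjI allI impI ballI)
  show "z \<notin> O_units \<Longrightarrow> \<theta> ((b * z) $$ m) * f z = 0" for z using LC_outside[OF f] by simp
  fix z :: "'f fls" assume z: "z \<in> O_units"
  have "\<forall>z\<in>O_units. \<exists>N. \<forall>z'\<in>O_units. z' - z \<in> disc n' N \<longrightarrow> f z' = f z"
    using LC_mono[OF f n] unfolding LC_iff by (rule conjunct2)
  from bspec[OF this z] obtain N1 where N1: "\<forall>z'\<in>O_units. z' - z \<in> disc n' N1 \<longrightarrow> f z' = f z" ..
  let ?d = "fls_subdegree b"
  have neg: "\<forall>i<0. fls_shift ?d b $$ i = 0" by simp
  from disc_exists_bound[OF this, of n'] obtain R where R: "fls_shift ?d b \<in> disc n' (- R)" by blast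
  have th: "\<theta> ((b * z') $$ m) = \<theta> ((b * z) $$ m)" if z': "z' - z \<in> disc n' (R + 1)" for z'
  proof -
    have "fls_shift ?d b * (z' - z) \<in> disc n' (- R + (R + 1))" by (rule disc_mult[OF R z'])
    then have d: "fls_shift ?d b * (z' - z) \<in> disc n' 1" by simp
    have "(b * (z' - z)) $$ m \<in> \<pp> 1"
    proof (cases "b = 0")
      case False
      show ?thesis
        unfolding nth_mult_shift[of b _ m ?d] using d b[OF False] by (cases "m - ?d < 0") (auto simp: disc_def)
    qed simp
    then have "\<theta> ((b * (z' - z)) $$ m) = 1" by (rule char_trivial)
    moreover have "(b * z') $$ m = (b * z) $$ m + (b * (z' - z)) $$ m"
      by (simp add: right_diff_distrib)
    ultimately show ?thesis by (simp add: char_add)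
  qed
  have "\<theta> ((b * z') $$ m) * f z' = \<theta> ((b * z) $$ m) * f z"
    if "z' \<in> O_units" "z' - z \<in> disc n' (max N1 (R + 1))" for z'
  proof -
    have "z' - z \<in> disc n' N1" "z' - z \<in> disc n' (R + 1)" using that(2) by (auto elim!: disc_mono)
    then show ?thesis using bspec[OF N1 that(1)] th by metis
  qed
  then show "\<exists>N. \<forall>z'\<in>O_units. z' - z \<in> disc n' N \<longrightarrow>
      \<theta> ((b * z') $$ m) * f z' = \<theta> ((b * z) $$ m) * f z" by blast
qed

text \<open>With \<open>a = t\<^sup>k a'\<close> and \<open>a'\<close> a unit, this is the shift by \<open>k\<close>, pushforward along \<open>z \<mapsto> a'\<^sup>-\<^sup>1 z\<close> and
  multiplication by \<open>\<psi>(t\<^sup>-\<^sup>m b z/t) = \<theta>((b z)\<^sub>m)\<close>, in this order.\<close>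

definition P_op :: "'f fls \<Rightarrow> 'f fls \<Rightarrow> (int \<Rightarrow> 'f functional) \<Rightarrow> int \<Rightarrow> 'f functional" where
  "P_op a b y = (\<lambda>m f. if f \<in> LCinf
     then y (m - fls_subdegree a)
       (\<lambda>z. \<theta> ((b * (inverse (a * fls_X_intpow (- fls_subdegree a)) * z)) $$ m) *
            f (inverse (a * fls_X_intpow (- fls_subdegree a)) * z)) else 0)"

lemma psiK_eq: "psiK \<theta> (fls_X_intpow (- m) * b * z / fls_X) = \<theta> ((b * z) $$ m)"
proof -
  have "(fls_X_intpow (- m) * b * z) $$ 0 = (b * z) $$ m"
    using fls_X_intpow_times_conv_shift(1)[of "- m" "b * z"] by (simp add: mult.assoc)
  then show ?thesis by (simp add: psiK_def)
qed

text \<open>Unfolding both definitions at the level \<open>N\<close> where the result is evaluated; the source level \<open>L\<close> in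
  \<open>Upsilon_act\<close> is large enough for the integrand to be a function on \<open>Z\<^sub>L\<close>, so that all restrictions
  in between are harmless.\<close>

lemma Upsilon_act_eq:
  assumes y: "y \<in> lim_Upsilon" and a: "a \<noteq> 0"
  shows "from_threads (lim_map (Upsilon_act vF \<theta> (a, b)) (to_threads y)) = P_op a b y"
proof (intro ext)
  fix m f
  show "from_threads (lim_map (Upsilon_act vF \<theta> (a, b)) (to_threads y)) m f = P_op a b y m f"
  proof (cases "f \<in> LCinf")
    case False
    then show ?thesis by (simp add: from_threads_def P_op_def)
  next
    case True
    define N where "N = (LEAST N. \<bar>m\<bar> \<le> int N \<and> f \<in> LC vF N)"
    have N: "\<bar>m\<bar> \<le> int N" "f \<in> LC vF N" using level_exists[OF True, of m] by (auto simp: N_def)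
    define k where "k = fls_subdegree a"
    define a' where "a' = a * fls_X_intpow (- k)"
    define L where "L = N + nat \<bar>k\<bar> + nat \<bar>fls_subdegree b\<bar>"
    define p where "p = P_mult (P_mult (t_hat (- m)) (P_mult (a, b) (t_hat (- k)))) (t_hat m)"
    have a'u: "a' \<in> O_units"
      using a fls_subdegree_mult_fls_X_intpow(2)[OF a, of "- k"]
        fls_X_intpow_nonzero[of "- k", where 'a = 'f]
      unfolding a'_def O_units_def mem_Collect_eq by (simp only: k_def mult_eq_0_iff) simp
    have p2: "snd p = fls_X_intpow (- m) * b" by (simp add: p_def P_mult_def t_hat_def)
    have "fst p = fls_X_intpow (- m) * fls_X_intpow m * a'"
      by (simp only: p_def P_mult_def t_hat_def a'_def fst_conv snd_conv mult_ac)
    then have p1: "fst p = a'" by (simp only: fls_X_intpow_times_fls_X_intpow) simp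
    define l where "l = nat (max (int N) (- fls_subdegree (snd p)))"
    have sd: "- fls_subdegree (snd p) = (if b = 0 then 0 else m - fls_subdegree b)"
      unfolding p2 using fls_subdegree_mult_fls_X_intpow(1)[of b "- m"] by auto
    have lL: "l \<le> L" "N \<le> l" using N(1) unfolding l_def L_def sd by auto
    have lb: "b \<noteq> 0 \<Longrightarrow> m - fls_subdegree b \<le> int l" unfolding l_def sd by auto
    define g where "g z = \<theta> ((b * z) $$ m) * f z" for z
    have g: "g \<in> LC vF l" unfolding g_def by (rule LC_char_mult[OF N(2) lL(2) lb])
    define h where "h z = g (inverse a' * z)" for z
    have h: "h \<in> LC vF l" unfolding h_def by (rule LC_translate[OF g O_units_inverse[OF a'u]])
    have hL: "h \<in> LC vF L" using LC_mono[OF h lL(1)] .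
    have mk: "\<bar>m - k\<bar> \<le> int L" using N(1) by (auto simp: L_def)
    have "from_threads (lim_map (Upsilon_act vF \<theta> (a, b)) (to_threads y)) m f
        = snd (Upsilon_act vF \<theta> (a, b) N) (to_threads y (fst (Upsilon_act vF \<theta> (a, b) N))) m f"
      using True by (simp add: from_threads_def lim_map_def N_def)
    also have "\<dots> = snd (rho0 vF \<theta> p N) (tr (M_pro vF) L (fst (rho0 vF \<theta> p N)) (to_threads y L (m - k))) f"
      using N(1) by (simp add: Upsilon_act_def Let_def rho_def k_def p_def L_def)
    also have "\<dots> = restrict_meas vF l (to_threads y L (m - k))
        (\<lambda>z. psiK \<theta> (snd p * (inverse (fst p) * z) / fls_X) * f (inverse (fst p) * z))"
      using N(2) by (simp add: rho0_def M_pro_def l_def restrict_meas_def[of vF N] tilde_act_def hat_act_def)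
    also have "(\<lambda>z. psiK \<theta> (snd p * (inverse (fst p) * z) / fls_X) * f (inverse (fst p) * z)) = h"
      unfolding p1 p2 psiK_eq h_def g_def ..
    also have "restrict_meas vF l (to_threads y L (m - k)) h = y (m - k) h"
      using h hL mk by (simp add: restrict_meas_def to_threads_def)
    finally show ?thesis
      using True by (simp add: P_op_def h_def[abs_def] g_def k_def a'_def)
  qed
qed

end

section \<open>The Weyl element in the Kirillov model\<close>

text \<open>What is known about the operator \<open>W\<close> by which \<open>w\<close>, the antidiagonal matrix with entries \<open>1\<close>, acts on
  the limit of \<open>\<Upsilon>\<close>. These properties turn out to be contradictory.\<close>

locale weyl_operator = local_field_with_char vF \<theta>
  for vF :: "'f::field \<Rightarrow> int" and \<theta> :: "'f \<Rightarrow> complex" +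
  fixes W :: "(int \<Rightarrow> 'f functional) \<Rightarrow> int \<Rightarrow> 'f functional"
  assumes W_in: "y \<in> lim_Upsilon \<Longrightarrow> W y \<in> lim_Upsilon"
    and W_add: "y \<in> lim_Upsilon \<Longrightarrow> y' \<in> lim_Upsilon \<Longrightarrow> W (\<lambda>m f. y m f + y' m f) = (\<lambda>m f. W y m f + W y' m f)"
    and W_scale: "y \<in> lim_Upsilon \<Longrightarrow> W (\<lambda>m f. c * y m f) = (\<lambda>m f. c * W y m f)"
    and W_W: "y \<in> lim_Upsilon \<Longrightarrow> W (W y) = y"
    and W_diag: "a \<in> O_units \<Longrightarrow> y \<in> lim_Upsilon \<Longrightarrow> W (P_op a 0 y) = P_op (inverse a) 0 (W y)"
    and W_unip: "b \<noteq> 0 \<Longrightarrow> y \<in> lim_Upsilon \<Longrightarrow>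
       W (P_op 1 b (W y)) = P_op 1 (inverse b) (W (P_op (- (b\<^sup>2)) (- b) y))"
    and P_op_in: "a \<noteq> 0 \<Longrightarrow> y \<in> lim_Upsilon \<Longrightarrow> P_op a b y \<in> lim_Upsilon"
    and W_cont: "\<exists>L. \<forall>y\<in>lim_Upsilon. (\<forall>m f. \<bar>m\<bar> \<le> int L \<longrightarrow> f \<in> LC vF L \<longrightarrow> y m f = 0) \<longrightarrow>
       (\<forall>m f. \<bar>m\<bar> \<le> int N \<longrightarrow> f \<in> LC vF N \<longrightarrow> W y m f = 0)"
begin

definition single :: "int \<Rightarrow> 'f functional \<Rightarrow> int \<Rightarrow> 'f functional" where
  "single i \<nu> = (\<lambda>m. if m = i then \<nu> else (\<lambda>f. 0))"

lemma single_in: "\<nu> \<in> lim_meas i \<Longrightarrow> single i \<nu> \<in> lim_Upsilon"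
  by (simp add: single_def lim_Upsilon_def lim_meas_zero)

lemma lim_Upsilon_zero: "(\<lambda>m f. 0) \<in> lim_Upsilon"
  by (simp add: lim_Upsilon_def lim_meas_zero)

lemma lim_Upsilon_sum: "(\<And>i. i \<in> I \<Longrightarrow> y i \<in> lim_Upsilon) \<Longrightarrow> (\<lambda>m f. \<Sum>i\<in>I. y i m f) \<in> lim_Upsilon"
  by (induction I rule: infinite_finite_induct) (simp_all add: lim_Upsilon_zero lim_Upsilon_add)

lemma W_zero: "W (\<lambda>m f. 0) = (\<lambda>m f. 0)"
  using W_scale[OF lim_Upsilon_zero, of 0] by simp

lemma W_sum: "(\<And>i. i \<in> I \<Longrightarrow> y i \<in> lim_Upsilon) \<Longrightarrow> W (\<lambda>m f. \<Sum>i\<in>I. y i m f) = (\<lambda>m f. \<Sum>i\<in>I. W (y i) m f)"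
  by (induction I rule: infinite_finite_induct) (simp_all add: W_zero W_add lim_Upsilon_sum)

lemma W_diff:
  assumes "y \<in> lim_Upsilon" "y' \<in> lim_Upsilon"
  shows "(\<lambda>m f. y m f - y' m f) \<in> lim_Upsilon" "W (\<lambda>m f. y m f - y' m f) = (\<lambda>m f. W y m f - W y' m f)"
proof -
  have y'': "(\<lambda>m f. (-1) * y' m f) \<in> lim_Upsilon" by (rule lim_Upsilon_scale[OF assms(2)])
  have "W (\<lambda>m f. y m f + (-1) * y' m f) = (\<lambda>m f. W y m f + (-1) * W y' m f)"
    using W_add[OF assms(1) y''] W_scale[OF assms(2), of "-1"] by simp
  then show "W (\<lambda>m f. y m f - y' m f) = (\<lambda>m f. W y m f - W y' m f)" by simp
  show "(\<lambda>m f. y m f - y' m f) \<in> lim_Upsilon" using lim_Upsilon_add[OF assms(1) y''] by simp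
qed

definition modulus :: "nat \<Rightarrow> nat" where
  "modulus N = (SOME L. \<forall>y\<in>lim_Upsilon. (\<forall>m f. \<bar>m\<bar> \<le> int L \<longrightarrow> f \<in> LC vF L \<longrightarrow> y m f = 0) \<longrightarrow>
       (\<forall>m f. \<bar>m\<bar> \<le> int N \<longrightarrow> f \<in> LC vF N \<longrightarrow> W y m f = 0))"

lemma W_cong:
  assumes y: "y \<in> lim_Upsilon" and y': "y' \<in> lim_Upsilon" and m: "\<bar>m\<bar> \<le> int N" and f: "f \<in> LC vF N"
    and eq: "\<And>m f. \<bar>m\<bar> \<le> int (modulus N) \<Longrightarrow> f \<in> LC vF (modulus N) \<Longrightarrow> y m f = y' m f"
  shows "W y m f = W y' m f"
proof -
  have "\<forall>y\<in>lim_Upsilon. (\<forall>m f. \<bar>m\<bar> \<le> int (modulus N) \<longrightarrow> f \<in> LC vF (modulus N) \<longrightarrow> y m f = 0) \<longrightarrow>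
       (\<forall>m f. \<bar>m\<bar> \<le> int N \<longrightarrow> f \<in> LC vF N \<longrightarrow> W y m f = 0)"
    unfolding modulus_def by (rule someI_ex[OF W_cont])
  from bspec[OF this W_diff(1)[OF y y']] have "W (\<lambda>m f. y m f - y' m f) m f = 0"
    using eq m f by simp
  then show ?thesis by (simp add: W_diff(2)[OF y y'])
qed

text \<open>Up to level \<open>modulus N\<close> an element is the finite sum of its components, although it has infinitely many
  of them.\<close>

lemma W_components:
  assumes y: "y \<in> lim_Upsilon" and m: "\<bar>m\<bar> \<le> int N" and f: "f \<in> LC vF N"
  shows "W y m f = (\<Sum>i\<in>{- int (modulus N)..int (modulus N)}. W (single i (y i)) m f)"
proof -
  let ?I = "{- int (modulus N)..int (modulus N)}"
  have s: "single i (y i) \<in> lim_Upsilon" for i by (rule single_in[OF lim_Upsilon_component[OF y]])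
  have "W y m f = W (\<lambda>m f. \<Sum>i\<in>?I. single i (y i) m f) m f"
  proof (rule W_cong[OF y lim_Upsilon_sum[OF s] m f])
    fix m f assume "\<bar>m\<bar> \<le> int (modulus N)"
    then have "m \<in> ?I" by auto
    have "(\<Sum>i\<in>?I. single i (y i) m f) = (\<Sum>i\<in>?I. if m = i then y i f else 0)"
      by (rule sum.cong) (auto simp: single_def)
    also have "\<dots> = y m f" using \<open>m \<in> ?I\<close> by simp
    finally show "y m f = (\<Sum>i\<in>?I. single i (y i) m f)" by simp
  qed
  then show ?thesis by (simp add: W_sum[OF s])
qed

lemma P_op_unit:
  assumes "a \<in> O_units" "f \<in> LCinf"
  shows "P_op a 0 y m f = y m (\<lambda>z. f (inverse a * z))"
  using assms by (simp add: P_op_def O_units_def)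

lemma P_op_unip:
  assumes "f \<in> LCinf"
  shows "P_op 1 b y m f = y m (\<lambda>z. \<theta> ((b * z) $$ m) * f z)"
  using assms by (simp add: P_op_def)

abbreviation "L0 \<equiv> modulus 0"

text \<open>The component \<open>i\<close> of \<open>y\<close> matters for the bottom level of \<open>W y\<close>.\<close>

definition contributes :: "int \<Rightarrow> bool" where
  "contributes i \<longleftrightarrow> (\<exists>\<nu>\<in>lim_meas i. \<exists>f\<in>LC vF 0. W (single i \<nu>) 0 f \<noteq> 0)"

lemma indicator_O_units_LC: "indicator O_units \<in> LC vF n"
  by (rule LC_indicator[of _ n 0]) auto

text \<open>If no component contributed, then the bottom level of \<open>W (W y) = y\<close> would vanish for all \<open>y\<close>, but Haar
  measure has total mass \<open>1\<close>.\<close>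

lemma exists_top_contributing: "\<exists>s. \<bar>s\<bar> \<le> int L0 \<and> contributes s \<and> (\<forall>i. s < i \<longrightarrow> \<bar>i\<bar> \<le> int L0 \<longrightarrow> \<not> contributes i)"
proof -
  let ?S = "{i \<in> {- int L0..int L0}. contributes i}"
  have "?S \<noteq> {}"
  proof
    assume none: "?S = {}"
    define y where "y = single 0 (haar 1)"
    have y: "y \<in> lim_Upsilon" unfolding y_def by (intro single_in lim_meas_haar) simp
    define f :: "'f fls \<Rightarrow> complex" where "f = indicator O_units"
    have f: "f \<in> LC vF 0" unfolding f_def by (rule indicator_O_units_LC)
    have "W (W y) 0 f = (\<Sum>i\<in>{- int L0..int L0}. W (single i (W y i)) 0 f)"
      by (rule W_components[OF W_in[OF y]]) (use f in auto)
    also have "\<dots> = 0"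
      using none lim_Upsilon_component[OF W_in[OF y]] f by (intro sum.neutral) (auto simp: contributes_def)
    finally have "y 0 f = 0" by (simp add: W_W[OF y])
    then show False by (simp add: y_def single_def f_def haar_indicator_O_units)
  qed
  moreover have fin: "finite ?S" by (rule finite_subset[of _ "{- int L0..int L0}"]) auto
  ultimately have "Max ?S \<in> ?S" by (rule Max_in[rotated])
  then obtain s where s: "s \<in> ?S" "s = Max ?S" by blast
  have "\<not> contributes i" if i: "s < i" "\<bar>i\<bar> \<le> int L0" for i
  proof
    assume "contributes i"
    then have "i \<in> ?S" using i(2) by auto
    then have "i \<le> s" unfolding s(2) by (rule Max_ge[OF fin])
    then show False using i(1) by simp
  qed
  moreover have "\<bar>s\<bar> \<le> int L0" "contributes s" using s(1) by auto
  ultimately show ?thesis by blast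
qed

text \<open>A measure that witnesses the contribution of \<open>s\<close> is invariant under \<open>cong1 L0 r\<close> for all large \<open>r\<close>, and
  then it is, up to level \<open>L0\<close>, a combination of translates of \<open>haar r\<close>. As \<open>W\<close> inverts translations,
  it would vanish on this combination if it vanished on \<open>haar r\<close>.\<close>

lemma contributes_haar:
  assumes "contributes s" and s: "\<bar>s\<bar> \<le> int L0"
  shows "\<exists>r0\<ge>1. \<forall>r\<ge>r0. \<exists>f\<in>LC vF 0. W (single s (haar r)) 0 f \<noteq> 0"
proof -
  obtain \<nu> f where \<nu>: "\<nu> \<in> lim_meas s" and f: "f \<in> LC vF 0" and nz: "W (single s \<nu>) 0 f \<noteq> 0"
    using assms(1) unfolding contributes_def by blast
  have meas: "restrict_meas vF L0 \<nu> \<in> measures_Z vF L0" using \<nu> s by (simp add: lim_meas_def)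
  obtain r0 where r0: "r0 \<ge> 1" "\<forall>r\<ge>r0. cong1_invariant L0 r (restrict_meas vF L0 \<nu>)"
    using measures_Z_cong1_invariant[OF meas] by blast
  have "\<exists>f\<in>LC vF 0. W (single s (haar r)) 0 f \<noteq> 0" if r: "r \<ge> r0" for r
  proof (rule ccontr)
    assume "\<not> ?thesis"
    then have dead: "W (single s (haar r)) 0 g = 0" if "g \<in> LC vF 0" for g using that by blast
    have r1: "r \<ge> 1" using r r0(1) by simp
    have inv: "cong1_invariant L0 r (restrict_meas vF L0 \<nu>)" using r0(2) r by blast
    define c where "c x = restrict_meas vF L0 \<nu> (\<lambda>z. indicator (cong1 L0 r) (inverse x * z))" for x
    obtain X where X: "X \<subseteq> O_units" "finite X"
      "\<forall>f\<in>LC vF L0. restrict_meas vF L0 \<nu> f = (\<Sum>x\<in>X. c x * haar r (\<lambda>z. f (x * z)))"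
      using measure_decomposition[OF meas r1 inv] unfolding c_def by (elim exE conjE)
    define h where "h = single s (haar r)"
    have h: "h \<in> lim_Upsilon" unfolding h_def by (intro single_in lim_meas_haar r1)
    define y where "y x = P_op (inverse x) 0 h" for x
    have xO: "x \<in> O_units" "x \<noteq> 0" "inverse x \<in> O_units" if "x \<in> X" for x
      using that X(1) O_units_nonzero O_units_inverse by auto
    have yin: "y x \<in> lim_Upsilon" if "x \<in> X" for x unfolding y_def using xO[OF that] by (intro P_op_in h) auto
    have cyin: "(\<lambda>m f. c x * y x m f) \<in> lim_Upsilon" if "x \<in> X" for x by (rule lim_Upsilon_scale[OF yin[OF that]])
    have "W (single s \<nu>) 0 f = W (\<lambda>m f. \<Sum>x\<in>X. c x * y x m f) 0 f"
    proof (rule W_cong[OF single_in[OF \<nu>] lim_Upsilon_sum[OF cyin], where N = 0])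
      fix m g assume m: "\<bar>m\<bar> \<le> int L0" and g: "g \<in> LC vF L0"
      have yx: "y x m g = (if m = s then haar r (\<lambda>z. g (x * z)) else 0)" if "x \<in> X" for x
        unfolding y_def P_op_unit[OF xO(3)[OF that] LC_LCinf[OF g]] by (simp add: h_def single_def)
      have "(\<Sum>x\<in>X. c x * y x m g) = (\<Sum>x\<in>X. c x * (if m = s then haar r (\<lambda>z. g (x * z)) else 0))"
        using yx by (intro sum.cong) simp_all
      also have "\<dots> = single s \<nu> m g"
        using bspec[OF X(3) g] g by (simp add: single_def restrict_meas_def)
      finally show "single s \<nu> m g = (\<Sum>x\<in>X. c x * y x m g)" by simp
    qed (use f in auto)
    also have "\<dots> = (\<Sum>x\<in>X. c x * W (y x) 0 f)"
      using W_sum[of X "\<lambda>x m f. c x * y x m f", OF cyin] W_scale[OF yin] by simp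
    also have "\<dots> = 0"
    proof (rule sum.neutral, rule ballI)
      fix x assume x: "x \<in> X"
      have "W (y x) = P_op x 0 (W h)" unfolding y_def using W_diag[OF xO(3)[OF x] h] by simp
      then have "W (y x) 0 f = W h 0 (\<lambda>z. f (inverse x * z))"
        using P_op_unit[OF xO(1)[OF x] LC_LCinf[OF f]] by simp
      also have "\<dots> = 0" unfolding h_def by (rule dead[OF LC_translate[OF f xO(3)[OF x]]])
      finally show "c x * W (y x) 0 f = 0" by simp
    qed
    finally show False using nz by simp
  qed
  then show ?thesis using r0(1) by blast
qed

section \<open>Fourier sums that isolate one component\<close>

text \<open>As \<open>d\<close> runs through representatives with \<open>d\<^sub>0 \<noteq> 0\<close>, these are elements of \<open>K\<close> of valuation \<open>v\<close>
  whose coefficients of degree \<open>v\<close> to \<open>v + k\<close> run through \<open>\<varpi>\<^sup>-\<^sup>e O\<^sub>F\<close> modulo a small ideal.\<close>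

definition freq :: "int \<Rightarrow> nat \<Rightarrow> 'f fls \<Rightarrow> 'f fls" where
  "freq v e d = fls_X_intpow v * (fls_const (uniformizer powi (- int e)) * d)"

lemma freq_nth: "(freq v e d * z) $$ i = uniformizer powi (- int e) * (d * z) $$ (i - v)"
proof -
  have "freq v e d * z = fls_X_intpow v * (fls_const (uniformizer powi (- int e)) * (d * z))"
    by (simp only: freq_def mult.assoc)
  then show ?thesis by (simp only: fls_X_intpow_times_conv_shift(1) fls_shift_nth fls_mult_const_nth) simp
qed

text \<open>The coefficients \<open>\<theta>(- \<varpi>\<^sup>-\<^sup>e d\<^sub>k)\<close> are the inverse characters at the point \<open>z = 1\<close> in component \<open>v + k\<close>, so
  there the sum is a multiple of the indicator function of a neighbourhood of \<open>1\<close>.\<close>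

definition freq_sum :: "int \<Rightarrow> nat \<Rightarrow> nat \<Rightarrow> 'f fls set \<Rightarrow> int \<Rightarrow> 'f fls \<Rightarrow> complex" where
  "freq_sum v e k X i z = (\<Sum>d\<in>X. \<theta> (- (uniformizer powi (- int e) * d $$ int k)) * \<theta> ((freq v e d * z) $$ i))"

lemma freq_sum_eq:
  "freq_sum v e k X i z = (\<Sum>d\<in>X. \<theta> (uniformizer powi (- int e) * ((d * z) $$ (i - v) - d $$ int k)))"
  unfolding freq_sum_def freq_nth by (simp add: algebra_simps flip: char_add)

lemma freq_periodic:
  assumes N: "N \<ge> int e + R + 1" and R: "R \<ge> 0" and z: "z \<in> disc k (- R)" and i: "i - v \<le> int k"
  shows "periodic k N (\<lambda>d. \<theta> (uniformizer powi (- int e) * ((d * z) $$ (i - v) - d $$ int k)))"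
  unfolding periodic_def
proof (intro ballI impI)
  fix x y assume xy: "x - y \<in> disc k N"
  have "(x - y) * z \<in> disc k (N + - R)" by (rule disc_mult[OF xy z])
  then have 1: "((x - y) * z) $$ (i - v) \<in> \<pp> (N - R)"
    using i by (cases "i - v < 0") (auto simp: disc_def)
  have "(x - y) $$ int k \<in> \<pp> N" using xy by (auto simp: disc_def)
  then have 2: "(x - y) $$ int k \<in> \<pp> (N - R)" by (rule idealF_mono) (use R in simp)
  have "((x - y) * z) $$ (i - v) - (x - y) $$ int k \<in> \<pp> (N - R)" by (rule idealF_diff[OF 1 2])
  then have "((x - y) * z) $$ (i - v) - (x - y) $$ int k \<in> \<pp> (1 - - int e)"
    by (rule idealF_mono) (use N in simp)
  then have "uniformizer powi (- int e) * (((x - y) * z) $$ (i - v) - (x - y) $$ int k) \<in> \<pp> 1"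
    unfolding uni_power_mult_in_idealF .
  then have "\<theta> (uniformizer powi (- int e) * (((x - y) * z) $$ (i - v) - (x - y) $$ int k)) = 1"
    by (rule char_trivial)
  moreover have "uniformizer powi (- int e) * ((x * z) $$ (i - v) - x $$ int k)
     = uniformizer powi (- int e) * ((y * z) $$ (i - v) - y $$ int k)
      + uniformizer powi (- int e) * (((x - y) * z) $$ (i - v) - (x - y) $$ int k)"
    by (simp add: algebra_simps)
  ultimately show "\<theta> (uniformizer powi (- int e) * ((x * z) $$ (i - v) - x $$ int k)) =
      \<theta> (uniformizer powi (- int e) * ((y * z) $$ (i - v) - y $$ int k))"
    by (simp add: char_add)
qed

lemma freq_additive:
  "\<theta> (uniformizer powi (- int e) * (((x + y) * z) $$ j - (x + y) $$ k)) =
   \<theta> (uniformizer powi (- int e) * ((x * z) $$ j - x $$ k)) * \<theta> (uniformizer powi (- int e) * ((y * z) $$ j - y $$ k))"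
  by (simp add: algebra_simps flip: char_add)

lemma monomial_disc: "c \<in> \<pp> 0 \<Longrightarrow> fls_X_intpow (int i) * fls_const c \<in> disc k 0"
  by (auto simp: disc_def fls_X_intpow_times_conv_shift)

lemma monomial_mult_nth:
  fixes c :: 'f
  shows "((fls_X_intpow i * fls_const c) * z) $$ j = c * z $$ (j - i)"
proof -
  have "(fls_X_intpow i * fls_const c) * z = fls_X_intpow i * (fls_const c * z)" by (rule mult.assoc)
  then show ?thesis by (simp only: fls_X_intpow_times_conv_shift(1) fls_shift_nth fls_mult_const_nth) simp
qed

text \<open>For \<open>i < v + k\<close> the coefficient \<open>d\<^sub>k\<close> does not enter into \<open>(d z)\<^sub>i\<^sub>-\<^sub>v\<close>, so the summand is a nontrivial
  character of \<open>d\<^sub>k\<close>.\<close>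

lemma freq_sum_lower:
  assumes X: "rep_set k N X" and N: "N \<ge> int e + R + 1" and R: "R \<ge> 0" and z: "z \<in> disc k (- R)"
    and i: "i - v < int k"
  shows "freq_sum v e k X i z = 0"
proof -
  obtain x0 where x0: "x0 \<in> \<pp> 0" "\<theta> x0 \<noteq> 1" using char_nontrivial by blast
  define c where "c = - (uniformizer powi (int e) * x0)"
  have "uniformizer powi (int e) * x0 \<in> \<pp> 0"
    unfolding uni_power_mult_in_idealF using x0(1) by (rule idealF_mono) simp
  then have c: "c \<in> \<pp> 0" unfolding c_def by (rule idealF_minus)
  let ?y = "fls_X_intpow (int k) * fls_const c"
  have "(?y * z) $$ (i - v) = c * z $$ (i - v - int k)" by (rule monomial_mult_nth)
  also have "z $$ (i - v - int k) = 0" using z i by (simp add: disc_def)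
  finally have a: "(?y * z) $$ (i - v) = 0" by simp
  have b: "?y $$ int k = c" using monomial_mult_nth[of "int k" c 1 "int k"] by simp
  have "uniformizer powi (- int e) * ((?y * z) $$ (i - v) - ?y $$ int k) = x0"
    by (simp only: a b) (simp add: c_def uni_power_cancel del: power_int_of_nat)
  then have ne: "\<theta> (uniformizer powi (- int e) * ((?y * z) $$ (i - v) - ?y $$ int k)) \<noteq> 1"
    using x0(2) by (simp only: not_False_eq_True)
  have le: "i - v \<le> int k" using i by simp
  show ?thesis
    unfolding freq_sum_eq
    by (rule rep_set_sum_char[OF X freq_periodic[OF N R z le] freq_additive monomial_disc[OF c] ne])
qed

text \<open>The summand is the character \<open>d \<mapsto> \<theta>(\<varpi>\<^sup>-\<^sup>e (d (z - 1))\<^sub>k)\<close>. As \<open>\<theta>\<close> has conductor \<open>\<varpi> O\<^sub>F\<close>, it is trivial exactly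
  if the coefficients of \<open>z - 1\<close> up to degree \<open>k\<close> lie in \<open>\<varpi>\<^sup>e\<^sup>+\<^sup>1 O\<^sub>F\<close>.\<close>

lemma freq_sum_top:
  assumes X: "rep_set k N X" and N: "N \<ge> int e + R + 1" and R: "R \<ge> 0" and z: "z \<in> disc k (- R)"
    and i: "i - v = int k"
  shows "freq_sum v e k X i z = of_nat (card X) * indicator (cong1 k (Suc e)) z"
proof -
  have eq: "(d * z) $$ (i - v) - d $$ int k = (d * (z - 1)) $$ int k" for d
    by (simp add: i right_diff_distrib)
  show ?thesis
  proof (cases "z \<in> cong1 k (Suc e)")
    case True
    have "\<theta> (uniformizer powi (- int e) * ((d * z) $$ (i - v) - d $$ int k)) = 1" if "d \<in> X" for d
    proof -
      have "d \<in> disc k 0" using that X by (auto simp: rep_set_def)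
      then have "d * (z - 1) \<in> disc k (0 + int (Suc e))"
        using True by (intro disc_mult) (auto simp: cong1_def)
      then have "(d * (z - 1)) $$ int k \<in> \<pp> (1 - - int e)" by (auto simp: disc_def)
      then have "uniformizer powi (- int e) * (d * (z - 1)) $$ int k \<in> \<pp> 1"
        unfolding uni_power_mult_in_idealF .
      then show ?thesis unfolding eq by (rule char_trivial)
    qed
    then have "freq_sum v e k X i z = (\<Sum>d\<in>X. 1)" unfolding freq_sum_eq by (intro sum.cong) auto
    then show ?thesis using True by simp
  next
    case False
    then have "z - 1 \<notin> disc k (int (Suc e))" by (simp add: cong1_def)
    moreover have "\<forall>j<0. (z - 1) $$ j = 0" using z by (auto simp: disc_def)
    ultimately obtain j where j: "j \<in> {0..int k}" "(z - 1) $$ j \<notin> \<pp> (int (Suc e))"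
      unfolding disc_def by blast
    define w where "w = (z - 1) $$ j"
    have "w \<notin> \<pp> (int (Suc e))" using j(2) unfolding w_def .
    then have w: "w \<noteq> 0" "vF w \<le> int e" by (auto simp: vball_def)
    obtain x0 where x0: "x0 \<in> \<pp> 0" "\<theta> x0 \<noteq> 1" using char_nontrivial by blast
    define c where "c = uniformizer powi (int e) * x0 * inverse w"
    have "inverse w \<in> \<pp> (- int e)" using w by (simp add: vball_def vF_inverse)
    moreover have "uniformizer powi (int e) * x0 \<in> \<pp> (int e)" unfolding uni_power_mult_in_idealF using x0(1) by simp
    ultimately have "c \<in> \<pp> (int e + - int e)" unfolding c_def by (rule idealF_mult[rotated])
    then have c: "c \<in> \<pp> 0" by simp
    let ?y = "fls_X_intpow (int (nat (int k - j))) * fls_const c"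
    have "(?y * (z - 1)) $$ int k = c * w"
      using monomial_mult_nth[of "int (nat (int k - j))" c "z - 1" "int k"] j(1) by (simp add: w_def)
    then have "uniformizer powi (- int e) * ((?y * z) $$ (i - v) - ?y $$ int k) = x0"
      unfolding eq c_def using w(1) by (simp add: uni_power_cancel mult.assoc del: power_int_of_nat)
    then have ne: "\<theta> (uniformizer powi (- int e) * ((?y * z) $$ (i - v) - ?y $$ int k)) \<noteq> 1"
      using x0(2) by (simp only: not_False_eq_True)
    have le: "i - v \<le> int k" using i by simp
    have "freq_sum v e k X i z = 0"
      unfolding freq_sum_eq
      by (rule rep_set_sum_char[OF X freq_periodic[OF N R z le] freq_additive monomial_disc[OF c] ne])
    then show ?thesis using False by simp
  qed
qed

lemma freq_nonzero:
  assumes "d \<in> disc k 0" "d $$ 0 \<noteq> 0"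
  shows "freq v e d \<noteq> 0" "fls_subdegree (freq v e d) = v"
proof -
  have "d \<in> O_units" using assms by (auto simp: O_units_iff disc_def)
  then have d: "d \<noteq> 0" "fls_subdegree d = 0" by (auto simp: O_units_def)
  then have cd: "fls_const (uniformizer powi (- int e)) * d \<noteq> 0" by (simp add: fls_const_nonzero)
  show "freq v e d \<noteq> 0" unfolding freq_def using cd by (intro no_zero_divisors) auto
  have "fls_subdegree (fls_const (uniformizer powi (- int e)) * d) = 0"
    using d by (simp add: fls_const_nonzero)
  then show "fls_subdegree (freq v e d) = v"
    unfolding freq_def using fls_subdegree_mult_fls_X_intpow(1)[OF cd, of v] by simp
qed

section \<open>Vanishing of the top contributing component on the image of \<open>W\<close>\<close>

text \<open>By the braid relation this is the bottom level of \<open>n(1/b) W (-b\<^sup>2, -b)\<close>. Since \<open>1/b\<close> is divisible by \<open>t\<close>,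
  \<open>n(1/b)\<close> acts trivially there, and \<open>(-b\<^sup>2, -b)\<close> moves the component \<open>j\<close> out of the range that \<open>W\<close> can see.\<close>

lemma W_unip_W_bottom_vanishes:
  assumes \<nu>: "\<nu> \<in> lim_meas j" and b: "b \<noteq> 0" "fls_subdegree b < 0"
    and far: "\<bar>j + 2 * fls_subdegree b\<bar> > int L0" and f: "f \<in> LC vF 0"
  shows "W (P_op 1 b (W (single j \<nu>))) 0 f = 0"
proof -
  let ?y = "P_op (- (b\<^sup>2)) (- b) (single j \<nu>)"
  have s: "single j \<nu> \<in> lim_Upsilon" by (rule single_in[OF \<nu>])
  have y: "?y \<in> lim_Upsilon" using b by (intro P_op_in s) simp
  have "W (P_op 1 b (W (single j \<nu>))) 0 f = P_op 1 (inverse b) (W ?y) 0 f"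
    by (simp only: W_unip[OF b(1) s])
  also have "\<dots> = W ?y 0 (\<lambda>z. \<theta> ((inverse b * z) $$ 0) * f z)"
    by (rule P_op_unip[OF LC_LCinf[OF f]])
  also have "(\<lambda>z. \<theta> ((inverse b * z) $$ 0) * f z) = f"
  proof
    fix z
    show "\<theta> ((inverse b * z) $$ 0) * f z = f z"
    proof (cases "z \<in> O_units")
      case True
      then have "fls_subdegree (inverse b * z) > 0"
        using b by (simp add: O_units_def fls_inverse_subdegree)
      then show ?thesis by simp
    qed (simp add: LC_outside[OF f])
  qed
  also have "W ?y 0 f = W (\<lambda>m f. 0) 0 f"
  proof (rule W_cong[OF y lim_Upsilon_zero, where N = 0])
    fix m g assume m: "\<bar>m\<bar> \<le> int L0"
    have "fls_subdegree (- (b\<^sup>2)) = 2 * fls_subdegree b" using b by (simp add: power2_eq_square)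
    then have "m - fls_subdegree (- (b\<^sup>2)) \<noteq> j" using m far by auto
    then show "?y m g = 0" by (simp add: P_op_def single_def)
  qed (use f in auto)
  finally show ?thesis by (simp add: W_zero)
qed

text \<open>Take the Fourier sum of the relations \<open>W_unip_W_bottom_vanishes\<close> over \<open>b\<close> with \<open>v(b) = s - k\<close>. Components
  above \<open>s\<close> do not contribute, those below \<open>s\<close> are killed by the sum, and component \<open>s\<close> becomes its mass
  on \<open>cong1 k (Suc e)\<close> times a Haar measure that does contribute.\<close>

lemma component_mass_zero:
  assumes s: "\<bar>s\<bar> \<le> int L0" "\<forall>i. s < i \<longrightarrow> \<bar>i\<bar> \<le> int L0 \<longrightarrow> \<not> contributes i"
    and f: "f \<in> LC vF 0" "W (single s (haar (Suc e))) 0 f \<noteq> 0"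
    and k: "L0 \<le> k" "s < int k" "\<bar>j + 2 * (s - int k)\<bar> > int L0"
    and \<nu>: "\<nu> \<in> lim_meas j" and inv: "cong1_invariant k (Suc e) (W (single j \<nu>) s)"
  shows "W (single j \<nu>) s (indicator (cong1 k (Suc e))) = 0"
proof -
  define y where "y = W (single j \<nu>)"
  have y: "y \<in> lim_Upsilon" unfolding y_def by (intro W_in single_in \<nu>)
  define v where "v = s - int k"
  let ?I = "{- int L0..int L0}"
  have lin: "lin_LC k (y i)" if "i \<in> ?I" for i
    using lim_meas_lin[OF lim_Upsilon_component[OF y], of i k] that k(1) by auto
  \<comment> \<open>The Fourier sums are only controlled on bounded sets, so a common bound \<open>R\<close> is needed for the supports
      of the finitely many measures \<open>y i\<close> at level \<open>k\<close>.\<close>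
  have supp: "\<exists>R C. R \<ge> 0 \<and> C \<subseteq> O_units \<and> C \<subseteq> disc k (- R) \<and>
      (\<forall>f\<in>LC vF k. \<forall>g\<in>LC vF k. (\<forall>z\<in>C. f z = g z) \<longrightarrow> y i f = y i g)" if i: "i \<in> ?I" for i
  proof -
    have meas: "restrict_meas vF k (y i) \<in> measures_Z vF k"
      using lim_Upsilon_component[OF y, of i] i k(1) by (auto simp: lim_meas_def)
    obtain C where C: "compactin (Z_topology vF k) C" "C \<subseteq> O_units"
      "\<And>f g. f \<in> LC vF k \<Longrightarrow> g \<in> LC vF k \<Longrightarrow> (\<And>z. z \<in> C \<Longrightarrow> f z = g z) \<Longrightarrow>
         restrict_meas vF k (y i) f = restrict_meas vF k (y i) g"
      using measures_Z_support[OF meas] by metis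
    obtain R where R: "R \<ge> 0" "C \<subseteq> disc k (- R)" using compact_bounded[OF C(1)] by blast
    show ?thesis
    proof (intro exI[of _ R] exI[of _ C] conjI ballI impI R C(2))
      fix f g assume fg: "f \<in> LC vF k" "g \<in> LC vF k" "\<forall>z\<in>C. f z = g z"
      then show "y i f = y i g" using C(3)[OF fg(1,2)] by (simp add: restrict_meas_def)
    qed
  qed
  have "\<forall>i\<in>?I. \<exists>R C. R \<ge> 0 \<and> C \<subseteq> O_units \<and> C \<subseteq> disc k (- R) \<and>
      (\<forall>f\<in>LC vF k. \<forall>g\<in>LC vF k. (\<forall>z\<in>C. f z = g z) \<longrightarrow> y i f = y i g)"
    by (rule ballI) (rule supp)
  from bchoice[OF this] obtain Rf where "\<forall>i\<in>?I. \<exists>C. Rf i \<ge> 0 \<and> C \<subseteq> O_units \<and> C \<subseteq> disc k (- Rf i) \<and>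
      (\<forall>f\<in>LC vF k. \<forall>g\<in>LC vF k. (\<forall>z\<in>C. f z = g z) \<longrightarrow> y i f = y i g)" by (elim exE)
  from bchoice[OF this] obtain C where C: "\<forall>i\<in>?I. Rf i \<ge> 0 \<and> C i \<subseteq> O_units \<and> C i \<subseteq> disc k (- Rf i) \<and>
      (\<forall>f\<in>LC vF k. \<forall>g\<in>LC vF k. (\<forall>z\<in>C i. f z = g z) \<longrightarrow> y i f = y i g)" by (elim exE)
  define R where "R = Max (insert 0 (Rf ` ?I))"
  have R: "R \<ge> 0" "\<And>i. i \<in> ?I \<Longrightarrow> Rf i \<le> R"
    unfolding R_def by (intro Max_ge finite.insertI finite_imageI finite_atLeastAtMost_int; blast)+
  have CR: "z \<in> disc k (- R)" "z \<in> O_units" if i: "i \<in> ?I" and z: "z \<in> C i" for i z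
  proof -
    have c: "C i \<subseteq> O_units" "C i \<subseteq> disc k (- Rf i)" using bspec[OF C i] by simp_all
    then show "z \<in> O_units" using z by blast
    show "z \<in> disc k (- R)" by (rule disc_mono[OF subsetD[OF c(2) z]]) (use R(2)[OF i] in auto)
  qed
  have C_eq: "y i f = y i g" if "i \<in> ?I" "f \<in> LC vF k" "g \<in> LC vF k" "\<And>z. z \<in> C i \<Longrightarrow> f z = g z" for i f g
    using bspec[OF C that(1)] that by blast
  define N where "N = int e + R + 1"
  have N: "N \<ge> int e + R + 1" by (simp add: N_def)
  have "N \<ge> 0" using R(1) by (simp add: N_def)
  from rep_set_exists[OF this, of k] obtain X where X: "rep_set k N X" and X0: "\<forall>d\<in>X. d $$ 0 \<noteq> 0"
    by blast
  have b: "freq v e d \<noteq> 0" "fls_subdegree (freq v e d) = v" if "d \<in> X" for d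
    using freq_nonzero[of d k v e] that X X0 by (auto simp: rep_set_def)
  define c where "c d = \<theta> (- (uniformizer powi (- int e) * d $$ int k))" for d
  define u where "u d = (\<lambda>m f. c d * P_op 1 (freq v e d) y m f)" for d
  have oin: "P_op 1 (freq v e d) y \<in> lim_Upsilon" for d by (rule P_op_in[OF _ y]) simp
  have u: "u d \<in> lim_Upsilon" for d unfolding u_def by (rule lim_Upsilon_scale[OF oin])
  define w where "w = (\<lambda>m f. \<Sum>d\<in>X. u d m f)"
  have w: "w \<in> lim_Upsilon" unfolding w_def by (rule lim_Upsilon_sum[OF u])
  have "W w 0 f = (\<Sum>d\<in>X. c d * W (P_op 1 (freq v e d) y) 0 f)"
    unfolding w_def W_sum[OF u] unfolding u_def W_scale[OF oin] ..
  also have "\<dots> = 0"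
  proof (rule sum.neutral, rule ballI)
    fix d assume d: "d \<in> X"
    have "W (P_op 1 (freq v e d) y) 0 f = 0"
      unfolding y_def by (rule W_unip_W_bottom_vanishes[OF \<nu> _ _ _ f(1)]) (use b[OF d] k in \<open>auto simp: v_def\<close>)
    then show "c d * W (P_op 1 (freq v e d) y) 0 f = 0" by simp
  qed
  finally have Ww: "W w 0 f = 0" .
  have w_val: "w i g = y i (\<lambda>z. freq_sum v e k X i z * g z)"
    if i: "i \<in> ?I" "i \<le> s" and g: "g \<in> LC vF L0" for i g
  proof -
    have LC: "(\<lambda>z. \<theta> ((freq v e d * z) $$ i) * g z) \<in> LC vF k" if "d \<in> X" for d
      by (rule LC_char_mult[OF g k(1)]) (use i b(2)[OF that] in \<open>auto simp: v_def\<close>)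
    have LC': "(\<lambda>z. c d * (\<theta> ((freq v e d * z) $$ i) * g z)) \<in> LC vF k" if "d \<in> X" for d
      by (rule LC_cmult[OF LC[OF that]])
    have "w i g = (\<Sum>d\<in>X. c d * y i (\<lambda>z. \<theta> ((freq v e d * z) $$ i) * g z))"
      by (simp add: w_def u_def P_op_unip[OF LC_LCinf[OF g]])
    also have "\<dots> = (\<Sum>d\<in>X. y i (\<lambda>z. c d * (\<theta> ((freq v e d * z) $$ i) * g z)))"
      by (rule sum.cong) (simp_all add: lin_LC_cmult[OF lin[OF i(1)] LC])
    also have "\<dots> = y i (\<lambda>z. \<Sum>d\<in>X. c d * (\<theta> ((freq v e d * z) $$ i) * g z))"
      by (rule lin_LC_sum[OF lin[OF i(1)] LC', symmetric])
    also have "(\<lambda>z. \<Sum>d\<in>X. c d * (\<theta> ((freq v e d * z) $$ i) * g z)) = (\<lambda>z. freq_sum v e k X i z * g z)"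
      by (simp add: freq_sum_def c_def sum_distrib_right mult.assoc)
    finally show ?thesis .
  qed
  have fs_LC: "(\<lambda>z. freq_sum v e k X i z * g z) \<in> LC vF k" if i: "i \<le> s" and g: "g \<in> LC vF L0" for i g
  proof -
    have LC: "(\<lambda>z. c d * (\<theta> ((freq v e d * z) $$ i) * g z)) \<in> LC vF k" if "d \<in> X" for d
      by (rule LC_cmult, rule LC_char_mult[OF g k(1)]) (use i b(2)[OF that] in \<open>auto simp: v_def\<close>)
    have "(\<lambda>z. \<Sum>d\<in>X. c d * (\<theta> ((freq v e d * z) $$ i) * g z)) = (\<lambda>z. freq_sum v e k X i z * g z)"
      by (simp add: freq_sum_def c_def sum_distrib_right mult.assoc)
    then show ?thesis using LC_sum[OF LC, of X "\<lambda>d. d"] by simp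
  qed
  have sI: "s \<in> ?I" using s(1) by auto
  have others: "W (single i (w i)) 0 f = 0" if i: "i \<in> ?I" "i \<noteq> s" for i
  proof (cases "i < s")
    case False
    then have "\<not> contributes i" using s(2) i by auto
    then show ?thesis using lim_Upsilon_component[OF w, of i] f(1) unfolding contributes_def by blast
  next
    case True
    have "W (single i (w i)) 0 f = W (\<lambda>m f. 0) 0 f"
    proof (rule W_cong[OF single_in[OF lim_Upsilon_component[OF w]] lim_Upsilon_zero, where N = 0])
      fix m g assume g: "g \<in> LC vF L0"
      have "w i g = y i (\<lambda>z. freq_sum v e k X i z * g z)" using w_val[OF i(1) _ g] True by simp
      also have "\<dots> = y i (\<lambda>z. 0)"
      proof (rule C_eq[OF i(1)])
        fix z assume "z \<in> C i"
        then have "freq_sum v e k X i z = 0"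
          using freq_sum_lower[OF X N R(1) CR(1)[OF i(1)]] True by (simp add: v_def)
        then show "freq_sum v e k X i z * g z = 0" by simp
      qed (use fs_LC[OF _ g] True in auto)
      also have "\<dots> = 0" by (rule lin_LC_zero_fun[OF lin[OF i(1)]])
      finally show "single i (w i) m g = 0" by (simp add: single_def)
    qed (use f in auto)
    then show ?thesis by (simp add: W_zero)
  qed
  define \<kappa> where "\<kappa> = of_nat (card X) * y s (indicator (cong1 k (Suc e)))"
  have h: "single s (haar (Suc e)) \<in> lim_Upsilon" by (intro single_in lim_meas_haar) simp
  have "W w 0 f = (\<Sum>i\<in>?I. W (single i (w i)) 0 f)" by (rule W_components[OF w]) (use f in auto)
  also have "\<dots> = (\<Sum>i\<in>?I. if i = s then W (single s (w s)) 0 f else 0)"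
    using others by (intro sum.cong) auto
  also have "\<dots> = W (single s (w s)) 0 f" using sI by simp
  also have "\<dots> = W (\<lambda>m f. \<kappa> * single s (haar (Suc e)) m f) 0 f"
  proof (rule W_cong[OF single_in[OF lim_Upsilon_component[OF w]] lim_Upsilon_scale[OF h], where N = 0])
    fix m g assume g: "g \<in> LC vF L0"
    have gk: "g \<in> LC vF k" by (rule LC_mono[OF g k(1)])
    have I: "(\<lambda>z. indicator (cong1 k (Suc e)) z * g z) \<in> LC vF k"
      by (intro LC_mult LC_cong1_indicator gk) simp
    have "w s g = y s (\<lambda>z. freq_sum v e k X s z * g z)" using w_val[OF sI _ g] by simp
    also have "\<dots> = y s (\<lambda>z. of_nat (card X) * (indicator (cong1 k (Suc e)) z * g z))"
    proof (rule C_eq[OF sI fs_LC[OF _ g] LC_cmult[OF I]])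
      fix z assume "z \<in> C s"
      then show "freq_sum v e k X s z * g z = of_nat (card X) * (indicator (cong1 k (Suc e)) z * g z)"
        using freq_sum_top[OF X N R(1) CR(1)[OF sI]] by (simp add: v_def)
    qed simp
    also have "\<dots> = of_nat (card X) * y s (\<lambda>z. indicator (cong1 k (Suc e)) z * g z)"
      by (rule lin_LC_cmult[OF lin[OF sI] I])
    also have "y s (\<lambda>z. indicator (cong1 k (Suc e)) z * g z) = y s (indicator (cong1 k (Suc e))) * haar (Suc e) g"
      by (rule measure_on_coset[OF lin[OF sI] _ _ gk]) (use inv in \<open>simp_all add: y_def\<close>)
    finally show "single s (w s) m g = \<kappa> * single s (haar (Suc e)) m g" by (simp add: single_def \<kappa>_def)
  qed (use f in auto)
  also have "\<dots> = \<kappa> * W (single s (haar (Suc e))) 0 f" unfolding W_scale[OF h] ..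
  finally have "\<kappa> = 0" using Ww f(2) by simp
  then show ?thesis using rep_set_nonempty[OF X] by (simp add: \<kappa>_def y_def)
qed

text \<open>Translating \<open>\<nu>\<close> translates \<open>W \<nu>\<close>, so by \<open>component_mass_zero\<close> the component has mass \<open>0\<close> on every coset
  of a group under which it is invariant at level \<open>k\<close>.\<close>

lemma component_vanishes:
  assumes s: "\<bar>s\<bar> \<le> int L0" "\<forall>i. s < i \<longrightarrow> \<bar>i\<bar> \<le> int L0 \<longrightarrow> \<not> contributes i" "contributes s"
    and \<nu>: "\<nu> \<in> lim_meas j" and f: "f \<in> LC vF (nat \<bar>s\<bar>)"
  shows "W (single j \<nu>) s f = 0"
proof -
  \<comment> \<open>Large enough for \<open>v(b) = s - k\<close> to be negative and for \<open>j + 2 v(b)\<close> to lie below \<open>- L0\<close>.\<close>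
  define k where "k = L0 + nat \<bar>j\<bar> + 2 * nat \<bar>s\<bar> + 1"
  have k: "L0 \<le> k" "s < int k" "\<bar>j + 2 * (s - int k)\<bar> > int L0" "nat \<bar>s\<bar> \<le> k" "\<bar>s\<bar> \<le> int k"
    by (auto simp: k_def)
  define y where "y = single j \<nu>"
  have y: "y \<in> lim_Upsilon" unfolding y_def by (rule single_in[OF \<nu>])
  have Wy: "W y \<in> lim_Upsilon" by (rule W_in[OF y])
  have meas: "restrict_meas vF k (W y s) \<in> measures_Z vF k"
    using lim_Upsilon_component[OF Wy, of s] k(5) by (simp add: lim_meas_def)
  obtain r1 where r1: "r1 \<ge> 1" "\<forall>r\<ge>r1. cong1_invariant k r (restrict_meas vF k (W y s))"
    using measures_Z_cong1_invariant[OF meas] by blast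
  obtain r0 where r0: "r0 \<ge> 1" "\<forall>r\<ge>r0. \<exists>f\<in>LC vF 0. W (single s (haar r)) 0 f \<noteq> 0"
    using contributes_haar[OF s(3,1)] by blast
  define e where "e = max r0 r1"
  have r: "Suc e \<ge> 1" "Suc e \<ge> r0" "Suc e \<ge> r1" by (simp_all add: e_def)
  obtain f0 where f0: "f0 \<in> LC vF 0" "W (single s (haar (Suc e))) 0 f0 \<noteq> 0" using r0(2) r(2) by blast
  have invr: "cong1_invariant k (Suc e) (restrict_meas vF k (W y s))" using r1(2) r(3) by blast
  have inv: "W y s (\<lambda>z. g (t * z)) = W y s g" if "t \<in> cong1 k (Suc e)" "g \<in> LC vF k" for t g
  proof -
    have "t \<in> O_units" using that(1) cong1_subset_O_units[OF r(1)] by blast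
    from LC_translate[OF that(2) this] show ?thesis
      using bspec[OF bspec[OF invr[unfolded cong1_invariant_def] that(1)] that(2)] that(2)
      by (simp add: restrict_meas_def)
  qed
  have mass: "W y s (\<lambda>z. indicator (cong1 k (Suc e)) (x * z)) = 0" if x: "x \<in> O_units" for x
  proof -
    have x0: "x \<noteq> 0" and ix: "inverse x \<in> O_units" using x O_units_nonzero O_units_inverse by auto
    define \<nu>' where "\<nu>' = P_op x 0 y j"
    have \<nu>': "\<nu>' \<in> lim_meas j" unfolding \<nu>'_def by (rule lim_Upsilon_component[OF P_op_in[OF x0 y]])
    have "P_op x 0 y = single j \<nu>'"
    proof (intro ext)
      fix m g
      have "fls_subdegree x = 0" using x by (simp add: O_units_def)
      then show "P_op x 0 y m g = single j \<nu>' m g"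
        by (cases "m = j") (simp_all add: \<nu>'_def P_op_def y_def single_def)
    qed
    then have e1: "W (single j \<nu>') = P_op (inverse x) 0 (W y)" using W_diag[OF x y] by simp
    have e2: "W (single j \<nu>') s g = W y s (\<lambda>z. g (x * z))" if "g \<in> LC vF k" for g
      unfolding e1 P_op_unit[OF ix LC_LCinf[OF that]] by simp
    have "cong1_invariant k (Suc e) (W (single j \<nu>') s)"
      unfolding cong1_invariant_def
    proof (intro ballI)
      fix t g assume t: "t \<in> cong1 k (Suc e)" and g: "g \<in> LC vF k"
      have tO: "t \<in> O_units" using t cong1_subset_O_units[OF r(1)] by blast
      have "W (single j \<nu>') s (\<lambda>z. g (t * z)) = W y s (\<lambda>z. g (t * (x * z)))"
        by (rule e2[OF LC_translate[OF g tO]])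
      also have "\<dots> = W y s (\<lambda>z. g (x * (t * z)))" by (simp add: mult.left_commute)
      also have "\<dots> = W y s (\<lambda>z. g (x * z))" by (rule inv[OF t LC_translate[OF g x]])
      finally show "W (single j \<nu>') s (\<lambda>z. g (t * z)) = W (single j \<nu>') s g" by (simp add: e2[OF g])
    qed
    from component_mass_zero[OF s(1,2) f0 k(1-3) \<nu>' this] show ?thesis
      using e2[OF LC_cong1_indicator[OF r(1)]] by simp
  qed
  obtain Y where Y: "Y \<subseteq> O_units" "\<forall>f\<in>LC vF k. restrict_meas vF k (W y s) f =
      (\<Sum>x\<in>Y. restrict_meas vF k (W y s) (\<lambda>z. indicator (cong1 k (Suc e)) (inverse x * z)) *
        haar (Suc e) (\<lambda>z. f (x * z)))"
    using measure_decomposition[OF meas r(1) invr] by (elim exE conjE)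
  have fk: "f \<in> LC vF k" by (rule LC_mono[OF f k(4)])
  have "restrict_meas vF k (W y s) f = 0"
    unfolding bspec[OF Y(2) fk]
  proof (rule sum.neutral, rule ballI)
    fix x assume "x \<in> Y"
    then have "inverse x \<in> O_units" using Y(1) O_units_inverse by blast
    from mass[OF this] show "restrict_meas vF k (W y s) (\<lambda>z. indicator (cong1 k (Suc e)) (inverse x * z)) *
        haar (Suc e) (\<lambda>z. f (x * z)) = 0"
      by (simp add: restrict_meas_def)
  qed
  then show ?thesis using fk by (simp add: restrict_meas_def y_def)
qed

text \<open>The component \<open>s\<close> of \<open>W y\<close> at level \<open>\<bar>s\<bar>\<close> is a finite sum of contributions of single components of \<open>y\<close>, all of which
  vanish; but \<open>W\<close> is onto.\<close>

lemma no_weyl_operator: False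
proof -
  obtain s where s: "\<bar>s\<bar> \<le> int L0" "contributes s" "\<forall>i. s < i \<longrightarrow> \<bar>i\<bar> \<le> int L0 \<longrightarrow> \<not> contributes i"
    using exists_top_contributing by blast
  define f :: "'f fls \<Rightarrow> complex" where "f = indicator O_units"
  have f: "f \<in> LC vF (nat \<bar>s\<bar>)" unfolding f_def by (rule indicator_O_units_LC)
  define y where "y = single s (haar 1)"
  have y: "y \<in> lim_Upsilon" unfolding y_def by (intro single_in lim_meas_haar) simp
  have "W (W y) s f = (\<Sum>i\<in>{- int (modulus (nat \<bar>s\<bar>))..int (modulus (nat \<bar>s\<bar>))}. W (single i (W y i)) s f)"
    by (rule W_components[OF W_in[OF y] _ f]) simp
  also have "\<dots> = 0"
    by (intro sum.neutral ballI component_vanishes[OF s(1,3,2) lim_Upsilon_component[OF W_in[OF y]] f])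
  finally have "y s f = 0" by (simp add: W_W[OF y])
  then show False by (simp add: y_def single_def f_def haar_indicator_O_units)
qed

end

section \<open>The operator of the Weyl element and the conclusion\<close>

locale local_Upsilon_extension = Upsilon_extension vF V \<alpha> \<theta> \<Phi> \<Psi> + local_field_with_char vF \<theta>
  for vF :: "'f::field \<Rightarrow> int" and V :: "'v::ab_group_add prospace" and \<alpha> \<theta> \<Phi> \<Psi>
begin

definition act_lim :: "'f mat2 \<Rightarrow> (int \<Rightarrow> 'f functional) \<Rightarrow> int \<Rightarrow> 'f functional" where
  "act_lim g y = from_threads (act_U g (to_threads y))"

lemma act_lim_in: "g \<in> GL2K \<Longrightarrow> y \<in> lim_Upsilon \<Longrightarrow> act_lim g y \<in> lim_Upsilon"
  unfolding act_lim_def by (intro from_threads_in act_U_in to_threads_in)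

lemma act_lim_add:
  assumes "g \<in> GL2K" "y \<in> lim_Upsilon" "y' \<in> lim_Upsilon"
  shows "act_lim g (\<lambda>m f. y m f + y' m f) = (\<lambda>m f. act_lim g y m f + act_lim g y' m f)"
  unfolding act_lim_def
  using act_U_add[OF assms(1) to_threads_in[OF assms(2)] to_threads_in[OF assms(3)]] to_threads_in[OF lim_Upsilon_add[OF assms(2,3)]]
  by (simp add: to_threads_add from_threads_add)

lemma act_lim_scale:
  assumes "g \<in> GL2K" "y \<in> lim_Upsilon"
  shows "act_lim g (\<lambda>m f. c * y m f) = (\<lambda>m f. c * act_lim g y m f)"
  unfolding act_lim_def
  using act_U_scale[OF assms(1) to_threads_in[OF assms(2)], of c] to_threads_in[OF lim_Upsilon_scale[OF assms(2), of c]]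
  by (simp add: to_threads_scale from_threads_scale)

lemma act_lim_mult:
  assumes "g \<in> GL2K" "h \<in> GL2K" "y \<in> lim_Upsilon"
  shows "act_lim (g ** h) y = act_lim g (act_lim h y)"
  unfolding act_lim_def using assms by (simp add: act_U_mult to_threads_in to_from_threads act_U_in)

lemma act_lim_one: "y \<in> lim_Upsilon \<Longrightarrow> act_lim (mat 1) y = y"
  unfolding act_lim_def by (simp add: act_U_one to_threads_in from_to_threads)

lemma act_lim_scalar:
  "g \<in> GL2K \<Longrightarrow> c \<noteq> 0 \<Longrightarrow> mat c ** g \<in> GL2K \<Longrightarrow> y \<in> lim_Upsilon \<Longrightarrow> act_lim (mat c ** g) y = act_lim g y"
  unfolding act_lim_def by (simp add: act_U_scalar to_threads_in)

lemma act_lim_P: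
  "a \<noteq> 0 \<Longrightarrow> y \<in> lim_Upsilon \<Longrightarrow> act_lim (P_mat (a, b)) y = P_op a b y"
  unfolding act_lim_def by (simp add: act_U_P to_threads_in Upsilon_act_eq)

lemma act_lim_continuous:
  assumes g: "g \<in> GL2K"
  shows "\<exists>L. \<forall>y\<in>lim_Upsilon. (\<forall>m f. \<bar>m\<bar> \<le> int L \<longrightarrow> f \<in> LC vF L \<longrightarrow> y m f = 0) \<longrightarrow>
       (\<forall>m f. \<bar>m\<bar> \<le> int N \<longrightarrow> f \<in> LC vF N \<longrightarrow> act_lim g y m f = 0)"
proof -
  obtain L where L: "\<And>x y. x L = y L \<Longrightarrow> act_U g x N = act_U g y N"
    using act_U_continuous by metis
  define o' :: "int \<Rightarrow> 'f functional" where "o' = (\<lambda>m f. 0)"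
  have o': "o' \<in> lim_Upsilon" by (simp add: o'_def lim_Upsilon_def lim_meas_zero)
  have go: "act_lim g o' = o'" using act_lim_scale[OF g o', of 0] by (simp add: o'_def)
  have "act_lim g y m f = 0"
    if y: "y \<in> lim_Upsilon" "\<forall>m f. \<bar>m\<bar> \<le> int L \<longrightarrow> f \<in> LC vF L \<longrightarrow> y m f = 0" and m: "\<bar>m\<bar> \<le> int N" "f \<in> LC vF N"
    for y m f
  proof -
    have "to_threads y L = to_threads o' L"
      using y(2) by (intro ext) (simp add: to_threads_def restrict_meas_def o'_def)
    then have "act_U g (to_threads y) N = act_U g (to_threads o') N" by (rule L)
    moreover have "act_lim g y m f = act_U g (to_threads y) N m f" "act_lim g o' m f = act_U g (to_threads o') N m f"
      unfolding act_lim_def by (intro from_threads_eq act_U_in g to_threads_in y(1) o' m)+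
    ultimately show ?thesis using go by (simp add: o'_def)
  qed
  then show ?thesis by blast
qed

definition weyl :: "'f mat2" where
  "weyl = vector [vector [0, 1], vector [1, 0]]"

lemma GL2K_iff: "g \<in> GL2K \<longleftrightarrow> det g \<noteq> 0"
  by (simp add: GL2K_def invertible_det_nz)

lemma weyl_GL2K: "weyl \<in> GL2K"
  by (simp add: GL2K_iff det_2 weyl_def)

lemma P_mat_GL2K: "a \<noteq> 0 \<Longrightarrow> P_mat (a, b) \<in> GL2K"
  by (simp add: GL2K_iff det_2 P_mat_def)

lemma GL2K_mult: "g \<in> GL2K \<Longrightarrow> h \<in> GL2K \<Longrightarrow> g ** h \<in> GL2K"
  by (simp add: GL2K_iff det_mul)

lemmas mat2_simps = vec_eq_iff matrix_matrix_mult_def sum_2 forall_2 vector_2 mat_def weyl_def P_mat_def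

lemma weyl_square: "weyl ** weyl = mat 1"
  by (simp add: mat2_simps)

lemma weyl_diag: "a \<noteq> 0 \<Longrightarrow> weyl ** P_mat (a, 0) = mat a ** (P_mat (inverse a, 0) ** weyl)"
  by (simp add: mat2_simps)

text \<open>The left-hand side is the lower triangular matrix with rows \<open>(1, 0)\<close> and \<open>(b, 1)\<close>, and the right-hand side
  is its Bruhat decomposition.\<close>

lemma weyl_unip:
  "b \<noteq> 0 \<Longrightarrow> weyl ** (P_mat (1, b) ** weyl) =
     mat (- inverse b) ** (P_mat (1, inverse b) ** (weyl ** P_mat (- (b\<^sup>2), - b)))"
  by (simp add: mat2_simps power2_eq_square field_simps)

lemma weyl_operator: "weyl_operator vF \<theta> (act_lim weyl)"
proof
  fix y y' assume y: "y \<in> lim_Upsilon" and y': "y' \<in> lim_Upsilon"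
  show "act_lim weyl (\<lambda>m f. y m f + y' m f) = (\<lambda>m f. act_lim weyl y m f + act_lim weyl y' m f)"
    by (rule act_lim_add[OF weyl_GL2K y y'])
next
  fix y c assume y: "y \<in> lim_Upsilon"
  show "act_lim weyl y \<in> lim_Upsilon" by (rule act_lim_in[OF weyl_GL2K y])
  show "act_lim weyl (\<lambda>m f. c * y m f) = (\<lambda>m f. c * act_lim weyl y m f)"
    by (rule act_lim_scale[OF weyl_GL2K y])
  show "act_lim weyl (act_lim weyl y) = y"
    using act_lim_mult[OF weyl_GL2K weyl_GL2K y] by (simp add: weyl_square act_lim_one y)
next
  fix a :: "'f fls" and y assume a: "a \<in> O_units" and y: "y \<in> lim_Upsilon"
  have a0: "a \<noteq> 0" "inverse a \<noteq> 0" using O_units_nonzero[OF a] by auto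
  have wP: "weyl ** P_mat (a, 0) \<in> GL2K" by (intro GL2K_mult weyl_GL2K P_mat_GL2K a0)
  have Pw: "P_mat (inverse a, 0) ** weyl \<in> GL2K" by (intro GL2K_mult weyl_GL2K P_mat_GL2K a0)
  have "act_lim weyl (P_op a 0 y) = act_lim (weyl ** P_mat (a, 0)) y"
    by (simp add: act_lim_mult[OF weyl_GL2K P_mat_GL2K[OF a0(1)] y] act_lim_P a0 y)
  also have "\<dots> = act_lim (P_mat (inverse a, 0) ** weyl) y"
    using wP unfolding weyl_diag[OF a0(1)] by (intro act_lim_scalar Pw a0(1) y)
  also have "\<dots> = P_op (inverse a) 0 (act_lim weyl y)"
    by (simp only: act_lim_mult[OF P_mat_GL2K[OF a0(2)] weyl_GL2K y]
        act_lim_P[OF a0(2) act_lim_in[OF weyl_GL2K y]])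
  finally show "act_lim weyl (P_op a 0 y) = P_op (inverse a) 0 (act_lim weyl y)" .
next
  fix b :: "'f fls" and y assume b: "b \<noteq> 0" and y: "y \<in> lim_Upsilon"
  have b2: "- (b\<^sup>2) \<noteq> 0" using b by simp
  let ?n = "P_mat (1, b)" and ?n' = "P_mat (1, inverse b)" and ?p = "P_mat (- (b\<^sup>2), - b)"
  have n: "?n \<in> GL2K" "?n' \<in> GL2K" "?p \<in> GL2K" by (intro P_mat_GL2K b2 one_neq_zero[symmetric] | simp)+
  have nw: "?n ** weyl \<in> GL2K" "weyl ** ?p \<in> GL2K" "?n' ** (weyl ** ?p) \<in> GL2K"
    "weyl ** (?n ** weyl) \<in> GL2K"
    by (intro GL2K_mult weyl_GL2K n)+
  have "act_lim weyl (P_op 1 b (act_lim weyl y)) = act_lim (weyl ** (?n ** weyl)) y"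
    by (simp only: act_lim_mult[OF weyl_GL2K nw(1) y] act_lim_mult[OF n(1) weyl_GL2K y]
        act_lim_P[OF one_neq_zero act_lim_in[OF weyl_GL2K y]])
  also have "\<dots> = act_lim (?n' ** (weyl ** ?p)) y"
    using nw(4) b unfolding weyl_unip[OF b] by (intro act_lim_scalar nw y) simp_all
  also have "\<dots> = P_op 1 (inverse b) (act_lim weyl (P_op (- (b\<^sup>2)) (- b) y))"
    by (simp only: act_lim_mult[OF n(2) nw(2) y] act_lim_mult[OF weyl_GL2K n(3) y] act_lim_P[OF b2 y]
        act_lim_P[OF one_neq_zero act_lim_in[OF weyl_GL2K act_lim_in[OF n(3) y, unfolded act_lim_P[OF b2 y]]]])
  finally show "act_lim weyl (P_op 1 b (act_lim weyl y)) =
      P_op 1 (inverse b) (act_lim weyl (P_op (- (b\<^sup>2)) (- b) y))" .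
next
  fix a b :: "'f fls" and y assume a: "a \<noteq> 0" and y: "y \<in> lim_Upsilon"
  show "P_op a b y \<in> lim_Upsilon" using act_lim_in[OF P_mat_GL2K[OF a] y] by (simp add: act_lim_P[OF a y])
next
  show "\<exists>L. \<forall>y\<in>lim_Upsilon. (\<forall>m f. \<bar>m\<bar> \<le> int L \<longrightarrow> f \<in> LC vF L \<longrightarrow> y m f = 0) \<longrightarrow>
       (\<forall>m f. \<bar>m\<bar> \<le> int N \<longrightarrow> f \<in> LC vF N \<longrightarrow> act_lim weyl y m f = 0)" for N
    by (rule act_lim_continuous[OF weyl_GL2K])
qed

end

theorem corollary11p2:
  fixes vF :: "'f::field \<Rightarrow> int" and \<theta> :: "'f \<Rightarrow> complex"
  assumes "nonarch_local_field vF"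
    and "odd (residue_char vF)"
    and "additive_char vF \<theta>"
  shows "\<not> (\<exists>(V :: 'v::ab_group_add prospace) \<alpha>.
              smooth_rep vF V \<alpha> \<and> restricts_to_Upsilon vF \<theta> V \<alpha>)"
proof
  assume "\<exists>(V :: 'v prospace) \<alpha>. smooth_rep vF V \<alpha> \<and> restricts_to_Upsilon vF \<theta> V \<alpha>"
  then obtain V :: "'v prospace" and \<alpha> where smooth: "smooth_rep vF V \<alpha>" and "restricts_to_Upsilon vF \<theta> V \<alpha>"
    by blast
  then obtain \<Phi> where iso: "pro_iso V (Upsilon vF) \<Phi>"
    and equiv: "\<And>a b. a \<noteq> 0 \<Longrightarrow> pro_eq V (pro_comp \<Phi> (G_act \<alpha> (P_mat (a, b))))
                   (pro_comp (Upsilon_act vF \<theta> (a, b)) \<Phi>)"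
    unfolding restricts_to_Upsilon_def by blast
  then obtain \<Psi> where *: "pro_mor V (Upsilon vF) \<Phi>" "pro_mor (Upsilon vF) V \<Psi>"
      "pro_eq V (pro_comp \<Psi> \<Phi>) pro_id" "pro_eq (Upsilon vF) (pro_comp \<Phi> \<Psi>) pro_id"
    unfolding pro_iso_def by blast
  interpret nonarch_local_field vF by fact
  interpret local_Upsilon_extension vF V \<alpha> \<theta> \<Phi> \<Psi>
    by unfold_locales (fact smooth * equiv assms)+
  interpret weyl_operator vF \<theta> "act_lim weyl" by (rule weyl_operator)
  show False by (rule no_weyl_operator)
qed

end
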